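(* For every state $\rho_{AB}$ on a finite-dimensional system $\mathcal{H}_A\otimes\mathcal{H}_B$, $$2E^C_{\rm sq}(\rho_{AB})\ \ge\ 2\big(E^C_{\rm sq}\big)^{(\infty)}(\rho_{AB})\ \ge\ I_b^{(\infty)}(\rho_{AB})\ \ge\ 2E_I(\rho_{AB})\ \ge\ 2E^Q_{\rm sq}(\rho_{AB}).$$
   Context: Mutual information $I(X:Y)_\rho=S(X)+S(Y)-S(XY)$ (von Neumann entropies, base 2). An extension of $\rho_{AB}$ is a state on $AB$ plus further systems whose reduced state on $AB$ is $\rho_{AB}$. Squashed entanglement: $E^Q_{\rm sq}(\rho_{AB})=\frac12\inf_{\rho_{ABE}}\big(I(A:BE)_\rho-I(A:E)_\rho\big)$ over all extensions $\rho_{ABE}$. Conditional entanglement of mutual information: $E_I(\rho_{AB})=\frac12\inf_{\rho_{ABA'B'}}\big(I(AA':BB')_\rho-I(A':B')_\rho\big)$ over all extensions $\rho_{ABA'B'}$. Classical squashed entanglement: $E^C_{\rm sq}(\rho_{AB})=\frac12\min\big(I(A:B\hat E)_\rho-I(A:\hat E)_\rho\big)$ over extensions of the form $\rho_{AB\hat E}=\sum_kp_k\rho^k_{AB}\otimes|k\rangle\langle k|_{\hat E}$ (classical on $\hat E$). The regularization is $(E^C_{\rm sq})^{(\infty)}(\rho_{AB})=\lim_n\frac1nE^C_{\rm sq}(\rho_{AB}^{\otimes n})$ (with $\rho_{AB}^{\otimes n}$ viewed as a state of $A^n$ versus $B^n$). An $n$-copy broadcast state of $\rho_{AB}$ is a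 state on $A_1B_1\cdots A_nB_n$ whose reduced state on each $A_kB_k$ is $\rho_{AB}$; $(I_b)_n(\rho_{AB})$ is the minimum of $I(A_1\cdots A_n:B_1\cdots B_n)$ over such states and $I_b^{(\infty)}=\lim_n\frac1n(I_b)_n$. *)

theory Defs
  imports Complex_Main "Jordan_Normal_Form.Char_Poly"
begin

text \<open>A composite system is described by the list ds of local dimensions
  (system 0, system 1, ...).  Its Hilbert space has dimension prod_list ds and
  basis indices are encoded in mixed radix, big-endian, consistent with the
  Kronecker product below.\<close>

definition dig :: "nat list \<Rightarrow> nat \<Rightarrow> nat \<Rightarrow> nat" where
  "dig ds k p = (k div prod_list (drop (Suc p) ds)) mod (ds ! p)"

definition enc :: "nat list \<Rightarrow> nat list \<Rightarrow> nat" where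
  "enc ds xs = (\<Sum>p<length ds. xs ! p * prod_list (drop (Suc p) ds))"

definition restr :: "nat list \<Rightarrow> nat set \<Rightarrow> nat \<Rightarrow> nat" where
  "restr ds S k = enc (nths ds S) (nths (map (dig ds k) [0..<length ds]) S)"

text \<open>Partial trace: reduced state on the subsystems whose positions lie in S
  (tracing out all other subsystems).\<close>
definition ptrace :: "nat list \<Rightarrow> nat set \<Rightarrow> complex mat \<Rightarrow> complex mat" where
  "ptrace ds S \<rho> = mat (prod_list (nths ds S)) (prod_list (nths ds S))
     (\<lambda>(i,j). \<Sum>k<prod_list ds. \<Sum>l<prod_list ds.
        if restr ds S k = i \<and> restr ds S l = j \<and>
           (\<forall>p<length ds. p \<notin> S \<longrightarrow> dig ds k p = dig ds l p)
        then \<rho> $$ (k,l) else 0)"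

definition kron :: "complex mat \<Rightarrow> complex mat \<Rightarrow> complex mat" where
  "kron A B = mat (dim_row A * dim_row B) (dim_col A * dim_col B)
     (\<lambda>(i,j). A $$ (i div dim_row B, j div dim_col B) * B $$ (i mod dim_row B, j mod dim_col B))"

definition is_density :: "nat \<Rightarrow> complex mat \<Rightarrow> bool" where
  "is_density d \<rho> \<longleftrightarrow> \<rho> \<in> carrier_mat d d \<and> (\<Sum>i<d. \<rho> $$ (i,i)) = 1 \<and>
     (\<forall>v :: nat \<Rightarrow> complex. \<exists>r::real. r \<ge> 0 \<and>
        (\<Sum>i<d. \<Sum>j<d. cnj (v i) * \<rho> $$ (i,j) * v j) = complex_of_real r)"

definition state :: "nat list \<Rightarrow> complex mat \<Rightarrow> bool" where
  "state ds \<rho> \<longleftrightarrow> is_density (prod_list ds) \<rho>"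

definition eigs :: "complex mat \<Rightarrow> complex multiset" where
  "eigs A = (SOME M. char_poly A = (\<Prod>a\<in>#M. [:- a, 1:]))"

text \<open>Von Neumann entropy, base 2 (note 0 * log 2 0 = 0 in Isabelle).\<close>
definition vN_entropy :: "complex mat \<Rightarrow> real" where
  "vN_entropy \<rho> = - (\<Sum>a\<in>#eigs \<rho>. Re a * log 2 (Re a))"

definition ent :: "nat list \<Rightarrow> complex mat \<Rightarrow> nat set \<Rightarrow> real" where
  "ent ds \<rho> S = vN_entropy (ptrace ds S \<rho>)"

text \<open>I(X:Y) for disjoint sets of subsystems X, Y.\<close>
definition mutinf :: "nat list \<Rightarrow> complex mat \<Rightarrow> nat set \<Rightarrow> nat set \<Rightarrow> real" where
  "mutinf ds \<rho> X Y = ent ds \<rho> X + ent ds \<rho> Y - ent ds \<rho> (X \<union> Y)"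

definition is_ext :: "nat list \<Rightarrow> complex mat \<Rightarrow> nat list \<Rightarrow> complex mat \<Rightarrow> bool" where
  "is_ext ds \<rho> es \<sigma> \<longleftrightarrow> state (ds @ es) \<sigma> \<and> ptrace (ds @ es) {0..<length ds} \<sigma> = \<rho>"

definition Esq_Q :: "nat \<Rightarrow> nat \<Rightarrow> complex mat \<Rightarrow> real" where
  "Esq_Q dA dB \<rho> = 1/2 * Inf {mutinf [dA,dB,dE] \<sigma> {0} {1,2} - mutinf [dA,dB,dE] \<sigma> {0} {2}
      | dE \<sigma>. is_ext [dA,dB] \<rho> [dE] \<sigma>}"

text \<open>Conditional entanglement of mutual information; A'=system 2, B'=system 3.\<close>
definition E_I :: "nat \<Rightarrow> nat \<Rightarrow> complex mat \<Rightarrow> real" where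
  "E_I dA dB \<rho> = 1/2 * Inf {mutinf [dA,dB,a,b] \<sigma> {0,2} {1,3} - mutinf [dA,dB,a,b] \<sigma> {2} {3}
      | a b \<sigma>. is_ext [dA,dB] \<rho> [a,b] \<sigma>}"

definition proj :: "nat \<Rightarrow> nat \<Rightarrow> complex mat" where
  "proj K k = mat K K (\<lambda>(i,j). if i = k \<and> j = k then 1 else 0)"

text \<open>Classical squashed entanglement of a state on systems ds, bipartitioned
  into the A-part X and the B-part Y; the classical system E-hat is appended last.\<close>
definition Esq_C :: "nat list \<Rightarrow> nat set \<Rightarrow> nat set \<Rightarrow> complex mat \<Rightarrow> real" where
  "Esq_C ds X Y \<rho> = 1/2 * Inf {mutinf (ds @ [K]) \<sigma> X (Y \<union> {length ds}) - mutinf (ds @ [K]) \<sigma> X {length ds}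
      | K \<sigma> p R. (\<forall>k<K. p k \<ge> 0 \<and> state ds (R k)) \<and> (\<Sum>k<K. p k) = 1 \<and>
          \<sigma> = mat (prod_list ds * K) (prod_list ds * K)
                (\<lambda>(i,j). \<Sum>k<K. complex_of_real (p k) * kron (R k) (proj K k) $$ (i,j)) \<and>
          is_ext ds \<rho> [K] \<sigma>}"

definition nds :: "nat \<Rightarrow> nat \<Rightarrow> nat \<Rightarrow> nat list" where
  "nds dA dB n = concat (replicate n [dA, dB])"

definition Apos :: "nat \<Rightarrow> nat set" where "Apos n = {p. p < 2*n \<and> even p}"
definition Bpos :: "nat \<Rightarrow> nat set" where "Bpos n = {p. p < 2*n \<and> odd p}"

fun tpow :: "complex mat \<Rightarrow> nat \<Rightarrow> complex mat" where
  "tpow \<rho> 0 = 1\<^sub>m 1"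
| "tpow \<rho> (Suc n) = kron (tpow \<rho> n) \<rho>"

definition Esq_C_reg :: "nat \<Rightarrow> nat \<Rightarrow> complex mat \<Rightarrow> real" where
  "Esq_C_reg dA dB \<rho> = lim (\<lambda>n. Esq_C (nds dA dB n) (Apos n) (Bpos n) (tpow \<rho> n) / real n)"

definition Ib_n :: "nat \<Rightarrow> nat \<Rightarrow> complex mat \<Rightarrow> nat \<Rightarrow> real" where
  "Ib_n dA dB \<rho> n = Inf {mutinf (nds dA dB n) \<sigma> (Apos n) (Bpos n) | \<sigma>.
      state (nds dA dB n) \<sigma> \<and> (\<forall>k<n. ptrace (nds dA dB n) {2*k, 2*k+1} \<sigma> = \<rho>)}"

definition Ib_reg :: "nat \<Rightarrow> nat \<Rightarrow> complex mat \<Rightarrow> real" where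
  "Ib_reg dA dB \<rho> = lim (\<lambda>n. Ib_n dA dB \<rho> n / real n)"

end

theory Submission
  imports Defs
begin

text \<open>All four inequalities rest on strong subadditivity of the entropy. It is obtained from
  monotonicity of \<open>D(F \<parallel> S)\<close> under partial traces: \<open>D\<close> is the integral over \<open>t > 0\<close> of
  \<open>f\<^sub>t(F, S) - 1 / (1 + t)\<close>, where \<open>f\<^sub>t(F, S)\<close> is the supremum over all matrices \<open>M\<close> of
  \<open>2 Re Tr(F M) - Tr(S M M\<^sup>*) - t Tr(F M\<^sup>* M)\<close>; restricting to \<open>M \<otimes> 1\<close> gives the supremum for the
  reduced states. Entropies of mixtures follow by storing the mixing index in classical systems.

  The first inequality is subadditivity of \<open>Esq_C\<close> under tensor products together with Fekete's lemma.
  For the second, take an ensemble \<open>p k, R k\<close> of the \<open>m\<close>-fold power of the state; averaging a product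
  of about \<open>n p k\<close> copies of each \<open>R k\<close> over the \<open>n\<close> cyclic shifts gives a broadcast state of \<open>n m\<close>
  copies whose mutual information exceeds \<open>n (\<Sum>k. p k I(R k))\<close> only by \<open>O(log n)\<close>.
  For the third, the mutual information of a broadcast state telescopes over the copies, and in every
  increment the earlier copies serve as the extension \<open>A'B'\<close>. For the fourth, take \<open>E = A'B'\<close>.\<close>

subsection \<open>Spectral theorem for Hermitian matrices\<close>

text \<open>The integral is never formed. In eigenbases of \<open>F\<close> and \<open>S\<close> all
  quantities are finite sums with weights \<open>c\<close> of total 1, and
  \<open>c (ln (r + t p) - ln r)\<close> is a primitive of \<open>c p / (r + t p)\<close>;
  subtracting \<open>ln t\<close> and letting \<open>t\<close> tend to infinity leaves
  \<open>c (ln p - ln r)\<close>. Relative entropies are thus compared through real functions of one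
  variable, and no logarithm of an operator occurs. Zero eigenvalues of \<open>S\<close> would spoil
  both the supremum at \<open>t = 0\<close> and \<open>ln r\<close>, while marginals may be
  singular; hence the reference operator is \<open>1 \<otimes> (\<tau> + e)\<close>, with
  \<open>e\<close> tending to 0 at the end. The other obstacle is bookkeeping, since subsystems
  occur in every order and grouping. The entropy of a reduction depends only on which basis indices
  a label identifies, so strong subadditivity is stated for label functions, and permuting or
  merging tensor factors becomes a change of labels. Ensemble weights may be irrational, so block
  multiplicities are rounded, at a cost independent of \<open>n\<close>. Existence of the limits
  must be shown, as \<open>lim\<close> says nothing otherwise, and no infimum is assumed to be
  attained.\<close>

definition ip :: "'a set \<Rightarrow> ('a \<Rightarrow> complex) \<Rightarrow> ('a \<Rightarrow> complex) \<Rightarrow> complex" where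
  "ip I x y = (\<Sum>i\<in>I. cnj (x i) * y i)"

lemma ip_cnj: "cnj (ip I x y) = ip I y x"
  unfolding ip_def by (simp add: mult.commute)

lemma ip_scale_right: "ip I x (\<lambda>i. c * y i) = c * ip I x y"
  unfolding ip_def sum_distrib_left by (rule sum.cong) auto

lemma ip_scale_left: "ip I (\<lambda>i. c * x i) y = cnj c * ip I x y"
  unfolding ip_def sum_distrib_left by (rule sum.cong) auto

lemma ip_add_right: "ip I x (\<lambda>i. y i + z i) = ip I x y + ip I x z"
  unfolding ip_def sum.distrib[symmetric] by (rule sum.cong) (auto simp: algebra_simps)

lemma ip_self: "ip I x x = complex_of_real (\<Sum>i\<in>I. (cmod (x i))\<^sup>2)"
  unfolding ip_def of_real_sum
  by (rule sum.cong) (auto simp: complex_norm_square mult.commute simp del: of_real_power)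

lemma ip_self_pos:
  assumes "finite I" "i \<in> I" "x i \<noteq> 0"
  shows "(\<Sum>i\<in>I. (cmod (x i))\<^sup>2) > 0"
  using assms by (intro sum_pos2[of I i]) auto

text \<open>Padding the \<open>k\<close> equations with zero rows gives a square matrix; its
  transpose annihilates \<open>unit_vec n k\<close>, so the determinant is 0 and a nonzero solution
  exists.\<close>

lemma exists_null_vector:
  fixes M :: "nat \<Rightarrow> nat \<Rightarrow> complex"
  assumes "k < n"
  shows "\<exists>x. (\<exists>j<n. x j \<noteq> 0) \<and> (\<forall>j\<ge>n. x j = 0) \<and> (\<forall>i<k. (\<Sum>j<n. M i j * x j) = 0)"
proof -
  define A where "A = mat n n (\<lambda>(i,j). if i < k then M i j else 0)"
  have A: "A \<in> carrier_mat n n" unfolding A_def by simp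
  have "transpose_mat A *\<^sub>v unit_vec n k = 0\<^sub>v n"
    using assms unfolding A_def by (intro eq_vecI) (auto simp: scalar_prod_right_unit)
  moreover have "unit_vec n k \<noteq> (0\<^sub>v n :: complex vec)"
    using assms by auto
  moreover have "transpose_mat A \<in> carrier_mat n n" using A by simp
  ultimately have "det (transpose_mat A) = 0"
    using det_0_iff_vec_prod_zero unit_vec_carrier by metis
  then have "det A = 0" using det_transpose[OF A] by simp
  then obtain v where v: "v \<in> carrier_vec n" "v \<noteq> 0\<^sub>v n" "A *\<^sub>v v = 0\<^sub>v n"
    using det_0_iff_vec_prod_zero[OF A] by auto
  define x where "x j = (if j < n then v $ j else 0)" for j
  have nz: "\<exists>j<n. x j \<noteq> 0"
  proof (rule ccontr)
    assume "\<not> ?thesis"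
    then have "v = 0\<^sub>v n" using v(1) unfolding x_def by (intro eq_vecI) auto
    then show False using v by simp
  qed
  have "(\<Sum>j<n. M i j * x j) = 0" if i: "i < k" for i
  proof -
    have "(A *\<^sub>v v) $ i = (\<Sum>j<n. M i j * x j)"
      using i assms v(1) unfolding A_def x_def
      by (auto simp: scalar_prod_def lessThan_atLeast0 intro!: sum.cong)
    then show ?thesis using v(3) i assms by simp
  qed
  then show ?thesis using nz by (intro exI[of _ x]) (auto simp: x_def)
qed

text \<open>Set to 0 from \<open>n\<close> on, so that vectors of length \<open>n\<close> are
  compared as functions and iterates stay among them.\<close>

definition mv :: "nat \<Rightarrow> (nat \<Rightarrow> nat \<Rightarrow> complex) \<Rightarrow> (nat \<Rightarrow> complex) \<Rightarrow> nat \<Rightarrow> complex" where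
  "mv n A x i = (if i < n then \<Sum>j<n. A i j * x j else 0)"

lemma mv_lin: "mv n A (\<lambda>i. a * x i + b * y i) = (\<lambda>i. a * mv n A x i + b * mv n A y i)"
  unfolding mv_def by (auto simp: sum_distrib_left sum.distrib algebra_simps)

lemma mv_pow_lin:
  "(mv n A ^^ k) (\<lambda>i. a * x i + b * y i) = (\<lambda>i. a * (mv n A ^^ k) x i + b * (mv n A ^^ k) y i)"
  by (induction k) (auto simp: mv_lin)

text \<open>Splitting a linear factor off a polynomial annihilating \<open>x\<close> either reveals an eigenvector
  or moves to a nonzero vector annihilated by a polynomial of smaller degree.\<close>
lemma eigenvector_of_annihilator:
  fixes q :: "complex poly"
  assumes "q \<noteq> 0" "degree q \<le> N" "x \<in> W" "x \<noteq> (\<lambda>_. 0)"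
    and ann: "\<And>j. (\<Sum>i\<le>N. coeff q i * (mv n A ^^ i) x j) = 0"
    and lin: "\<And>x y a b. x \<in> W \<Longrightarrow> y \<in> W \<Longrightarrow> (\<lambda>i. a * x i + b * y i) \<in> W"
    and inv: "\<And>x. x \<in> W \<Longrightarrow> mv n A x \<in> W"
  shows "\<exists>y z. y \<in> W \<and> y \<noteq> (\<lambda>_. 0) \<and> mv n A y = (\<lambda>i. z * y i)"
  using assms(1-5)
proof (induction "degree q" arbitrary: q x N)
  case 0
  obtain c where c: "q = [:c:]" using 0(1) degree_eq_zeroE by metis
  have "c \<noteq> 0" using c 0 by auto
  have "(\<Sum>i\<le>N. coeff q i * (mv n A ^^ i) x j) = c * x j" for j
  proof -
    have "(\<Sum>i\<le>N. coeff q i * (mv n A ^^ i) x j) = (\<Sum>i\<in>{0}. coeff q i * (mv n A ^^ i) x j)"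
      using c by (intro sum.mono_neutral_right) (auto simp: coeff_pCons split: nat.splits)
    then show ?thesis using c by simp
  qed
  then have "x = (\<lambda>_. 0)" using 0 \<open>c \<noteq> 0\<close> by auto
  then show ?case using 0 by simp
next
  case (Suc d)
  have "\<not> constant (poly q)" using Suc(2) constant_degree by (metis nat.distinct(1))
  then obtain z where "poly q z = 0" using fundamental_theorem_of_algebra by blast
  then obtain q' where q': "q = [:-z, 1:] * q'" using poly_eq_0_iff_dvd by (metis dvdE)
  have q'0: "q' \<noteq> 0" using q' Suc by auto
  have deg: "degree q = Suc (degree q')" using q'0 unfolding q' by (subst degree_mult_eq) auto
  obtain N' where N': "N = Suc N'" using deg Suc(4) by (cases N) auto
  define y where "y = (\<lambda>i. 1 * mv n A x i + (-z) * x i)"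
  have yW: "y \<in> W" unfolding y_def by (intro lin inv Suc)
  have ann': "(\<Sum>i\<le>N'. coeff q' i * (mv n A ^^ i) y j) = 0" for j
  proof -
    have *: "(mv n A ^^ i) y j = (mv n A ^^ Suc i) x j - z * (mv n A ^^ i) x j" for i
      unfolding y_def mv_pow_lin by (simp add: funpow_swap1)
    have top: "coeff q' N = 0" using deg Suc(4) N' by (intro coeff_eq_0) auto
    have "0 = (\<Sum>i\<le>N. coeff q i * (mv n A ^^ i) x j)" using Suc by simp
    also have "\<dots> = (\<Sum>i\<le>N. coeff (pCons 0 q') i * (mv n A ^^ i) x j) - z * (\<Sum>i\<le>N. coeff q' i * (mv n A ^^ i) x j)"
      unfolding q' by (simp add: sum_distrib_left algebra_simps sum.distrib sum_subtractf sum_negf)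
    also have "(\<Sum>i\<le>N. coeff (pCons 0 q') i * (mv n A ^^ i) x j) = (\<Sum>i\<le>N'. coeff q' i * (mv n A ^^ Suc i) x j)"
      unfolding N' by (subst sum.atMost_Suc_shift) simp
    also have "(\<Sum>i\<le>N. coeff q' i * (mv n A ^^ i) x j) = (\<Sum>i\<le>N'. coeff q' i * (mv n A ^^ i) x j)"
      using top unfolding N' by simp
    finally show ?thesis unfolding * by (simp add: algebra_simps sum_distrib_left sum_subtractf)
  qed
  show ?case
  proof (cases "y = (\<lambda>_. 0)")
    case True
    then have "mv n A x = (\<lambda>i. z * x i)" unfolding y_def by (auto simp: fun_eq_iff algebra_simps)
    then show ?thesis using Suc by blast
  next
    case False
    show ?thesis using Suc(1)[of q' N' y] deg Suc(2,4) q'0 yW False ann' N' by auto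
  qed
qed

text \<open>Krylov argument: the \<open>n + 1\<close> iterates \<open>x, A x, ..., A^n x\<close>
  live in dimension \<open>n\<close>, so a nontrivial linear relation between them is an
  annihilating polynomial. Only iterates of one vector occur, so no basis of \<open>W\<close> has to
  be chosen.\<close>

lemma exists_eigenvector_in_subspace:
  assumes "x \<in> W" "x \<noteq> (\<lambda>_. 0)"
    and supp: "\<And>x i. x \<in> W \<Longrightarrow> i \<ge> n \<Longrightarrow> x i = 0"
    and lin: "\<And>x y a b. x \<in> W \<Longrightarrow> y \<in> W \<Longrightarrow> (\<lambda>i. a * x i + b * y i) \<in> W"
    and inv: "\<And>x. x \<in> W \<Longrightarrow> mv n A x \<in> W"
  shows "\<exists>y z. y \<in> W \<and> y \<noteq> (\<lambda>_. 0) \<and> mv n A y = (\<lambda>i. z * y i)"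
proof -
  obtain c where c: "\<exists>j<Suc n. c j \<noteq> 0" "\<And>j. j \<ge> Suc n \<Longrightarrow> c j = 0"
     "\<And>i. i < n \<Longrightarrow> (\<Sum>j<Suc n. (mv n A ^^ j) x i * c j) = 0"
    using exists_null_vector[OF lessI, of n "\<lambda>i j. (mv n A ^^ j) x i"] by blast
  define q where "q = Poly (map c [0..<Suc n])"
  have cq: "coeff q i = c i" for i unfolding q_def coeff_Poly nth_default_def using c(2)[of i]
    by (auto simp del: upt_Suc)
  have q0: "q \<noteq> 0" using c(1) cq by (metis coeff_0)
  have deg: "degree q \<le> n" by (rule degree_le) (auto simp: cq c(2))
  have W: "(mv n A ^^ i) x \<in> W" for i by (induction i) (auto simp: assms inv)
  have "(\<Sum>i\<le>n. coeff q i * (mv n A ^^ i) x j) = 0" for j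
  proof (cases "j < n")
    case True
    then show ?thesis using c(3)[OF True] unfolding cq lessThan_Suc_atMost by (simp add: mult.commute)
  next
    case False
    then show ?thesis using supp[OF W, of j] by simp
  qed
  then show ?thesis using eigenvector_of_annihilator[OF q0 deg assms(1,2) _ lin inv] by blast
qed

text \<open>Induction on the number \<open>k\<close> of eigenvectors: the orthogonal complement of
  those found so far is invariant because \<open>A\<close> is self-adjoint, and nonzero because only
  \<open>k < n\<close> conditions are imposed on \<open>n\<close> unknowns.\<close>

lemma hermitian_eigenbasis_aux:
  assumes herm: "\<And>i j. i < n \<Longrightarrow> j < n \<Longrightarrow> A j i = cnj (A i j)"
  shows "k \<le> n \<Longrightarrow> \<exists>u p. (\<forall>i<k. \<forall>j<k. ip {..<n} (u i) (u j) = (if i = j then 1 else 0))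
     \<and> (\<forall>i<k. (\<forall>j\<ge>n. u i j = 0) \<and> mv n A (u i) = (\<lambda>j. complex_of_real (p i) * u i j))"
proof (induction k)
  case 0
  show ?case by simp
next
  case (Suc k)
  then obtain u p where on: "\<forall>i<k. \<forall>j<k. ip {..<n} (u i) (u j) = (if i = j then 1 else 0)"
    and ev: "\<forall>i<k. (\<forall>j\<ge>n. u i j = 0) \<and> mv n A (u i) = (\<lambda>j. complex_of_real (p i) * u i j)"
    by auto
  have sa: "ip {..<n} x (mv n A y) = ip {..<n} (mv n A x) y" for x y
  proof -
    have "ip {..<n} x (mv n A y) = (\<Sum>i<n. \<Sum>j<n. cnj (x i) * (A i j * y j))"
      unfolding ip_def mv_def by (auto simp: sum_distrib_left)
    also have "\<dots> = (\<Sum>j<n. \<Sum>i<n. cnj (x i) * (A i j * y j))" by (rule sum.swap)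
    also have "\<dots> = ip {..<n} (mv n A x) y"
      unfolding ip_def mv_def
    proof (intro sum.cong refl)
      fix j assume j: "j \<in> {..<n}"
      have "(\<Sum>i<n. cnj (x i) * (A i j * y j)) = (\<Sum>i<n. cnj (A j i * x i) * y j)"
      proof (intro sum.cong refl)
        fix i assume "i \<in> {..<n}"
        then have "cnj (A j i) = A i j" using herm[of i j] j by simp
        then show "cnj (x i) * (A i j * y j) = cnj (A j i * x i) * y j" by simp
      qed
      then show "(\<Sum>i<n. cnj (x i) * (A i j * y j)) = cnj (if j < n then \<Sum>i<n. A j i * x i else 0) * y j"
        using j by (simp add: sum_distrib_right)
    qed
    finally show ?thesis .
  qed
  have kn: "k < n" using Suc by simp
  define W where "W = {y. (\<forall>j\<ge>n. y j = 0) \<and> (\<forall>i<k. ip {..<n} (u i) y = 0)}"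
  obtain x where x: "\<exists>j<n. x j \<noteq> 0" "\<And>j. j \<ge> n \<Longrightarrow> x j = 0" "\<And>i. i < k \<Longrightarrow> (\<Sum>j<n. cnj (u i j) * x j) = 0"
    using exists_null_vector[OF kn, of "\<lambda>i j. cnj (u i j)"] by blast
  have "x \<in> W" using x unfolding W_def ip_def by auto
  moreover have "x \<noteq> (\<lambda>_. 0)" using x by auto
  ultimately have "\<exists>y z. y \<in> W \<and> y \<noteq> (\<lambda>_. 0) \<and> mv n A y = (\<lambda>i. z * y i)"
  proof (rule exists_eigenvector_in_subspace)
    fix x i assume "x \<in> W" "i \<ge> n" then show "x i = 0" unfolding W_def by auto
  next
    fix x y a b assume "x \<in> W" "y \<in> W"
    then show "(\<lambda>i. a * x i + b * y i) \<in> W" unfolding W_def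
      by (auto simp: ip_add_right ip_scale_right)
  next
    fix x assume "x \<in> W"
    then show "mv n A x \<in> W" unfolding W_def using ev
      by (auto simp: sa ip_scale_left) (auto simp: mv_def)
  qed
  then obtain y z where y: "y \<in> W" "y \<noteq> (\<lambda>_. 0)" "mv n A y = (\<lambda>i. z * y i)" by blast
  then obtain j where j: "j < n" "y j \<noteq> 0" unfolding W_def
    by (metis (mono_tags, lifting) ext linorder_not_less mem_Collect_eq)
  define r where "r = (\<Sum>i<n. (cmod (y i))\<^sup>2)"
  have r: "r > 0" unfolding r_def using j by (intro ip_self_pos[of _ j]) auto
  have ipy: "ip {..<n} y y = complex_of_real r" unfolding r_def by (rule ip_self)
  have "z * complex_of_real r = cnj z * complex_of_real r"
    using sa[of y y] unfolding y(3) ip_scale_left ip_scale_right ipy by simp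
  then have "z = cnj z" using r by simp
  then have z: "z = complex_of_real (Re z)" by (metis Reals_cnj_iff of_real_Re)
  define w where "w = (\<lambda>i. complex_of_real (1 / sqrt r) * y i)"
  have ww: "ip {..<n} w w = 1" unfolding w_def ip_scale_left ip_scale_right ipy using r
    by (simp flip: of_real_mult)
  have uw: "ip {..<n} (u i) w = 0" if "i < k" for i
    unfolding w_def ip_scale_right using y(1) that unfolding W_def by simp
  have wu: "ip {..<n} w (u i) = 0" if "i < k" for i
    using uw[OF that] by (metis complex_cnj_zero ip_cnj)
  have ws: "w j = 0" if "j \<ge> n" for j using y(1) that unfolding W_def w_def by simp
  have mw: "mv n A w = (\<lambda>j. complex_of_real (Re z) * w j)"
    using mv_lin[of n A "complex_of_real (1 / sqrt r)" y 0 y] y(3) z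
    unfolding w_def by (auto simp: fun_eq_iff)
  have k2: "i < Suc k \<longleftrightarrow> i < k \<or> i = k" for i by auto
  show ?case
    by (rule exI[of _ "u(k := w)"], rule exI[of _ "p(k := Re z)"])
       (use on ev ww uw wu ws mw in \<open>auto simp: k2\<close>)
qed

text \<open>Orthonormality says \<open>V * U = 1\<close> for the square matrices of the family and
  its adjoint; a one-sided inverse of a square matrix is two-sided, which is completeness.\<close>

lemma orthonormal_complete:
  assumes on: "\<And>i j. i < n \<Longrightarrow> j < n \<Longrightarrow> ip {..<n} (u i) (u j) = (if i = j then 1 else 0)"
    and "x < n" "y < (n :: nat)"
  shows "(\<Sum>i<n. u i x * cnj (u i y)) = (if x = y then 1 else 0)"
proof -
  define U where "U = mat n n (\<lambda>(x,i). u i x)"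
  define V where "V = mat n n (\<lambda>(i,x). cnj (u i x))"
  have U: "U \<in> carrier_mat n n" and V: "V \<in> carrier_mat n n" unfolding U_def V_def by auto
  have "V * U = 1\<^sub>m n" unfolding U_def V_def
    using on by (intro eq_matI) (auto simp: scalar_prod_def ip_def lessThan_atLeast0)
  then have "U * V = 1\<^sub>m n" by (rule mat_mult_left_right_inverse[OF V U])
  then have "(U * V) $$ (x,y) = (1\<^sub>m n) $$ (x,y)" by simp
  then show ?thesis using assms(2,3) unfolding U_def V_def
    by (auto simp: scalar_prod_def lessThan_atLeast0)
qed

lemma hermitian_eigenbasis:
  fixes n :: nat
  assumes herm: "\<And>i j. i < n \<Longrightarrow> j < n \<Longrightarrow> A j i = cnj (A i j)"
  shows "\<exists>u (p :: nat \<Rightarrow> real). (\<forall>i<n. \<forall>j<n. ip {..<n} (u i) (u j) = (if i = j then 1 else 0)) \<and>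
    (\<forall>x<n. \<forall>y<n. (\<Sum>i<n. u i x * cnj (u i y)) = (if x = y then 1 else 0)) \<and>
    (\<forall>x<n. \<forall>y<n. A x y = (\<Sum>i<n. complex_of_real (p i) * u i x * cnj (u i y)))"
proof -
  have "\<exists>u p. (\<forall>i<n. \<forall>j<n. ip {..<n} (u i) (u j) = (if i = j then 1 else 0))
     \<and> (\<forall>i<n. (\<forall>j\<ge>n. u i j = 0) \<and> mv n A (u i) = (\<lambda>j. complex_of_real (p i) * u i j))"
    by (rule hermitian_eigenbasis_aux[where A = A and k = n and n = n, OF _ order_refl]) (rule herm)
  then obtain u p where H: "\<forall>i<n. \<forall>j<n. ip {..<n} (u i) (u j) = (if i = j then 1 else 0)"
    "\<forall>i<n. (\<forall>j\<ge>n. u i j = 0) \<and> mv n A (u i) = (\<lambda>j. complex_of_real (p i) * u i j)"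
    by (elim exE conjE)
  have on: "\<And>i j. i < n \<Longrightarrow> j < n \<Longrightarrow> ip {..<n} (u i) (u j) = (if i = j then 1 else 0)"
    and ev: "\<And>i. i < n \<Longrightarrow> mv n A (u i) = (\<lambda>j. complex_of_real (p i) * u i j)"
    using H by blast+
  have c: "(\<Sum>i<n. u i x * cnj (u i y)) = (if x = y then 1 else 0)" if "x < n" "y < n" for x y
    by (rule orthonormal_complete) (auto simp: on that)
  have "A x y = (\<Sum>i<n. complex_of_real (p i) * u i x * cnj (u i y))" if "x < n" "y < n" for x y
  proof -
    have "(\<Sum>i<n. complex_of_real (p i) * u i x * cnj (u i y)) = (\<Sum>i<n. mv n A (u i) x * cnj (u i y))"
      by (rule sum.cong) (auto simp: ev)
    also have "\<dots> = (\<Sum>i<n. \<Sum>j<n. A x j * (u i j * cnj (u i y)))"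
      unfolding mv_def using that by (simp add: sum_distrib_right mult.assoc)
    also have "\<dots> = (\<Sum>j<n. A x j * (\<Sum>i<n. u i j * cnj (u i y)))"
      unfolding sum_distrib_left by (rule sum.swap)
    also have "\<dots> = (\<Sum>j<n. A x j * (if j = y then 1 else 0))"
      using that by (intro sum.cong) (auto simp: c)
    also have "\<dots> = A x y" using that by (simp add: if_distrib cong: if_cong)
    finally show ?thesis by simp
  qed
  then show ?thesis using on c by (intro exI[of _ u] exI[of _ p]) auto
qed

subsection \<open>Entropy of finitely supported kernels\<close>

text \<open>The orthonormal family \<open>u\<close> need not span: eigenvectors with eigenvalue 0 may be omitted. Hence a
  decomposition over \<open>I\<close> is also one over every finite superset, and \<open>kent\<close> carries no index set.\<close>
definition sdec :: "'a set \<Rightarrow> ('a \<Rightarrow> 'a \<Rightarrow> complex) \<Rightarrow> 'j set \<Rightarrow> ('j \<Rightarrow> real) \<Rightarrow> ('j \<Rightarrow> 'a \<Rightarrow> complex) \<Rightarrow> bool" where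
  "sdec I F J p u \<longleftrightarrow> finite I \<and> finite J \<and> (\<forall>j\<in>J. \<forall>x. x \<notin> I \<longrightarrow> u j x = 0) \<and>
     (\<forall>j\<in>J. \<forall>k\<in>J. ip I (u j) (u k) = (if j = k then 1 else 0)) \<and>
     (\<forall>x y. F x y = (\<Sum>j\<in>J. complex_of_real (p j) * u j x * cnj (u j y)))"

definition eta :: "real \<Rightarrow> real" where
  "eta x = - (x * log 2 x)"

text \<open>Index sets in \<open>nat\<close> suffice for finite sums and keep the definition free of
  a quantifier over types; \<open>kent_eq\<close> extends it to decompositions over any index type.
  The description is justified by \<open>sdec_sum_unique\<close>.\<close>

definition kent :: "('a \<Rightarrow> 'a \<Rightarrow> complex) \<Rightarrow> real" where
  "kent F = (THE s. \<exists>I (J :: nat set) p u. sdec I F J p u \<and> s = (\<Sum>j\<in>J. eta (p j)))"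

definition dens :: "'a set \<Rightarrow> ('a \<Rightarrow> 'a \<Rightarrow> complex) \<Rightarrow> bool" where
  "dens I F \<longleftrightarrow> finite I \<and> (\<forall>x y. x \<notin> I \<or> y \<notin> I \<longrightarrow> F x y = 0) \<and> (\<Sum>x\<in>I. F x x) = 1 \<and>
     (\<forall>v. \<exists>r\<ge>0. (\<Sum>x\<in>I. \<Sum>y\<in>I. cnj (v x) * F x y * v y) = complex_of_real r)"

lemma eta_0 [simp]: "eta 0 = 0" and eta_1 [simp]: "eta 1 = 0"
  by (auto simp: eta_def)

lemma eta_nonneg: "0 \<le> x \<Longrightarrow> x \<le> 1 \<Longrightarrow> eta x \<ge> 0"
  unfolding eta_def by (cases "x = 0") (auto simp: mult_nonneg_nonpos)

lemma eta_mult: "0 \<le> x \<Longrightarrow> 0 \<le> y \<Longrightarrow> eta (x * y) = y * eta x + x * eta y"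
  unfolding eta_def by (cases "x = 0 \<or> y = 0") (auto simp: log_mult algebra_simps)

lemma sdecD:
  assumes "sdec I F J p u"
  shows "finite I" "finite J" "\<And>j x. j \<in> J \<Longrightarrow> x \<notin> I \<Longrightarrow> u j x = 0"
    "\<And>j k. j \<in> J \<Longrightarrow> k \<in> J \<Longrightarrow> ip I (u j) (u k) = (if j = k then 1 else 0)"
    "\<And>x y. F x y = (\<Sum>j\<in>J. complex_of_real (p j) * u j x * cnj (u j y))"
  using assms unfolding sdec_def by blast+

lemma ip_mono:
  assumes "finite I'" "I \<subseteq> I'" "\<And>x. x \<notin> I \<Longrightarrow> a x = 0"
  shows "ip I' a b = ip I a b"
  unfolding ip_def using assms by (intro sum.mono_neutral_right) auto

lemma sdec_mono:
  assumes "sdec I F J p u" "finite I'" "I \<subseteq> I'"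
  shows "sdec I' F J p u"
proof -
  note D = sdecD[OF assms(1)]
  have "ip I' (u j) (u k) = ip I (u j) (u k)" if "j \<in> J" for j k
    using D(3)[OF that] assms by (intro ip_mono) auto
  moreover have "u j x = 0" if "j \<in> J" "x \<notin> I'" for j x
    using D(3) that assms(3) by blast
  ultimately show ?thesis unfolding sdec_def using D assms(2) by auto
qed

lemma sdec_apply:
  assumes "sdec I F J p u"
  shows "(\<Sum>y\<in>I. F x y * v y) = (\<Sum>j\<in>J. complex_of_real (p j) * u j x * ip I (u j) v)"
proof -
  have "(\<Sum>y\<in>I. F x y * v y) = (\<Sum>y\<in>I. \<Sum>j\<in>J. complex_of_real (p j) * u j x * (cnj (u j y) * v y))"
    unfolding sdecD(5)[OF assms] by (simp add: sum_distrib_right mult.assoc)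
  also have "\<dots> = (\<Sum>j\<in>J. \<Sum>y\<in>I. complex_of_real (p j) * u j x * (cnj (u j y) * v y))"
    by (rule sum.swap)
  finally show ?thesis unfolding ip_def sum_distrib_left .
qed

lemma sdec_eigenvector:
  assumes "sdec I F J p u" "k \<in> J"
  shows "(\<Sum>y\<in>I. F x y * u k y) = complex_of_real (p k) * u k x"
proof -
  have "(\<Sum>y\<in>I. F x y * u k y) = (\<Sum>j\<in>J. complex_of_real (p j) * u j x * (if j = k then 1 else 0))"
    unfolding sdec_apply[OF assms(1)] using assms sdecD(4)[OF assms(1)] by (intro sum.cong) auto
  then show ?thesis using assms sdecD(2)[OF assms(1)] by (simp add: if_distrib cong: if_cong)
qed

lemma sdec_ip_eigenvector:
  assumes "sdec I F J p u" "k \<in> J"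
  shows "ip I v (\<lambda>x. \<Sum>y\<in>I. F x y * u k y) = complex_of_real (p k) * ip I v (u k)"
  unfolding sdec_eigenvector[OF assms] by (rule ip_scale_right)

lemma sdec_symmetric:
  assumes "sdec I F J p u"
  shows "ip I v (\<lambda>x. \<Sum>y\<in>I. F x y * w y) = cnj (ip I w (\<lambda>x. \<Sum>y\<in>I. F x y * v y))"
proof -
  have *: "ip I v (\<lambda>x. \<Sum>y\<in>I. F x y * w y) = (\<Sum>j\<in>J. complex_of_real (p j) * (ip I v (u j) * ip I (u j) w))" for v w
  proof -
    have "ip I v (\<lambda>x. \<Sum>y\<in>I. F x y * w y) = (\<Sum>x\<in>I. \<Sum>j\<in>J. complex_of_real (p j) * ip I (u j) w * (cnj (v x) * u j x))"
      unfolding ip_def[of I v] sdec_apply[OF assms] by (simp add: sum_distrib_left mult_ac)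
    also have "\<dots> = (\<Sum>j\<in>J. \<Sum>x\<in>I. complex_of_real (p j) * ip I (u j) w * (cnj (v x) * u j x))"
      by (rule sum.swap)
    also have "\<dots> = (\<Sum>j\<in>J. complex_of_real (p j) * (ip I v (u j) * ip I (u j) w))"
      unfolding ip_def[of I v] by (simp add: sum_distrib_left sum_distrib_right mult_ac)
    finally show ?thesis .
  qed
  show ?thesis unfolding * by (simp add: ip_cnj mult_ac)
qed

text \<open>Two spectral decompositions are related by the doubly (sub)stochastic weights
  \<open>\<bar>\<langle>u j, v k\<rangle>\<bar>\<^sup>2\<close>, which vanish unless the eigenvalues agree.\<close>
lemma sdec_sum_unique:
  assumes U: "sdec I F J p u" and V: "sdec I' F K q v" and g: "g (0::real) = (0::real)"
  shows "(\<Sum>j\<in>J. g (p j)) = (\<Sum>k\<in>K. g (q k))"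
proof -
  define L where "L = I \<union> I'"
  have L: "finite L" "I \<subseteq> L" "I' \<subseteq> L"
    unfolding L_def using sdecD(1)[OF assms(1)] sdecD(1)[OF assms(2)] by auto
  have U: "sdec L F J p u" by (rule sdec_mono[OF assms(1) L(1,2)])
  have V: "sdec L F K q v" by (rule sdec_mono[OF assms(2) L(1,3)])
  define w where "w j k = (cmod (ip L (u j) (v k)))\<^sup>2" for j k
  \<comment> \<open>Eigenvectors for different eigenvalues are orthogonal: both products equal
    \<open>\<langle>u j, F v k\<rangle>\<close>.\<close>
  have eq: "p j = q k" if "j \<in> J" "k \<in> K" "w j k \<noteq> 0" for j k
  proof -
    have "complex_of_real (p j) * ip L (u j) (v k) = complex_of_real (q k) * ip L (u j) (v k)"
      using sdec_ip_eigenvector[OF V that(2), of "u j"] sdec_symmetric[OF U, of "u j" "v k"]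
        sdec_ip_eigenvector[OF U that(1), of "v k"] by (simp add: ip_cnj)
    then show ?thesis using that(3) unfolding w_def by simp
  qed
  \<comment> \<open>The weights of one row sum to 1 only at a nonzero eigenvalue, since the other
    family may miss part of the kernel of \<open>F\<close>; at eigenvalue 0 the condition on
    \<open>g\<close> takes over. Stated for arbitrary families so that it serves rows and columns
    alike.\<close>
  have half: "(\<Sum>k\<in>K. w j k) = 1" if jJ: "j \<in> J" and "p j \<noteq> 0"
    and U: "sdec L F J p u" and V: "sdec L F K q v"
    and w: "w = (\<lambda>j k. (cmod (ip L (u j) (v k)))\<^sup>2)"
    and eq: "\<And>j k. j \<in> J \<Longrightarrow> k \<in> K \<Longrightarrow> w j k \<noteq> 0 \<Longrightarrow> p j = q k"
    for J :: "'x set" and K :: "'y set" and p q u v j w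
  proof -
    have "complex_of_real (p j) = ip L (u j) (\<lambda>x. \<Sum>y\<in>L. F x y * u j y)"
      unfolding sdec_ip_eigenvector[OF U jJ] using sdecD(4)[OF U jJ jJ] by simp
    also have "\<dots> = ip L (u j) (\<lambda>x. \<Sum>k\<in>K. complex_of_real (q k) * v k x * ip L (v k) (u j))"
      unfolding sdec_apply[OF V] ..
    also have "\<dots> = (\<Sum>x\<in>L. \<Sum>k\<in>K. complex_of_real (q k) * ip L (v k) (u j) * (cnj (u j x) * v k x))"
      unfolding ip_def[of L "u j"] by (simp add: sum_distrib_left mult_ac)
    also have "\<dots> = (\<Sum>k\<in>K. \<Sum>x\<in>L. complex_of_real (q k) * ip L (v k) (u j) * (cnj (u j x) * v k x))"
      by (rule sum.swap)
    also have "\<dots> = (\<Sum>k\<in>K. complex_of_real (q k) * (ip L (v k) (u j) * ip L (u j) (v k)))"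
      unfolding ip_def[of L "u j"] by (simp add: sum_distrib_left mult_ac)
    also have "\<dots> = (\<Sum>k\<in>K. complex_of_real (q k * w j k))"
    proof (rule sum.cong)
      fix k
      have "ip L (v k) (u j) * ip L (u j) (v k) = complex_of_real (w j k)"
        unfolding w using ip_cnj[of L "u j" "v k"] complex_norm_square[of "ip L (u j) (v k)"]
        by (simp add: mult.commute)
      then show "complex_of_real (q k) * (ip L (v k) (u j) * ip L (u j) (v k)) = complex_of_real (q k * w j k)"
        by simp
    qed simp
    also have "\<dots> = (\<Sum>k\<in>K. complex_of_real (p j * w j k))"
      using eq[OF jJ] by (intro sum.cong) (metis mult_zero_right)+
    also have "\<dots> = complex_of_real (p j * (\<Sum>k\<in>K. w j k))"
      by (simp add: sum_distrib_left)
    finally have "p j = p j * (\<Sum>k\<in>K. w j k)" by (metis of_real_eq_iff)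
    then show ?thesis using \<open>p j \<noteq> 0\<close> by simp
  qed
  have wsym: "w j k = (cmod (ip L (v k) (u j)))\<^sup>2" for j k
    unfolding w_def by (metis ip_cnj complex_mod_cnj)
  have "(\<Sum>j\<in>J. g (p j)) = (\<Sum>j\<in>J. \<Sum>k\<in>K. w j k * g (p j))"
  proof (rule sum.cong)
    fix j assume "j \<in> J"
    then show "g (p j) = (\<Sum>k\<in>K. w j k * g (p j))"
      using half[of j J p u K q v w] U V eq w_def g
      by (cases "p j = 0") (auto simp: fun_eq_iff simp flip: sum_distrib_right)
  qed simp
  also have "\<dots> = (\<Sum>j\<in>J. \<Sum>k\<in>K. w j k * g (q k))"
    using eq by (intro sum.cong) (metis mult_zero_left)+
  also have "\<dots> = (\<Sum>k\<in>K. \<Sum>j\<in>J. w j k * g (q k))" by (rule sum.swap)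
  also have "\<dots> = (\<Sum>k\<in>K. g (q k))"
  proof (rule sum.cong)
    fix k assume "k \<in> K"
    then show "(\<Sum>j\<in>J. w j k * g (q k)) = g (q k)"
      using half[of k K q v J p u "\<lambda>k j. w j k"] U V eq wsym g
      by (cases "q k = 0") (auto simp: fun_eq_iff simp flip: sum_distrib_right)
  qed simp
  finally show ?thesis .
qed

lemma sdec_reindex:
  assumes "sdec I F J p u" "bij_betw h K J"
  shows "sdec I F K (\<lambda>k. p (h k)) (\<lambda>k. u (h k))"
proof -
  note D = sdecD[OF assms(1)]
  have "F x y = (\<Sum>k\<in>K. complex_of_real (p (h k)) * u (h k) x * cnj (u (h k) y))" for x y
    unfolding D(5) by (rule sum.reindex_bij_betw[OF assms(2), symmetric])
  moreover have "finite K" using D(2) assms(2) bij_betw_finite by blast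
  ultimately show ?thesis using D assms(2) unfolding sdec_def
    by (auto dest: bij_betwE simp: bij_betw_def inj_on_eq_iff)
qed

lemma kent_eq:
  assumes "sdec I F J p u"
  shows "kent F = (\<Sum>j\<in>J. eta (p j))"
proof -
  obtain h where h: "bij_betw h {0..<card J} J"
    using ex_bij_betw_nat_finite sdecD(2)[OF assms] by blast
  have "sdec I F {0..<card J} (\<lambda>k. p (h k)) (\<lambda>k. u (h k))"
    using sdec_reindex[OF assms h] .
  then have "\<exists>I (K :: nat set) p' u'. sdec I F K p' u' \<and> (\<Sum>j\<in>J. eta (p j)) = (\<Sum>j\<in>K. eta (p' j))"
    using sum.reindex_bij_betw[OF h, of "\<lambda>j. eta (p j)", symmetric] by blast
  then show ?thesis unfolding kent_def
  proof (rule the_equality)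
    fix s assume "\<exists>I J p u. sdec I F (J::nat set) p u \<and> s = (\<Sum>j\<in>J. eta (p j))"
    then show "s = (\<Sum>j\<in>J. eta (p j))" using sdec_sum_unique[OF _ assms, where g = eta] by auto
  qed
qed

text \<open>Polarisation: the quadratic form is real at the basis vectors and at
  \<open>e_x + e_y\<close> and \<open>e_x + \<i> e_y\<close>. The last two make the imaginary part
  of \<open>F x y + F y x\<close> and the real part of \<open>F x y - F y x\<close> vanish.\<close>

lemma psd_hermitian:
  assumes psd: "\<And>v. \<exists>r\<ge>0. (\<Sum>x\<in>I. \<Sum>y\<in>I. cnj (v x) * F x y * v y) = complex_of_real r"
    and "finite I" "x \<in> I" "y \<in> I"
  shows "F y x = cnj (F x y)"
proof -
  have q: "(\<Sum>a\<in>I. \<Sum>b\<in>I. cnj (v a) * F a b * v b) \<in> \<real>" for v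
    using psd[of v] by (metis Reals_of_real)
  have diag: "F z z \<in> \<real>" if "z \<in> I" for z
  proof -
    define v :: "'a \<Rightarrow> complex" where "v a = (if a = z then 1 else 0)" for a
    have "(\<Sum>a\<in>I. \<Sum>b\<in>I. cnj (v a) * F a b * v b) = (\<Sum>a\<in>{z}. \<Sum>b\<in>{z}. cnj (v a) * F a b * v b)"
      using that \<open>finite I\<close>
      by (intro sum.mono_neutral_cong_right ballI) (auto simp: v_def intro!: sum.mono_neutral_cong_right)
    then show ?thesis using q[of v] by (simp add: v_def)
  qed
  show ?thesis
  proof (cases "x = y")
    case True
    then show ?thesis using diag[OF assms(3)] by (simp add: Reals_cnj_iff)
  next
    case False
    have Q: "F x x + c * F x y + cnj c * F y x + cnj c * c * F y y \<in> \<real>" for c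
    proof -
      define v where "v a = (if a = x then 1 else if a = y then c else 0)" for a
      have "(\<Sum>a\<in>I. \<Sum>b\<in>I. cnj (v a) * F a b * v b) = (\<Sum>a\<in>{x,y}. \<Sum>b\<in>{x,y}. cnj (v a) * F a b * v b)"
        using assms(2-4) by (intro sum.mono_neutral_cong_right ballI) (auto simp: v_def intro!: sum.mono_neutral_cong_right)
      also have "\<dots> = F x x + c * F x y + cnj c * F y x + cnj c * c * F y y"
        using False by (simp add: v_def algebra_simps)
      finally show ?thesis using q[of v] by simp
    qed
    have "F x y + F y x \<in> \<real>" using Q[of 1] diag[OF assms(3)] diag[OF assms(4)]
      by (auto simp: complex_is_Real_iff)
    moreover have "\<i> * F x y - \<i> * F y x \<in> \<real>" using Q[of \<i>] diag[OF assms(3)] diag[OF assms(4)]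
      by (auto simp: complex_is_Real_iff)
    ultimately show ?thesis by (auto simp: complex_is_Real_iff complex_eq_iff)
  qed
qed

lemma sdec_trace:
  assumes "sdec I F J p u"
  shows "(\<Sum>x\<in>I. F x x) = complex_of_real (\<Sum>j\<in>J. p j)"
proof -
  note D = sdecD[OF assms]
  have "(\<Sum>x\<in>I. F x x) = (\<Sum>x\<in>I. \<Sum>j\<in>J. complex_of_real (p j) * (cnj (u j x) * u j x))"
    unfolding D(5) by (simp add: mult_ac)
  also have "\<dots> = (\<Sum>j\<in>J. complex_of_real (p j) * ip I (u j) (u j))"
    unfolding ip_def sum_distrib_left by (rule sum.swap)
  finally show ?thesis using D(4) by simp
qed

lemma sdec_quadratic_form:
  assumes "sdec I F J p u"
  shows "(\<Sum>x\<in>I. \<Sum>y\<in>I. cnj (v x) * F x y * v y) = complex_of_real (\<Sum>j\<in>J. p j * (cmod (ip I (u j) v))\<^sup>2)"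
proof -
  have "(\<Sum>x\<in>I. \<Sum>y\<in>I. cnj (v x) * F x y * v y) = (\<Sum>x\<in>I. \<Sum>j\<in>J. complex_of_real (p j) * ip I (u j) v * (cnj (v x) * u j x))"
  proof (rule sum.cong)
    fix x
    have "(\<Sum>y\<in>I. cnj (v x) * F x y * v y) = cnj (v x) * (\<Sum>y\<in>I. F x y * v y)"
      by (simp add: sum_distrib_left mult_ac)
    then show "(\<Sum>y\<in>I. cnj (v x) * F x y * v y) = (\<Sum>j\<in>J. complex_of_real (p j) * ip I (u j) v * (cnj (v x) * u j x))"
      unfolding sdec_apply[OF assms] by (simp add: sum_distrib_left mult_ac)
  qed simp
  also have "\<dots> = (\<Sum>j\<in>J. \<Sum>x\<in>I. complex_of_real (p j) * ip I (u j) v * (cnj (v x) * u j x))"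
    by (rule sum.swap)
  also have "\<dots> = (\<Sum>j\<in>J. complex_of_real (p j) * (ip I (u j) v * ip I v (u j)))"
    unfolding ip_def[of I v] by (simp add: sum_distrib_left mult_ac)
  also have "\<dots> = (\<Sum>j\<in>J. complex_of_real (p j * (cmod (ip I (u j) v))\<^sup>2))"
    by (intro sum.cong) (auto simp: ip_cnj[symmetric, of I v] complex_norm_square simp del: of_real_power)
  finally show ?thesis by simp
qed

lemma sdec_dens_nonneg:
  assumes "sdec I F J p u" "dens I F" "j \<in> J"
  shows "p j \<ge> 0"
proof -
  have "(\<Sum>x\<in>I. \<Sum>y\<in>I. cnj (u j x) * F x y * u j y) = complex_of_real (\<Sum>k\<in>J. p k * (cmod (ip I (u k) (u j)))\<^sup>2)"
    by (rule sdec_quadratic_form[OF assms(1)])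
  also have "(\<Sum>k\<in>J. p k * (cmod (ip I (u k) (u j)))\<^sup>2) = (\<Sum>k\<in>J. if k = j then p k else 0)"
    using sdecD(4)[OF assms(1)] assms(3) by (intro sum.cong) auto
  also have "\<dots> = p j" using assms sdecD(2)[OF assms(1)] by simp
  finally show ?thesis using assms(2) unfolding dens_def by (metis of_real_eq_iff)
qed

lemma sdec_dens_sum:
  assumes "sdec I F J p u" "dens I F"
  shows "(\<Sum>j\<in>J. p j) = 1"
  using sdec_trace[OF assms(1)] assms(2) unfolding dens_def by (metis of_real_eq_1_iff)

lemma sdec_densI:
  assumes "sdec I F J p u" "\<And>j. j \<in> J \<Longrightarrow> p j \<ge> 0" "(\<Sum>j\<in>J. p j) = 1"
  shows "dens I F"
proof -
  note D = sdecD[OF assms(1)]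
  have "\<exists>r\<ge>0. (\<Sum>x\<in>I. \<Sum>y\<in>I. cnj (v x) * F x y * v y) = complex_of_real r" for v
    using assms(2) by (intro exI[of _ "\<Sum>j\<in>J. p j * (cmod (ip I (u j) v))\<^sup>2"] conjI sdec_quadratic_form[OF assms(1)] sum_nonneg) simp
  moreover have "(\<Sum>x\<in>I. F x x) = 1" using sdec_trace[OF assms(1)] assms(3) by simp
  moreover have "F x y = 0" if "x \<notin> I \<or> y \<notin> I" for x y
    unfolding D(5) using D(3) that by (intro sum.neutral) auto
  ultimately show ?thesis using D(1) unfolding dens_def by blast
qed

text \<open>Relative entropy calls for complete bases: the shifted operator
  \<open>\<tau> + e\<close> has eigenvalue \<open>e\<close> on the kernel of \<open>\<tau>\<close>,
  so kernel vectors may no longer be omitted.\<close>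

definition sdec_full where
  "sdec_full I F J p u \<longleftrightarrow> sdec I F J p u \<and>
    (\<forall>x\<in>I. \<forall>y\<in>I. (\<Sum>j\<in>J. u j x * cnj (u j y)) = (if x = y then 1 else 0))"

lemma sdec_full_exists:
  assumes "dens I F"
  shows "\<exists>p u. sdec_full I F {..<card I} p u"
proof -
  have fin: "finite I" using assms dens_def by blast
  define n where "n = card I"
  obtain h where h: "bij_betw h {0..<n} I"
    using ex_bij_betw_nat_finite[OF fin] unfolding n_def by blast
  define g where "g = the_inv_into {..<n} h"
  have h: "bij_betw h {..<n} I" using h by (simp add: lessThan_atLeast0)
  have g: "bij_betw g I {..<n}" unfolding g_def by (rule bij_betw_the_inv_into[OF h])
  have hg: "h (g x) = x" if "x \<in> I" for x
    using that h unfolding g_def bij_betw_def by (auto intro: f_the_inv_into_f)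
  have gI: "g x < n" if "x \<in> I" for x using g that bij_betwE by blast
  have hI: "h i \<in> I" if "i < n" for i using h that bij_betwE by blast
  define A where "A i j = F (h i) (h j)" for i j
  have A: "A j i = cnj (A i j)" if "i < n" "j < n" for i j
    unfolding A_def using assms fin hI that unfolding dens_def by (intro psd_hermitian[where I = I]) auto
  have "\<exists>u (p :: nat \<Rightarrow> real). (\<forall>i<n. \<forall>j<n. ip {..<n} (u i) (u j) = (if i = j then 1 else 0)) \<and>
    (\<forall>x<n. \<forall>y<n. (\<Sum>i<n. u i x * cnj (u i y)) = (if x = y then 1 else 0)) \<and>
    (\<forall>x<n. \<forall>y<n. A x y = (\<Sum>i<n. complex_of_real (p i) * u i x * cnj (u i y)))"
    by (rule hermitian_eigenbasis, rule A)
  then obtain u and p :: "nat \<Rightarrow> real"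
    where u: "\<forall>i<n. \<forall>j<n. ip {..<n} (u i) (u j) = (if i = j then 1 else 0)"
      "\<forall>x<n. \<forall>y<n. (\<Sum>i<n. u i x * cnj (u i y)) = (if x = y then 1 else 0)"
      "\<forall>x<n. \<forall>y<n. A x y = (\<Sum>i<n. complex_of_real (p i) * u i x * cnj (u i y))"
    by (elim exE conjE)
  define w where "w j x = (if x \<in> I then u j (g x) else 0)" for j x
  have ipw: "ip I (w i) (w j) = ip {..<n} (u i) (u j)" for i j
    unfolding ip_def w_def
    using sum.reindex_bij_betw[OF g, of "\<lambda>x. cnj (u i x) * u j x"] by simp
  have "F x y = (\<Sum>j<n. complex_of_real (p j) * w j x * cnj (w j y))" for x y
  proof (cases "x \<in> I \<and> y \<in> I")
    case True
    then have "F x y = A (g x) (g y)" unfolding A_def using hg by simp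
    then show ?thesis using True u(3) gI unfolding w_def by simp
  next
    case False
    then show ?thesis using assms unfolding dens_def w_def by auto
  qed
  then have "sdec I F {..<n} p w" unfolding sdec_def using ipw u(1) fin by (auto simp: w_def)
  moreover have "(\<Sum>j<n. w j x * cnj (w j y)) = (if x = y then 1 else 0)" if "x \<in> I" "y \<in> I" for x y
  proof -
    have "(\<Sum>j<n. w j x * cnj (w j y)) = (\<Sum>j<n. u j (g x) * cnj (u j (g y)))"
      unfolding w_def using that by simp
    also have "\<dots> = (if g x = g y then 1 else 0)"
      using u(2) gI[OF that(1)] gI[OF that(2)] by blast
    also have "g x = g y \<longleftrightarrow> x = y" using hg[OF that(1)] hg[OF that(2)] by metis
    finally show ?thesis .
  qed
  ultimately have "sdec_full I F {..<n} p w" unfolding sdec_full_def by blast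
  then show ?thesis unfolding n_def by blast
qed

lemma dens_sdec_exists:
  assumes "dens I F"
  obtains p u where "sdec I F {..<card I} p u"
  using sdec_full_exists[OF assms] unfolding sdec_full_def by blast

lemma kent_nonneg:
  assumes "dens I F"
  shows "kent F \<ge> 0"
proof -
  obtain p u where s: "sdec I F {..<card I} p u" using dens_sdec_exists[OF assms] .
  have "p j \<le> 1" if "j < card I" for j
    using member_le_sum[of j "{..<card I}" p] sdec_dens_nonneg[OF s assms] sdec_dens_sum[OF s assms] that by auto
  then show ?thesis unfolding kent_eq[OF s]
    using sdec_dens_nonneg[OF s assms] by (intro sum_nonneg eta_nonneg) auto
qed

text \<open>Comparison with the uniform distribution: \<open>ln x \<le> x - 1\<close> at
  \<open>x = 1 / (n * p j)\<close>, summed over \<open>j\<close>.\<close>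

lemma sum_eta_le_log_card:
  assumes "finite J" "\<And>j. j \<in> J \<Longrightarrow> p j \<ge> 0" "(\<Sum>j\<in>J. p j) = 1"
  shows "(\<Sum>j\<in>J. eta (p j)) \<le> log 2 (card J)"
proof -
  define n where "n = real (card J)"
  have J: "J \<noteq> {}" using assms(3) by auto
  then have n: "n > 0" unfolding n_def using assms(1) by (simp add: card_gt_0_iff)
  have "eta (p j) - p j * log 2 n \<le> (1 / n - p j) / ln 2" if j: "j \<in> J" for j
  proof (cases "p j = 0")
    case False
    then have pj: "p j > 0" using assms(2)[OF j] by simp
    have "eta (p j) - p j * log 2 n = p j * ln (1 / (n * p j)) / ln 2"
      unfolding eta_def log_def using pj n by (simp add: ln_div ln_mult field_simps)
    also have "\<dots> \<le> p j * (1 / (n * p j) - 1) / ln 2"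
      using pj n by (intro divide_right_mono mult_left_mono ln_le_minus_one) auto
    also have "\<dots> = (1 / n - p j) / ln 2" using pj n by (simp add: field_simps)
    finally show ?thesis .
  qed (use n in auto)
  then have "(\<Sum>j\<in>J. eta (p j) - p j * log 2 n) \<le> (\<Sum>j\<in>J. (1 / n - p j) / ln 2)"
    by (rule sum_mono)
  also have "\<dots> = 0"
    using n J assms(1,3) unfolding sum_divide_distrib[symmetric] sum_subtractf by (simp add: n_def)
  finally show ?thesis using assms(3) unfolding n_def sum_subtractf sum_distrib_right[symmetric] by simp
qed

lemma kent_le_log_card:
  assumes "dens I F"
  shows "kent F \<le> log 2 (card I)"
proof -
  obtain p u where s: "sdec I F {..<card I} p u" using dens_sdec_exists[OF assms] .
  show ?thesis unfolding kent_eq[OF s]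
    using sum_eta_le_log_card[of "{..<card I}" p] sdec_dens_nonneg[OF s assms] sdec_dens_sum[OF s assms] by auto
qed

text \<open>Spectral decompositions are carried along an injective relabelling of the index set.
  Identifications of index sets, such as mixed-radix encodings and reordered tuples, rest on
  this.\<close>

lemma kent_transfer:
  assumes "dens I F" "inj_on h I"
    "\<And>x y. x \<in> I \<Longrightarrow> y \<in> I \<Longrightarrow> G (h x) (h y) = F x y"
    "\<And>x y. x \<notin> h ` I \<or> y \<notin> h ` I \<Longrightarrow> G x y = 0"
  shows "kent G = kent F" "dens (h ` I) G"
proof -
  obtain p u where s: "sdec I F {..<card I} p u" using dens_sdec_exists[OF assms(1)] .
  note D = sdecD[OF s]
  define g where "g = the_inv_into I h"
  have gh: "g (h x) = x" if "x \<in> I" for x unfolding g_def using assms(2) that by (rule the_inv_into_f_f)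
  define w where "w j y = (if y \<in> h ` I then u j (g y) else 0)" for j y
  have ipw: "ip (h ` I) (w i) (w j) = ip I (u i) (u j)" for i j
    unfolding ip_def sum.reindex[OF assms(2)] by (rule sum.cong) (auto simp: w_def gh)
  have "G x y = (\<Sum>j<card I. complex_of_real (p j) * w j x * cnj (w j y))" for x y
  proof (cases "x \<in> h ` I \<and> y \<in> h ` I")
    case True
    then obtain a b where "x = h a" "y = h b" "a \<in> I" "b \<in> I" by auto
    then show ?thesis using assms(3)[of a b] D(5)[of a b] by (simp add: w_def gh)
  next
    case False
    then show ?thesis using assms(4)[of x y] by (auto simp: w_def)
  qed
  then have G: "sdec (h ` I) G {..<card I} p w"
    unfolding sdec_def using D ipw by (auto simp: w_def)
  show "kent G = kent F" unfolding kent_eq[OF s] kent_eq[OF G] ..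
  show "dens (h ` I) G"
    by (rule sdec_densI[OF G]) (use sdec_dens_nonneg[OF s assms(1)] sdec_dens_sum[OF s assms(1)] in auto)
qed

section \<open>From matrices to kernels\<close>

definition mk :: "complex mat \<Rightarrow> nat \<Rightarrow> nat \<Rightarrow> complex" where
  "mk A i j = (if i < dim_row A \<and> j < dim_col A then A $$ (i,j) else 0)"

lemma is_density_iff: "is_density d \<rho> \<longleftrightarrow> \<rho> \<in> carrier_mat d d \<and> dens {..<d} (mk \<rho>)"
proof (cases "\<rho> \<in> carrier_mat d d")
  case True
  then have mk: "mk \<rho> i j = (if i < d \<and> j < d then \<rho> $$ (i,j) else 0)" for i j
    unfolding mk_def by auto
  have "(\<Sum>i<d. mk \<rho> i i) = (\<Sum>i<d. \<rho> $$ (i,i))" by (simp add: mk)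
  moreover have "(\<Sum>i<d. \<Sum>j<d. cnj (v i) * mk \<rho> i j * v j) = (\<Sum>i<d. \<Sum>j<d. cnj (v i) * \<rho> $$ (i,j) * v j)" for v
    by (simp add: mk)
  moreover have "\<forall>x y. x \<notin> {..<d} \<or> y \<notin> {..<d} \<longrightarrow> mk \<rho> x y = 0" by (simp add: mk)
  ultimately show ?thesis using True unfolding is_density_def dens_def by simp
qed (simp add: is_density_def)

text \<open>\<open>A\<close> is unitarily similar to the diagonal matrix of the \<open>p i\<close>,
  so its characteristic polynomial splits into the factors belonging to the
  \<open>p i\<close>.\<close>

lemma vN_entropy_eq_kent:
  assumes "A \<in> carrier_mat n n" "dens {..<n} (mk A)"
  shows "vN_entropy A = kent (mk A)"
proof -
  obtain p u where sf: "sdec_full {..<n} (mk A) {..<n} p u"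
    using sdec_full_exists[OF assms(2)] by auto
  then have s: "sdec {..<n} (mk A) {..<n} p u" unfolding sdec_full_def by blast
  define U where "U = mat n n (\<lambda>(x,i). u i x)"
  define V where "V = mat n n (\<lambda>(i,x). cnj (u i x))"
  define D where "D = mat n n (\<lambda>(i,j). if i = j then complex_of_real (p i) else 0)"
  have c: "U \<in> carrier_mat n n" "V \<in> carrier_mat n n" "D \<in> carrier_mat n n" "D * V \<in> carrier_mat n n"
    unfolding U_def V_def D_def by auto
  have VU: "V * U = 1\<^sub>m n" unfolding U_def V_def
    using sdecD(4)[OF s] by (intro eq_matI) (auto simp: scalar_prod_def ip_def lessThan_atLeast0)
  have UV: "U * V = 1\<^sub>m n" by (rule mat_mult_left_right_inverse[OF c(2,1) VU])
  have DV: "D * V = mat n n (\<lambda>(i,x). complex_of_real (p i) * cnj (u i x))" unfolding D_def V_def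
    by (intro eq_matI) (auto simp: scalar_prod_def if_distrib if_distribR cong: if_cong)
  have "A = U * (D * V)"
  proof (rule eq_matI)
    fix i j assume "i < dim_row (U * (D * V))" "j < dim_col (U * (D * V))"
    then have ij: "i < n" "j < n" unfolding U_def D_def V_def by auto
    have "A $$ (i,j) = mk A i j" using ij assms(1) by (auto simp: mk_def)
    also have "\<dots> = (\<Sum>k<n. complex_of_real (p k) * u k i * cnj (u k j))" by (rule sdecD(5)[OF s])
    also have "\<dots> = (U * (D * V)) $$ (i,j)" unfolding DV U_def using ij
      by (auto simp: scalar_prod_def lessThan_atLeast0 mult_ac)
    finally show "A $$ (i,j) = (U * (D * V)) $$ (i,j)" .
  qed (use assms(1) c in auto)
  then have "A = U * D * V" using assoc_mult_mat[OF c(1,3,2)] by simp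
  then have "similar_mat A D"
    using c assms(1) UV VU by (intro similar_matI[of _ _ U V n]) auto
  then have "char_poly A = char_poly D" by (rule char_poly_similar)
  also have "\<dots> = (\<Prod>a\<leftarrow>diag_mat D. [:- a, 1:])"
    by (rule char_poly_upper_triangular[OF c(3)]) (auto simp: D_def)
  also have "diag_mat D = map (\<lambda>i. complex_of_real (p i)) [0..<n]" unfolding diag_mat_def D_def by simp
  finally have cp: "char_poly A = (\<Prod>a\<in>#mset (map (\<lambda>i. complex_of_real (p i)) [0..<n]). [:- a, 1:])"
    by (simp add: prod_mset_prod_list flip: mset_map)
  \<comment> \<open>\<open>eigs\<close> picks some multiset of roots, so the polynomial has to be
    shown to determine it.\<close>
  have uniq: "M = N" if "(\<Prod>a\<in>#M. [:- a, 1:]) = (\<Prod>a\<in>#N. [:- a, 1:])" for M N :: "complex multiset"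
  proof -
    have "proots (\<Prod>a\<in>#M. [:- a, 1:]) = M" for M :: "complex multiset"
    proof (induction M)
      case (add x M)
      have "(\<Prod>a\<in>#M. [:- a, 1:]) \<noteq> 0" by (auto simp: prod_mset_zero_iff)
      then have "proots ([:- x, 1:] * (\<Prod>a\<in>#M. [:- a, 1:])) = proots [:- x, 1:] + M"
        using add proots_mult[of "[:- x, 1:]" "\<Prod>a\<in>#M. [:- a, 1:]"] by (metis pCons_eq_0_iff one_neq_zero)
      then show ?case by (simp del: mult_pCons_left)
    qed simp
    then show ?thesis using that by metis
  qed
  have "eigs A = mset (map (\<lambda>i. complex_of_real (p i)) [0..<n])"
    unfolding eigs_def using cp by (intro some_equality) (auto intro: uniq)
  then show ?thesis unfolding vN_entropy_def kent_eq[OF s] eta_def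
    by (simp add: image_mset.compositionality comp_def sum_mset_sum_list sum_negf
        interv_sum_list_conv_sum_set_nat lessThan_atLeast0 flip: mset_map)
qed

subsection \<open>Partial traces along labels\<close>

text \<open>Partial trace of a kernel on \<open>\<Omega>\<close> that keeps the label \<open>\<pi>\<close> and traces out the
  complementary label \<open>\<pi>'\<close>.\<close>
definition red :: "'w set \<Rightarrow> ('w \<Rightarrow> 'w \<Rightarrow> complex) \<Rightarrow> ('w \<Rightarrow> 'a) \<Rightarrow> ('w \<Rightarrow> 'b) \<Rightarrow> 'a \<Rightarrow> 'a \<Rightarrow> complex" where
  "red \<Omega> F \<pi> \<pi>' x y = (\<Sum>v\<in>\<Omega>. \<Sum>w\<in>\<Omega>. if \<pi> v = x \<and> \<pi> w = y \<and> \<pi>' v = \<pi>' w then F v w else 0)"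

lemma red_outside: "x \<notin> \<pi> ` \<Omega> \<or> y \<notin> \<pi> ` \<Omega> \<Longrightarrow> red \<Omega> F \<pi> \<pi>' x y = 0"
  unfolding red_def by (intro sum.neutral ballI) auto

lemma sum_delta_image:
  assumes "finite X" "\<pi> ` \<Omega> \<subseteq> X"
  shows "(\<Sum>x\<in>X. \<Sum>w\<in>\<Omega>. if \<pi> w = x then h x w else 0) = (\<Sum>w\<in>\<Omega>. h (\<pi> w) w :: complex)"
proof -
  have "(\<Sum>x\<in>X. \<Sum>w\<in>\<Omega>. if \<pi> w = x then h x w else 0) = (\<Sum>w\<in>\<Omega>. \<Sum>x\<in>X. if \<pi> w = x then h x w else 0)"
    by (rule sum.swap)
  also have "\<dots> = (\<Sum>w\<in>\<Omega>. h (\<pi> w) w)"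
    using assms by (intro sum.cong) (auto simp: sum.delta)
  finally show ?thesis .
qed

text \<open>Trace duality: pairing a reduction with \<open>a\<close> is pairing the original kernel
  with \<open>a\<close> tensored with the identity on the traced-out label. Composition and
  positivity of reductions, as well as \<open>qf_tensor_id\<close>, are read off from it.\<close>

lemma red_sum:
  assumes "finite X" "\<pi> ` \<Omega> \<subseteq> X"
  shows "(\<Sum>x\<in>X. \<Sum>y\<in>X. a x y * red \<Omega> F \<pi> \<pi>' x y) =
    (\<Sum>v\<in>\<Omega>. \<Sum>w\<in>\<Omega>. if \<pi>' v = \<pi>' w then a (\<pi> v) (\<pi> w) * F v w else 0)"
proof -
  let ?g = "\<lambda>x y v w. if \<pi>' v = \<pi>' w then a x y * F v w else 0"
  have "(\<Sum>x\<in>X. \<Sum>y\<in>X. a x y * red \<Omega> F \<pi> \<pi>' x y) =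
      (\<Sum>x\<in>X. \<Sum>y\<in>X. \<Sum>v\<in>\<Omega>. if \<pi> v = x then (\<Sum>w\<in>\<Omega>. if \<pi> w = y then ?g x y v w else 0) else 0)"
  proof (intro sum.cong refl)
    fix x y
    show "a x y * red \<Omega> F \<pi> \<pi>' x y = (\<Sum>v\<in>\<Omega>. if \<pi> v = x then (\<Sum>w\<in>\<Omega>. if \<pi> w = y then ?g x y v w else 0) else 0)"
      unfolding red_def sum_distrib_left by (intro sum.cong refl) (auto intro!: sum.cong)
  qed
  also have "\<dots> = (\<Sum>x\<in>X. \<Sum>v\<in>\<Omega>. \<Sum>y\<in>X. if \<pi> v = x then (\<Sum>w\<in>\<Omega>. if \<pi> w = y then ?g x y v w else 0) else 0)"
    by (intro sum.cong refl sum.swap)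
  also have "\<dots> = (\<Sum>x\<in>X. \<Sum>v\<in>\<Omega>. if \<pi> v = x then (\<Sum>y\<in>X. \<Sum>w\<in>\<Omega>. if \<pi> w = y then ?g x y v w else 0) else 0)"
    by (intro sum.cong refl) auto
  also have "\<dots> = (\<Sum>v\<in>\<Omega>. \<Sum>y\<in>X. \<Sum>w\<in>\<Omega>. if \<pi> w = y then ?g (\<pi> v) y v w else 0)"
    by (rule sum_delta_image[OF assms])
  also have "\<dots> = (\<Sum>v\<in>\<Omega>. \<Sum>w\<in>\<Omega>. ?g (\<pi> v) (\<pi> w) v w)"
    by (intro sum.cong refl sum_delta_image[OF assms])
  finally show ?thesis .
qed

text \<open>Two successive partial traces discard both complementary labels, hence the pair.\<close>

lemma red_red:
  assumes "finite X" "\<pi> ` \<Omega> \<subseteq> X"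
  shows "red X (red \<Omega> F \<pi> \<pi>') \<mu> \<mu>' = red \<Omega> F (\<lambda>w. \<mu> (\<pi> w)) (\<lambda>w. (\<mu>' (\<pi> w), \<pi>' w))"
proof (intro ext)
  fix a b
  have "red X (red \<Omega> F \<pi> \<pi>') \<mu> \<mu>' a b =
    (\<Sum>x\<in>X. \<Sum>y\<in>X. (if \<mu> x = a \<and> \<mu> y = b \<and> \<mu>' x = \<mu>' y then 1 else 0) * red \<Omega> F \<pi> \<pi>' x y)"
    unfolding red_def[of X] by (intro sum.cong refl) auto
  also have "\<dots> = red \<Omega> F (\<lambda>w. \<mu> (\<pi> w)) (\<lambda>w. (\<mu>' (\<pi> w), \<pi>' w)) a b"
    unfolding red_sum[OF assms] unfolding red_def by (intro sum.cong refl) auto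
  finally show "red X (red \<Omega> F \<pi> \<pi>') \<mu> \<mu>' a b = red \<Omega> F (\<lambda>w. \<mu> (\<pi> w)) (\<lambda>w. (\<mu>' (\<pi> w), \<pi>' w)) a b" .
qed

lemma red_cong:
  assumes "\<And>v. v \<in> \<Omega> \<Longrightarrow> \<pi> v = \<mu> v" "\<And>v w. v \<in> \<Omega> \<Longrightarrow> w \<in> \<Omega> \<Longrightarrow> \<pi>' v = \<pi>' w \<longleftrightarrow> \<mu>' v = \<mu>' w"
    "\<And>v w. v \<in> \<Omega> \<Longrightarrow> w \<in> \<Omega> \<Longrightarrow> F v w = G v w"
  shows "red \<Omega> F \<pi> \<pi>' = red \<Omega> G \<mu> \<mu>'"
  unfolding red_def using assms by (intro ext sum.cong refl) auto

lemma red_reindex: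
  assumes "bij_betw \<phi> \<Omega> \<Omega>'"
  shows "red \<Omega>' F \<pi> \<pi>' = red \<Omega> (\<lambda>v w. F (\<phi> v) (\<phi> w)) (\<lambda>v. \<pi> (\<phi> v)) (\<lambda>v. \<pi>' (\<phi> v))"
  unfolding red_def by (intro ext) (simp flip: sum.reindex_bij_betw[OF assms])

text \<open>Positivity: the quadratic form of the reduction at \<open>v\<close> is the sum, over the
  values \<open>c\<close> of the traced-out label, of the form of \<open>F\<close> at the slice
  \<open>w c\<close> of \<open>v\<close>. Joint injectivity of the labels singles out the diagonal
  of \<open>F\<close> in the trace.\<close>

lemma dens_red:
  assumes d: "dens \<Omega> F" and inj: "inj_on (\<lambda>w. (\<pi> w, \<pi>' w)) \<Omega>"
  shows "dens (\<pi> ` \<Omega>) (red \<Omega> F \<pi> \<pi>')"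
proof -
  have fin: "finite \<Omega>" using d unfolding dens_def by blast
  have fin': "finite (\<pi> ` \<Omega>)" using fin by simp
  have "(\<Sum>x\<in>\<pi> ` \<Omega>. red \<Omega> F \<pi> \<pi>' x x) = (\<Sum>x\<in>\<pi> ` \<Omega>. \<Sum>y\<in>\<pi> ` \<Omega>. (if x = y then 1 else 0) * red \<Omega> F \<pi> \<pi>' x y)"
    using fin' by (intro sum.cong refl) (auto simp: if_distribR if_distrib cong: if_cong)
  also have "\<dots> = (\<Sum>v\<in>\<Omega>. \<Sum>w\<in>\<Omega>. if v = w then F v w else 0)"
    unfolding red_sum[OF fin' order_refl] using inj
    by (intro sum.cong refl) (auto dest: inj_onD)
  also have "\<dots> = 1" using d fin unfolding dens_def by simp
  finally have tr: "(\<Sum>x\<in>\<pi> ` \<Omega>. red \<Omega> F \<pi> \<pi>' x x) = 1" .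
  have "\<exists>r\<ge>0. (\<Sum>x\<in>\<pi> ` \<Omega>. \<Sum>y\<in>\<pi> ` \<Omega>. cnj (v x) * red \<Omega> F \<pi> \<pi>' x y * v y) = complex_of_real r" for v
  proof -
    define w where "w c t = (if \<pi>' t = c then v (\<pi> t) else 0)" for c t
    have "\<forall>c. \<exists>r\<ge>0. (\<Sum>s\<in>\<Omega>. \<Sum>t\<in>\<Omega>. cnj (w c s) * F s t * w c t) = complex_of_real r"
      using d unfolding dens_def by blast
    then obtain r where r: "\<And>c. r c \<ge> 0"
      "\<And>c. (\<Sum>s\<in>\<Omega>. \<Sum>t\<in>\<Omega>. cnj (w c s) * F s t * w c t) = complex_of_real (r c)"
      by metis
    have "(\<Sum>x\<in>\<pi> ` \<Omega>. \<Sum>y\<in>\<pi> ` \<Omega>. cnj (v x) * red \<Omega> F \<pi> \<pi>' x y * v y) =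
        (\<Sum>x\<in>\<pi> ` \<Omega>. \<Sum>y\<in>\<pi> ` \<Omega>. (cnj (v x) * v y) * red \<Omega> F \<pi> \<pi>' x y)"
      by (simp add: mult_ac)
    also have "\<dots> = (\<Sum>s\<in>\<Omega>. \<Sum>t\<in>\<Omega>. if \<pi>' s = \<pi>' t then cnj (v (\<pi> s)) * v (\<pi> t) * F s t else 0)"
      by (rule red_sum[OF fin' order_refl])
    also have "\<dots> = (\<Sum>s\<in>\<Omega>. \<Sum>t\<in>\<Omega>. \<Sum>c\<in>\<pi>' ` \<Omega>. cnj (w c s) * F s t * w c t)"
    proof (intro sum.cong refl)
      fix s t assume st: "s \<in> \<Omega>" "t \<in> \<Omega>"
      have "(\<Sum>c\<in>\<pi>' ` \<Omega>. cnj (w c s) * F s t * w c t) = (\<Sum>c\<in>\<pi>' ` \<Omega>. if \<pi>' s = c then cnj (v (\<pi> s)) * F s t * w c t else 0)"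
        by (intro sum.cong refl) (auto simp: w_def)
      also have "\<dots> = cnj (v (\<pi> s)) * F s t * w (\<pi>' s) t"
        using st fin by (simp add: sum.delta)
      finally show "(if \<pi>' s = \<pi>' t then cnj (v (\<pi> s)) * v (\<pi> t) * F s t else 0) = (\<Sum>c\<in>\<pi>' ` \<Omega>. cnj (w c s) * F s t * w c t)"
        by (auto simp: w_def)
    qed
    also have "\<dots> = (\<Sum>s\<in>\<Omega>. \<Sum>c\<in>\<pi>' ` \<Omega>. \<Sum>t\<in>\<Omega>. cnj (w c s) * F s t * w c t)"
      by (intro sum.cong refl sum.swap)
    also have "\<dots> = (\<Sum>c\<in>\<pi>' ` \<Omega>. \<Sum>s\<in>\<Omega>. \<Sum>t\<in>\<Omega>. cnj (w c s) * F s t * w c t)"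
      by (rule sum.swap)
    also have "\<dots> = complex_of_real (\<Sum>c\<in>\<pi>' ` \<Omega>. r c)" by (simp add: r)
    finally show ?thesis using r(1) by (intro exI[of _ "\<Sum>c\<in>\<pi>' ` \<Omega>. r c"]) (auto intro: sum_nonneg)
  qed
  then show ?thesis unfolding dens_def using fin' tr red_outside[of _ \<pi> \<Omega> _ F \<pi>'] by blast
qed

text \<open>Labels matter only through the partitions they induce on \<open>\<Omega>\<close>;
  \<open>h\<close> translates one labelling into the other. This allows nested tuples, unit
  components and digit functions to be exchanged freely.\<close>

lemma kent_red_cong:
  assumes d: "dens \<Omega> F" and inj: "inj_on (\<lambda>w. (\<pi> w, \<pi>' w)) \<Omega>"
    and same: "\<And>v w. v \<in> \<Omega> \<Longrightarrow> w \<in> \<Omega> \<Longrightarrow> \<pi> v = \<pi> w \<longleftrightarrow> \<mu> v = \<mu> w"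
    and same': "\<And>v w. v \<in> \<Omega> \<Longrightarrow> w \<in> \<Omega> \<Longrightarrow> \<pi>' v = \<pi>' w \<longleftrightarrow> \<mu>' v = \<mu>' w"
  shows "kent (red \<Omega> F \<mu> \<mu>') = kent (red \<Omega> F \<pi> \<pi>')"
proof -
  define h where "h x = \<mu> (SOME w. w \<in> \<Omega> \<and> \<pi> w = x)" for x
  have h: "h (\<pi> w) = \<mu> w" if "w \<in> \<Omega>" for w
  proof -
    have "(SOME v. v \<in> \<Omega> \<and> \<pi> v = \<pi> w) \<in> \<Omega> \<and> \<pi> (SOME v. v \<in> \<Omega> \<and> \<pi> v = \<pi> w) = \<pi> w"
      by (rule someI[of _ w]) (use that in simp)
    then show ?thesis unfolding h_def using same that by blast
  qed
  have im: "h ` (\<pi> ` \<Omega>) = \<mu> ` \<Omega>" using h by (force simp: image_image)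
  show ?thesis
  proof (rule kent_transfer(1)[OF dens_red[OF d inj], of h])
    show "inj_on h (\<pi> ` \<Omega>)" using h same by (auto simp: inj_on_def)
    fix x y assume "x \<in> \<pi> ` \<Omega>" "y \<in> \<pi> ` \<Omega>"
    then obtain a b where ab: "a \<in> \<Omega>" "b \<in> \<Omega>" "x = \<pi> a" "y = \<pi> b" by blast
    show "red \<Omega> F \<mu> \<mu>' (h x) (h y) = red \<Omega> F \<pi> \<pi>' x y"
      unfolding red_def ab(3,4) h[OF ab(1)] h[OF ab(2)] using same same' ab(1,2)
      by (intro sum.cong refl) auto
  qed (auto simp: im intro: red_outside)
qed

text \<open>If the kept and the traced-out label are genuine coordinates, with inverse
  \<open>f\<close>, the double sum collapses to the familiar partial trace over
  \<open>Z\<close>.\<close>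

lemma red_product:
  assumes fin: "finite \<Omega>" "finite Z"
    and f: "\<And>w z. w \<in> W \<Longrightarrow> z \<in> Z \<Longrightarrow> f w z \<in> \<Omega> \<and> \<pi> (f w z) = w \<and> \<pi>' (f w z) = z"
    and g: "\<And>v. v \<in> \<Omega> \<Longrightarrow> \<pi>' v \<in> Z \<and> v = f (\<pi> v) (\<pi>' v)"
    and w: "w \<in> W" "w' \<in> W"
  shows "red \<Omega> F \<pi> \<pi>' w w' = (\<Sum>z\<in>Z. F (f w z) (f w' z))"
proof -
  have "red \<Omega> F \<pi> \<pi>' w w' = (\<Sum>v\<in>\<Omega>. \<Sum>v'\<in>\<Omega>. \<Sum>z\<in>Z. if v = f w z then (if v' = f w' z then F v v' else 0) else 0)"
    unfolding red_def
  proof (intro sum.cong refl)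
    fix v v' assume v: "v \<in> \<Omega>" "v' \<in> \<Omega>"
    have "(\<Sum>z\<in>Z. if v = f w z then (if v' = f w' z then F v v' else 0) else 0) =
      (\<Sum>z\<in>Z. if z = \<pi>' v then (if \<pi> v = w \<and> \<pi> v' = w' \<and> \<pi>' v = \<pi>' v' then F v v' else 0) else 0)"
    proof (intro sum.cong refl)
      fix z assume z: "z \<in> Z"
      have e1: "v = f w z \<longleftrightarrow> \<pi> v = w \<and> \<pi>' v = z" using f[OF w(1) z] g[OF v(1)] by metis
      have e2: "v' = f w' z \<longleftrightarrow> \<pi> v' = w' \<and> \<pi>' v' = z" using f[OF w(2) z] g[OF v(2)] by metis
      show "(if v = f w z then (if v' = f w' z then F v v' else 0) else 0) =
        (if z = \<pi>' v then (if \<pi> v = w \<and> \<pi> v' = w' \<and> \<pi>' v = \<pi>' v' then F v v' else 0) else 0)"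
        unfolding e1 e2 by auto
    qed
    then show "(if \<pi> v = w \<and> \<pi> v' = w' \<and> \<pi>' v = \<pi>' v' then F v v' else 0) =
      (\<Sum>z\<in>Z. if v = f w z then (if v' = f w' z then F v v' else 0) else 0)"
      using fin(2) g[OF v(1)] by simp
  qed
  also have "\<dots> = (\<Sum>v\<in>\<Omega>. \<Sum>z\<in>Z. \<Sum>v'\<in>\<Omega>. if v = f w z then (if v' = f w' z then F v v' else 0) else 0)"
    by (intro sum.cong refl sum.swap)
  also have "\<dots> = (\<Sum>z\<in>Z. \<Sum>v\<in>\<Omega>. \<Sum>v'\<in>\<Omega>. if v = f w z then (if v' = f w' z then F v v' else 0) else 0)"
    by (rule sum.swap)
  also have "\<dots> = (\<Sum>z\<in>Z. F (f w z) (f w' z))"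
  proof (intro sum.cong refl)
    fix z assume z: "z \<in> Z"
    have "(\<Sum>v\<in>\<Omega>. \<Sum>v'\<in>\<Omega>. if v = f w z then (if v' = f w' z then F v v' else 0) else 0) =
      (\<Sum>v\<in>\<Omega>. if v = f w z then F v (f w' z) else 0)"
      using fin(1) f[OF w(2) z] by (intro sum.cong refl) auto
    then show "(\<Sum>v\<in>\<Omega>. \<Sum>v'\<in>\<Omega>. if v = f w z then (if v' = f w' z then F v v' else 0) else 0) = F (f w z) (f w' z)"
      using fin(1) f[OF w(1) z] by simp
  qed
  finally show ?thesis .
qed

subsection \<open>Monotonicity of the relative entropy\<close>

definition onb :: "'a set \<Rightarrow> 'k set \<Rightarrow> ('k \<Rightarrow> 'a \<Rightarrow> complex) \<Rightarrow> bool" where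
  "onb I K s \<longleftrightarrow> finite I \<and> finite K \<and> (\<forall>j\<in>K. \<forall>k\<in>K. ip I (s j) (s k) = (if j = k then 1 else 0)) \<and>
    (\<forall>x\<in>I. \<forall>y\<in>I. (\<Sum>k\<in>K. s k x * cnj (s k y)) = (if x = y then 1 else 0))"

lemma onbD:
  assumes "onb I K s"
  shows "finite I" "finite K" "\<And>j k. j \<in> K \<Longrightarrow> k \<in> K \<Longrightarrow> ip I (s j) (s k) = (if j = k then 1 else 0)"
    "\<And>x y. x \<in> I \<Longrightarrow> y \<in> I \<Longrightarrow> (\<Sum>k\<in>K. s k x * cnj (s k y)) = (if x = y then 1 else 0)"
  using assms unfolding onb_def by auto

lemma parseval:
  assumes "onb I K s"
  shows "ip I a b = (\<Sum>k\<in>K. ip I a (s k) * ip I (s k) b)"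
proof -
  have "(\<Sum>k\<in>K. ip I a (s k) * ip I (s k) b) = (\<Sum>k\<in>K. \<Sum>x\<in>I. \<Sum>y\<in>I. cnj (a x) * b y * (s k x * cnj (s k y)))"
    unfolding ip_def sum_product by (simp add: mult_ac)
  also have "\<dots> = (\<Sum>x\<in>I. \<Sum>k\<in>K. \<Sum>y\<in>I. cnj (a x) * b y * (s k x * cnj (s k y)))"
    by (rule sum.swap)
  also have "\<dots> = (\<Sum>x\<in>I. \<Sum>y\<in>I. \<Sum>k\<in>K. cnj (a x) * b y * (s k x * cnj (s k y)))"
    by (intro sum.cong refl sum.swap)
  also have "\<dots> = (\<Sum>x\<in>I. \<Sum>y\<in>I. if y = x then cnj (a x) * b y else 0)"
    unfolding sum_distrib_left[symmetric] using onbD(4)[OF assms] by (intro sum.cong refl) auto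
  also have "\<dots> = ip I a b" unfolding ip_def using onbD(1)[OF assms] by simp
  finally show ?thesis ..
qed

lemma parseval_norm:
  assumes "onb I K s"
  shows "(\<Sum>x\<in>I. (cmod (a x))\<^sup>2) = (\<Sum>k\<in>K. (cmod (ip I (s k) a))\<^sup>2)"
proof -
  have "complex_of_real (\<Sum>x\<in>I. (cmod (a x))\<^sup>2) = (\<Sum>k\<in>K. ip I a (s k) * ip I (s k) a)"
    unfolding ip_self[symmetric] by (rule parseval[OF assms])
  also have "\<dots> = (\<Sum>k\<in>K. complex_of_real ((cmod (ip I (s k) a))\<^sup>2))"
    by (intro sum.cong refl) (simp add: ip_cnj[symmetric, of I a] complex_norm_square mult.commute del: of_real_power)
  finally show ?thesis by (metis of_real_sum of_real_eq_iff)
qed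

text \<open>For positive definite \<open>S\<close>, the supremum over \<open>M\<close> of
  \<open>2 Re Tr(F M) - Tr(S M M\<^sup>*) - t Tr(F M\<^sup>* M)\<close> is the resolvent of the relative modular
  operator of \<open>(F, S)\<close> at \<open>-t\<close>, evaluated at the vector \<open>sqrt F\<close>.\<close>
definition qf :: "'a set \<Rightarrow> ('a \<Rightarrow> 'a \<Rightarrow> complex) \<Rightarrow> ('a \<Rightarrow> 'a \<Rightarrow> complex) \<Rightarrow> real \<Rightarrow> ('a \<Rightarrow> 'a \<Rightarrow> complex) \<Rightarrow> real" where
  "qf I F S t M = 2 * Re (\<Sum>x\<in>I. \<Sum>y\<in>I. M y x * F x y)
     - Re (\<Sum>x\<in>I. \<Sum>y\<in>I. (\<Sum>z\<in>I. M y z * cnj (M x z)) * S x y)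
     - t * Re (\<Sum>x\<in>I. \<Sum>y\<in>I. (\<Sum>z\<in>I. cnj (M z y) * M z x) * F x y)"

lemma repr_sum:
  assumes "\<And>x y. x \<in> I \<Longrightarrow> y \<in> I \<Longrightarrow> F x y = (\<Sum>j\<in>J. complex_of_real (p j) * u j x * cnj (u j y))"
  shows "(\<Sum>x\<in>I. \<Sum>y\<in>I. A x y * F x y) = (\<Sum>j\<in>J. complex_of_real (p j) * (\<Sum>x\<in>I. \<Sum>y\<in>I. A x y * u j x * cnj (u j y)))"
proof -
  have "(\<Sum>x\<in>I. \<Sum>y\<in>I. A x y * F x y) = (\<Sum>x\<in>I. \<Sum>y\<in>I. \<Sum>j\<in>J. complex_of_real (p j) * (A x y * u j x * cnj (u j y)))"
    using assms by (intro sum.cong refl) (simp add: sum_distrib_left mult_ac)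
  also have "\<dots> = (\<Sum>x\<in>I. \<Sum>j\<in>J. \<Sum>y\<in>I. complex_of_real (p j) * (A x y * u j x * cnj (u j y)))"
    by (intro sum.cong refl sum.swap)
  also have "\<dots> = (\<Sum>j\<in>J. \<Sum>x\<in>I. \<Sum>y\<in>I. complex_of_real (p j) * (A x y * u j x * cnj (u j y)))"
    by (rule sum.swap)
  finally show ?thesis unfolding sum_distrib_left .
qed

lemma sum_norm_sq:
  "(\<Sum>x\<in>I. \<Sum>y\<in>I. (\<Sum>z\<in>L. A z y * cnj (A z x)) * c x * cnj (c y)) = complex_of_real (\<Sum>z\<in>L. (cmod (\<Sum>x\<in>I. c x * cnj (A z x)))\<^sup>2)"
proof -
  have "(\<Sum>x\<in>I. \<Sum>y\<in>I. (\<Sum>z\<in>L. A z y * cnj (A z x)) * c x * cnj (c y)) =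
      (\<Sum>x\<in>I. \<Sum>y\<in>I. \<Sum>z\<in>L. c x * cnj (A z x) * (A z y * cnj (c y)))"
    by (simp add: sum_distrib_left sum_distrib_right mult_ac)
  also have "\<dots> = (\<Sum>x\<in>I. \<Sum>z\<in>L. \<Sum>y\<in>I. c x * cnj (A z x) * (A z y * cnj (c y)))"
    by (intro sum.cong refl sum.swap)
  also have "\<dots> = (\<Sum>z\<in>L. \<Sum>x\<in>I. \<Sum>y\<in>I. c x * cnj (A z x) * (A z y * cnj (c y)))"
    by (rule sum.swap)
  also have "\<dots> = (\<Sum>z\<in>L. (\<Sum>x\<in>I. c x * cnj (A z x)) * cnj (\<Sum>x\<in>I. c x * cnj (A z x)))"
    by (intro sum.cong refl) (simp add: sum_product mult_ac)
  finally show ?thesis by (simp add: complex_norm_square del: of_real_power)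
qed

context
  fixes I :: "'a set" and J :: "'j set" and K :: "'k set" and p u r s F S
  assumes U: "onb I J u" and V: "onb I K s"
    and F: "\<And>x y. x \<in> I \<Longrightarrow> y \<in> I \<Longrightarrow> F x y = (\<Sum>j\<in>J. complex_of_real (p j) * u j x * cnj (u j y))"
    and S: "\<And>x y. x \<in> I \<Longrightarrow> y \<in> I \<Longrightarrow> S x y = (\<Sum>k\<in>K. complex_of_real (r k) * s k x * cnj (s k y))"
    and p: "\<And>j. j \<in> J \<Longrightarrow> p j \<ge> 0" and r: "\<And>k. k \<in> K \<Longrightarrow> r k > 0"
begin

text \<open>In the eigenbases of \<open>F\<close> and \<open>S\<close> the form decouples: every
  matrix entry \<open>\<langle>s k, M u j\<rangle>\<close> enters through its own scalar quadratic
  expression.\<close>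

lemma qf_eq:
  "qf I F S t M = (\<Sum>j\<in>J. \<Sum>k\<in>K. 2 * p j * Re (ip I (u j) (s k) * ip I (s k) (\<lambda>x. \<Sum>y\<in>I. M x y * u j y))
     - (r k + t * p j) * (cmod (ip I (s k) (\<lambda>x. \<Sum>y\<in>I. M x y * u j y)))\<^sup>2)"
proof -
  let ?m = "\<lambda>k j. ip I (s k) (\<lambda>x. \<Sum>y\<in>I. M x y * u j y)"
  have Re_of_real_mult: "Re (complex_of_real a * z) = a * Re z" for a z by simp
  have "(\<Sum>x\<in>I. \<Sum>y\<in>I. M y x * F x y) = (\<Sum>j\<in>J. complex_of_real (p j) * (\<Sum>x\<in>I. \<Sum>y\<in>I. M y x * u j x * cnj (u j y)))"
    by (rule repr_sum[OF F])
  also have "\<dots> = (\<Sum>j\<in>J. complex_of_real (p j) * ip I (u j) (\<lambda>y. \<Sum>x\<in>I. M y x * u j x))"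
  proof (intro sum.cong refl)
    fix j
    have "(\<Sum>x\<in>I. \<Sum>y\<in>I. M y x * u j x * cnj (u j y)) = (\<Sum>y\<in>I. \<Sum>x\<in>I. M y x * u j x * cnj (u j y))"
      by (rule sum.swap)
    also have "\<dots> = ip I (u j) (\<lambda>y. \<Sum>x\<in>I. M y x * u j x)"
      unfolding ip_def by (simp add: sum_distrib_left mult_ac)
    finally show "complex_of_real (p j) * (\<Sum>x\<in>I. \<Sum>y\<in>I. M y x * u j x * cnj (u j y)) =
      complex_of_real (p j) * ip I (u j) (\<lambda>y. \<Sum>x\<in>I. M y x * u j x)" by simp
  qed
  also have "\<dots> = (\<Sum>j\<in>J. complex_of_real (p j) * (\<Sum>k\<in>K. ip I (u j) (s k) * ?m k j))"
    by (intro sum.cong refl arg_cong2[where f = "(*)"] parseval[OF V])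
  finally have "Re (\<Sum>x\<in>I. \<Sum>y\<in>I. M y x * F x y) = (\<Sum>j\<in>J. \<Sum>k\<in>K. p j * Re (ip I (u j) (s k) * ?m k j))"
    by (simp only: Re_sum Re_of_real_mult sum_distrib_left)
  then have T1: "2 * Re (\<Sum>x\<in>I. \<Sum>y\<in>I. M y x * F x y) = (\<Sum>j\<in>J. \<Sum>k\<in>K. 2 * p j * Re (ip I (u j) (s k) * ?m k j))"
    by (simp add: sum_distrib_left mult_ac)
  have "(\<Sum>x\<in>I. \<Sum>y\<in>I. (\<Sum>z\<in>I. M y z * cnj (M x z)) * S x y) =
      (\<Sum>k\<in>K. complex_of_real (r k) * (\<Sum>x\<in>I. \<Sum>y\<in>I. (\<Sum>z\<in>I. M y z * cnj (M x z)) * s k x * cnj (s k y)))"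
    by (rule repr_sum[OF S])
  also have "\<dots> = (\<Sum>k\<in>K. complex_of_real (r k * (\<Sum>z\<in>I. (cmod (\<Sum>x\<in>I. s k x * cnj (M x z)))\<^sup>2)))"
    using sum_norm_sq[where A = "\<lambda>z y. M y z" and I = I and L = I] by simp
  also have "\<dots> = (\<Sum>k\<in>K. complex_of_real (r k * (\<Sum>j\<in>J. (cmod (?m k j))\<^sup>2)))"
  proof (intro sum.cong refl)
    fix k
    have "cmod (ip I (u j) (\<lambda>z. \<Sum>x\<in>I. s k x * cnj (M x z))) = cmod (?m k j)" for j
    proof -
      have "ip I (u j) (\<lambda>z. \<Sum>x\<in>I. s k x * cnj (M x z)) = (\<Sum>z\<in>I. \<Sum>x\<in>I. cnj (u j z) * (s k x * cnj (M x z)))"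
        unfolding ip_def by (simp add: sum_distrib_left)
      also have "\<dots> = (\<Sum>x\<in>I. \<Sum>z\<in>I. cnj (u j z) * (s k x * cnj (M x z)))" by (rule sum.swap)
      also have "\<dots> = cnj (?m k j)" unfolding ip_def by (simp add: sum_distrib_left mult_ac)
      finally show ?thesis by simp
    qed
    then show "complex_of_real (r k * (\<Sum>z\<in>I. (cmod (\<Sum>x\<in>I. s k x * cnj (M x z)))\<^sup>2)) =
      complex_of_real (r k * (\<Sum>j\<in>J. (cmod (?m k j))\<^sup>2))"
      unfolding parseval_norm[OF U] by simp
  qed
  finally have "Re (\<Sum>x\<in>I. \<Sum>y\<in>I. (\<Sum>z\<in>I. M y z * cnj (M x z)) * S x y) = (\<Sum>k\<in>K. \<Sum>j\<in>J. r k * (cmod (?m k j))\<^sup>2)"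
    by (simp only: Re_sum Re_complex_of_real sum_distrib_left)
  also have "\<dots> = (\<Sum>j\<in>J. \<Sum>k\<in>K. r k * (cmod (?m k j))\<^sup>2)" by (rule sum.swap)
  finally have T2: "Re (\<Sum>x\<in>I. \<Sum>y\<in>I. (\<Sum>z\<in>I. M y z * cnj (M x z)) * S x y) = (\<Sum>j\<in>J. \<Sum>k\<in>K. r k * (cmod (?m k j))\<^sup>2)" .
  have "(\<Sum>x\<in>I. \<Sum>y\<in>I. (\<Sum>z\<in>I. cnj (M z y) * M z x) * F x y) =
      (\<Sum>j\<in>J. complex_of_real (p j) * (\<Sum>x\<in>I. \<Sum>y\<in>I. (\<Sum>z\<in>I. cnj (M z y) * M z x) * u j x * cnj (u j y)))"
    by (rule repr_sum[OF F])
  also have "\<dots> = (\<Sum>j\<in>J. complex_of_real (p j * (\<Sum>z\<in>I. (cmod (\<Sum>x\<in>I. M z x * u j x))\<^sup>2)))"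
    using sum_norm_sq[where A = "\<lambda>z y. cnj (M z y)" and I = I and L = I] by (simp add: mult.commute)
  also have "\<dots> = (\<Sum>j\<in>J. complex_of_real (p j * (\<Sum>k\<in>K. (cmod (?m k j))\<^sup>2)))"
    unfolding parseval_norm[OF V] ..
  finally have T3: "t * Re (\<Sum>x\<in>I. \<Sum>y\<in>I. (\<Sum>z\<in>I. cnj (M z y) * M z x) * F x y) = (\<Sum>j\<in>J. \<Sum>k\<in>K. t * p j * (cmod (?m k j))\<^sup>2)"
    by (simp only: Re_sum Re_complex_of_real sum_distrib_left mult.assoc)
  show ?thesis unfolding qf_def T1 T2 T3 by (simp add: sum_subtractf[symmetric] algebra_simps)
qed

text \<open>Completing the square in each entry; \<open>r k > 0\<close> keeps the coefficient
  \<open>r k + t * p j\<close> positive even at \<open>t = 0\<close>.\<close>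

lemma qf_le:
  assumes t: "t \<ge> 0"
  shows "qf I F S t M \<le> (\<Sum>j\<in>J. \<Sum>k\<in>K. p j * (cmod (ip I (u j) (s k)))\<^sup>2 * p j / (r k + t * p j))"
  unfolding qf_eq
proof (intro sum_mono)
  fix j k assume jk: "j \<in> J" "k \<in> K"
  define d where "d = r k + t * p j"
  have d: "d > 0" unfolding d_def using p[OF jk(1)] r[OF jk(2)] t by (simp add: add_pos_nonneg)
  define a where "a = cmod (ip I (u j) (s k))"
  define b where "b = cmod (ip I (s k) (\<lambda>x. \<Sum>y\<in>I. M x y * u j y))"
  have "Re (ip I (u j) (s k) * ip I (s k) (\<lambda>x. \<Sum>y\<in>I. M x y * u j y)) \<le> a * b"
    unfolding a_def b_def norm_mult[symmetric] by (rule complex_Re_le_cmod)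
  then have "2 * p j * Re (ip I (u j) (s k) * ip I (s k) (\<lambda>x. \<Sum>y\<in>I. M x y * u j y)) \<le> 2 * p j * (a * b)"
    using p[OF jk(1)] by (intro mult_left_mono) auto
  moreover have "2 * p j * (a * b) - d * b\<^sup>2 \<le> p j * a\<^sup>2 * p j / d"
  proof -
    have "0 \<le> (p j * a - d * b)\<^sup>2" by simp
    then have "(2 * p j * (a * b) - d * b\<^sup>2) * d \<le> p j * a\<^sup>2 * p j"
      by (simp add: power2_eq_square algebra_simps)
    then show ?thesis using d by (simp add: pos_le_divide_eq)
  qed
  ultimately show "2 * p j * Re (ip I (u j) (s k) * ip I (s k) (\<lambda>x. \<Sum>y\<in>I. M x y * u j y)) -
    (r k + t * p j) * (cmod (ip I (s k) (\<lambda>x. \<Sum>y\<in>I. M x y * u j y)))\<^sup>2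
    \<le> p j * (cmod (ip I (u j) (s k)))\<^sup>2 * p j / (r k + t * p j)"
    unfolding a_def b_def d_def by linarith
qed

lemma qf_attained:
  assumes t: "t \<ge> 0"
  shows "\<exists>M. qf I F S t M = (\<Sum>j\<in>J. \<Sum>k\<in>K. p j * (cmod (ip I (u j) (s k)))\<^sup>2 * p j / (r k + t * p j))"
proof -
  \<comment> \<open>\<open>c k j\<close> is the stationary point of the scalar expression for the
    entry \<open>(k, j)\<close>, and \<open>M\<close> is the matrix with these entries.\<close>
  define c where "c k j = complex_of_real (p j / (r k + t * p j)) * cnj (ip I (u j) (s k))" for k j
  define M where "M x y = (\<Sum>j\<in>J. \<Sum>k\<in>K. c k j * s k x * cnj (u j y))" for x y
  have m: "ip I (s k) (\<lambda>x. \<Sum>y\<in>I. M x y * u j y) = c k j" if jk: "j \<in> J" "k \<in> K" for j k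
  proof -
    have "(\<Sum>y\<in>I. M x y * u j y) = (\<Sum>l\<in>K. c l j * s l x)" for x
    proof -
      have "(\<Sum>y\<in>I. M x y * u j y) = (\<Sum>y\<in>I. \<Sum>i\<in>J. \<Sum>l\<in>K. c l i * s l x * (cnj (u i y) * u j y))"
        unfolding M_def sum_distrib_right by (simp add: mult_ac)
      also have "\<dots> = (\<Sum>i\<in>J. \<Sum>y\<in>I. \<Sum>l\<in>K. c l i * s l x * (cnj (u i y) * u j y))" by (rule sum.swap)
      also have "\<dots> = (\<Sum>i\<in>J. (\<Sum>l\<in>K. c l i * s l x) * ip I (u i) (u j))"
        unfolding ip_def by (intro sum.cong refl) (simp add: sum_distrib_left sum_distrib_right)
      also have "\<dots> = (\<Sum>i\<in>J. if i = j then (\<Sum>l\<in>K. c l i * s l x) else 0)"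
        using onbD(3)[OF U] jk by (intro sum.cong refl) auto
      also have "\<dots> = (\<Sum>l\<in>K. c l j * s l x)" using onbD(2)[OF U] jk by simp
      finally show ?thesis .
    qed
    then have "ip I (s k) (\<lambda>x. \<Sum>y\<in>I. M x y * u j y) = (\<Sum>x\<in>I. \<Sum>l\<in>K. c l j * (cnj (s k x) * s l x))"
      unfolding ip_def by (simp add: sum_distrib_left mult_ac)
    also have "\<dots> = (\<Sum>l\<in>K. \<Sum>x\<in>I. c l j * (cnj (s k x) * s l x))" by (rule sum.swap)
    also have "\<dots> = (\<Sum>l\<in>K. c l j * ip I (s k) (s l))" unfolding ip_def sum_distrib_left ..
    also have "\<dots> = (\<Sum>l\<in>K. if l = k then c l j else 0)"
      using onbD(3)[OF V] jk by (intro sum.cong refl) auto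
    also have "\<dots> = c k j" using onbD(2)[OF V] jk by simp
    finally show ?thesis .
  qed
  show ?thesis
  proof (intro exI[of _ M], unfold qf_eq, intro sum.cong refl)
    fix j k assume jk: "j \<in> J" "k \<in> K"
    define d where "d = r k + t * p j"
    have d: "d > 0" unfolding d_def using p[OF jk(1)] r[OF jk(2)] t by (simp add: add_pos_nonneg)
    have "ip I (u j) (s k) * c k j = complex_of_real (p j / d * (cmod (ip I (u j) (s k)))\<^sup>2)"
      unfolding c_def d_def[symmetric] using complex_norm_square[of "ip I (u j) (s k)"] by simp
    then have 1: "Re (ip I (u j) (s k) * c k j) = p j / d * (cmod (ip I (u j) (s k)))\<^sup>2" by simp
    have 2: "(cmod (c k j))\<^sup>2 = (p j / d)\<^sup>2 * (cmod (ip I (u j) (s k)))\<^sup>2"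
      unfolding c_def d_def[symmetric] by (simp add: norm_mult norm_divide power_mult_distrib power_divide)
    show "2 * p j * Re (ip I (u j) (s k) * ip I (s k) (\<lambda>x. \<Sum>y\<in>I. M x y * u j y)) -
      (r k + t * p j) * (cmod (ip I (s k) (\<lambda>x. \<Sum>y\<in>I. M x y * u j y)))\<^sup>2 =
      p j * (cmod (ip I (u j) (s k)))\<^sup>2 * p j / (r k + t * p j)"
      unfolding m[OF jk] 1 2 d_def[symmetric] using d by (simp add: power2_eq_square field_simps)
  qed
qed

end

text \<open>The two sides of \<open>le\<close> are the derivatives of \<open>?H\<close> and
  \<open>?G\<close>, which both vanish at 0, so the inequality passes to these functions.
  Subtracting \<open>ln t\<close>, whose coefficient is 1 because the weights sum to 1, leaves a
  finite limit at infinity. Terms with \<open>ln 0\<close> disappear since \<open>p i = 0\<close>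
  forces \<open>c i = 0\<close>.\<close>

lemma log_integral_compare:
  fixes c p r :: "'i \<Rightarrow> real" and c' p' r' :: "'k \<Rightarrow> real"
  assumes fin: "finite A" "finite B"
    and A: "\<forall>i\<in>A. p i \<ge> 0 \<and> r i > 0 \<and> (p i = 0 \<longrightarrow> c i = 0)"
    and B: "\<forall>i\<in>B. p' i \<ge> 0 \<and> r' i > 0 \<and> (p' i = 0 \<longrightarrow> c' i = 0)"
    and s: "(\<Sum>i\<in>A. c i) = 1" "(\<Sum>i\<in>B. c' i) = 1"
    and le: "\<And>t. t \<ge> 0 \<Longrightarrow> (\<Sum>i\<in>B. c' i * p' i / (r' i + t * p' i)) \<le> (\<Sum>i\<in>A. c i * p i / (r i + t * p i))"
  shows "(\<Sum>i\<in>B. c' i * (ln (p' i) - ln (r' i))) \<le> (\<Sum>i\<in>A. c i * (ln (p i) - ln (r i)))"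
proof -
  have deriv: "((\<lambda>t. \<Sum>i\<in>A. c i * (ln (r i + t * p i) - ln (r i))) has_real_derivative
      (\<Sum>i\<in>A. c i * p i / (r i + t * p i))) (at t)"
    if "t \<ge> 0" and A: "\<forall>i\<in>A. p i \<ge> 0 \<and> r i > 0 \<and> (p i = 0 \<longrightarrow> c i = 0)"
    for A :: "'x set" and c p r :: "'x \<Rightarrow> real" and t
  proof (rule DERIV_sum)
    fix i assume "i \<in> A"
    then have "r i + t * p i > 0" using A that(1) by (auto intro!: add_pos_nonneg)
    then show "((\<lambda>t. c i * (ln (r i + t * p i) - ln (r i))) has_real_derivative c i * p i / (r i + t * p i)) (at t)"
      by (auto intro!: derivative_eq_intros)
  qed
  have lim: "((\<lambda>t. (\<Sum>i\<in>A. c i * (ln (r i + t * p i) - ln (r i))) - ln t) \<longlongrightarrow>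
      (\<Sum>i\<in>A. c i * (ln (p i) - ln (r i)))) at_top"
    if A: "\<forall>i\<in>A. p i \<ge> 0 \<and> r i > 0 \<and> (p i = 0 \<longrightarrow> c i = 0)" and s: "(\<Sum>i\<in>A. c i) = 1"
    for A :: "'x set" and c p r :: "'x \<Rightarrow> real"
  proof -
    have "((\<lambda>t. \<Sum>i\<in>A. c i * (ln (r i / t + p i) - ln (r i))) \<longlongrightarrow> (\<Sum>i\<in>A. c i * (ln (p i) - ln (r i)))) at_top"
    proof (rule tendsto_sum)
      fix i assume i: "i \<in> A"
      show "((\<lambda>t. c i * (ln (r i / t + p i) - ln (r i))) \<longlongrightarrow> c i * (ln (p i) - ln (r i))) at_top"
      proof (cases "p i = 0")
        case True
        then show ?thesis using A i by simp
      next
        case False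
        have "((\<lambda>t. r i / t) \<longlongrightarrow> 0) at_top"
          by (rule tendsto_divide_0[OF tendsto_const filterlim_at_top_imp_at_infinity[OF filterlim_ident]])
        then have "((\<lambda>t. r i / t + p i) \<longlongrightarrow> 0 + p i) at_top" by (intro tendsto_add tendsto_const)
        then show ?thesis using False by (auto intro!: tendsto_intros)
      qed
    qed
    moreover have "\<forall>\<^sub>F t in at_top. (\<Sum>i\<in>A. c i * (ln (r i / t + p i) - ln (r i))) =
        (\<Sum>i\<in>A. c i * (ln (r i + t * p i) - ln (r i))) - ln t"
      using eventually_gt_at_top[of 0]
    proof eventually_elim
      case (elim t)
      have "(\<Sum>i\<in>A. c i * (ln (r i / t + p i) - ln (r i))) = (\<Sum>i\<in>A. c i * (ln (r i + t * p i) - ln (r i)) - c i * ln t)"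
      proof (intro sum.cong refl)
        fix i assume i: "i \<in> A"
        have "r i + t * p i > 0" using A i elim by (auto intro!: add_pos_nonneg)
        moreover have "r i / t + p i = (r i + t * p i) / t" using elim by (simp add: field_simps)
        ultimately have L: "ln (r i / t + p i) = ln (r i + t * p i) - ln t" using elim by (simp add: ln_div)
        show "c i * (ln (r i / t + p i) - ln (r i)) = c i * (ln (r i + t * p i) - ln (r i)) - c i * ln t"
          unfolding L by (simp add: algebra_simps)
      qed
      then show ?case using s by (simp add: sum_subtractf flip: sum_distrib_right)
    qed
    ultimately show ?thesis by (rule Lim_transform_eventually)
  qed
  let ?G = "\<lambda>t. \<Sum>i\<in>A. c i * (ln (r i + t * p i) - ln (r i))"
  let ?H = "\<lambda>t. \<Sum>i\<in>B. c' i * (ln (r' i + t * p' i) - ln (r' i))"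
  have GH: "?H t \<le> ?G t" if t: "t \<ge> 0" for t
  proof -
    have "?G 0 - ?H 0 \<le> ?G t - ?H t"
    proof (rule DERIV_nonneg_imp_nondecreasing[OF t])
      fix x :: real assume x: "0 \<le> x" "x \<le> t"
      show "\<exists>y. ((\<lambda>t. ?G t - ?H t) has_real_derivative y) (at x) \<and> 0 \<le> y"
        using DERIV_diff[OF deriv[OF x(1) A] deriv[OF x(1) B]] le[OF x(1)] by (intro exI conjI) auto
    qed
    then show ?thesis by simp
  qed
  show ?thesis
  proof (rule tendsto_le[OF _ lim[OF A s(1)] lim[OF B s(2)]])
    show "\<forall>\<^sub>F t in at_top. ?H t - ln t \<le> ?G t - ln t"
      using eventually_ge_at_top[of 0] by eventually_elim (use GH in auto)
  qed auto
qed

text \<open>The optimal test matrix of the primed pair lifts to one with the same value for the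
  unprimed pair, so the suprema are ordered for every \<open>t\<close>;
  \<open>log_integral_compare\<close> turns this into an inequality of relative entropies, written
  out in eigenbases.\<close>

lemma relative_entropy_mono:
  assumes U: "onb I J u" and V: "onb I K s"
    and F: "\<And>x y. x \<in> I \<Longrightarrow> y \<in> I \<Longrightarrow> F x y = (\<Sum>j\<in>J. complex_of_real (p j) * u j x * cnj (u j y))"
    and S: "\<And>x y. x \<in> I \<Longrightarrow> y \<in> I \<Longrightarrow> S x y = (\<Sum>k\<in>K. complex_of_real (r k) * s k x * cnj (s k y))"
    and p: "\<And>j. j \<in> J \<Longrightarrow> p j \<ge> 0" and r: "\<And>k. k \<in> K \<Longrightarrow> r k > 0" and p1: "(\<Sum>j\<in>J. p j) = 1"
    and U': "onb I' J' u'" and V': "onb I' K' s'"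
    and F': "\<And>x y. x \<in> I' \<Longrightarrow> y \<in> I' \<Longrightarrow> F' x y = (\<Sum>j\<in>J'. complex_of_real (p' j) * u' j x * cnj (u' j y))"
    and S': "\<And>x y. x \<in> I' \<Longrightarrow> y \<in> I' \<Longrightarrow> S' x y = (\<Sum>k\<in>K'. complex_of_real (r' k) * s' k x * cnj (s' k y))"
    and p': "\<And>j. j \<in> J' \<Longrightarrow> p' j \<ge> 0" and r': "\<And>k. k \<in> K' \<Longrightarrow> r' k > 0" and p1': "(\<Sum>j\<in>J'. p' j) = 1"
    and lift: "\<And>M'. \<exists>M. \<forall>t. qf I F S t M = qf I' F' S' t M'"
  shows "(\<Sum>j\<in>J'. \<Sum>k\<in>K'. p' j * (cmod (ip I' (u' j) (s' k)))\<^sup>2 * (ln (p' j) - ln (r' k)))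
    \<le> (\<Sum>j\<in>J. \<Sum>k\<in>K. p j * (cmod (ip I (u j) (s k)))\<^sup>2 * (ln (p j) - ln (r k)))"
proof -
  \<comment> \<open>Both families are orthonormal bases, so
    \<open>\<bar>\<langle>u j, s k\<rangle>\<bar>\<^sup>2\<close> sums to 1 over
    \<open>k\<close>.\<close>
  have tot: "(\<Sum>(j,k)\<in>J \<times> K. p j * (cmod (ip I (u j) (s k)))\<^sup>2) = 1"
    if U: "onb I J u" and V: "onb I K s" and p1: "(\<Sum>j\<in>J. p j) = 1"
    for I :: "'x set" and J :: "'y set" and K :: "'z set" and u s p
  proof -
    have "(\<Sum>k\<in>K. (cmod (ip I (u j) (s k)))\<^sup>2) = 1" if j: "j \<in> J" for j
    proof -
      have "(\<Sum>k\<in>K. (cmod (ip I (u j) (s k)))\<^sup>2) = (\<Sum>k\<in>K. (cmod (ip I (s k) (u j)))\<^sup>2)"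
        by (metis ip_cnj complex_mod_cnj)
      also have "\<dots> = (\<Sum>x\<in>I. (cmod (u j x))\<^sup>2)" by (rule parseval_norm[OF V, symmetric])
      also have "\<dots> = 1" using ip_self[of I "u j"] onbD(3)[OF U j j] by (metis of_real_eq_1_iff)
      finally show ?thesis .
    qed
    then show ?thesis using p1 by (simp add: sum.cartesian_product[symmetric] sum_distrib_left[symmetric])
  qed
  have le: "(\<Sum>(j,k)\<in>J' \<times> K'. p' j * (cmod (ip I' (u' j) (s' k)))\<^sup>2 * p' j / (r' k + t * p' j))
    \<le> (\<Sum>(j,k)\<in>J \<times> K. p j * (cmod (ip I (u j) (s k)))\<^sup>2 * p j / (r k + t * p j))" if t: "t \<ge> 0" for t
  proof -
    have "\<exists>M'. qf I' F' S' t M' = (\<Sum>j\<in>J'. \<Sum>k\<in>K'. p' j * (cmod (ip I' (u' j) (s' k)))\<^sup>2 * p' j / (r' k + t * p' j))"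
      by (rule qf_attained[OF U' V' _ _ p' r' t]) (rule F' S', assumption+)+
    then obtain M' where M': "qf I' F' S' t M' = (\<Sum>j\<in>J'. \<Sum>k\<in>K'. p' j * (cmod (ip I' (u' j) (s' k)))\<^sup>2 * p' j / (r' k + t * p' j))" ..
    obtain M where M: "\<forall>t. qf I F S t M = qf I' F' S' t M'" using lift ..
    have "qf I F S t M \<le> (\<Sum>j\<in>J. \<Sum>k\<in>K. p j * (cmod (ip I (u j) (s k)))\<^sup>2 * p j / (r k + t * p j))"
      by (rule qf_le[OF U V _ _ p r t]) (rule F S, assumption+)+
    then show ?thesis using M M' by (simp add: sum.cartesian_product)
  qed
  have fin: "finite (J \<times> K)" "finite (J' \<times> K')" using onbD(2)[OF U] onbD(2)[OF V] onbD(2)[OF U'] onbD(2)[OF V'] by auto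
  have "(\<Sum>i\<in>J' \<times> K'. (case i of (j,k) \<Rightarrow> p' j * (cmod (ip I' (u' j) (s' k)))\<^sup>2) * (ln (p' (fst i)) - ln (r' (snd i))))
    \<le> (\<Sum>i\<in>J \<times> K. (case i of (j,k) \<Rightarrow> p j * (cmod (ip I (u j) (s k)))\<^sup>2) * (ln (p (fst i)) - ln (r (snd i))))"
  proof (rule log_integral_compare[OF fin])
    fix t :: real assume "t \<ge> 0"
    show "(\<Sum>i\<in>J' \<times> K'. (case i of (j,k) \<Rightarrow> p' j * (cmod (ip I' (u' j) (s' k)))\<^sup>2) * p' (fst i) / (r' (snd i) + t * p' (fst i)))
      \<le> (\<Sum>i\<in>J \<times> K. (case i of (j,k) \<Rightarrow> p j * (cmod (ip I (u j) (s k)))\<^sup>2) * p (fst i) / (r (snd i) + t * p (fst i)))"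
      using le[OF \<open>t \<ge> 0\<close>] by (simp add: case_prod_beta)
  qed (use p r p' r' tot[OF U V p1] tot[OF U' V' p1'] in auto)
  then show ?thesis by (simp add: sum.cartesian_product case_prod_beta)
qed

subsection \<open>Strong subadditivity\<close>

lemma onb_of_sdec_full: "sdec_full I F J p u \<Longrightarrow> onb I J u"
  unfolding sdec_full_def sdec_def onb_def by auto

lemma sdec_full_sdec: "sdec_full I F J p u \<Longrightarrow> sdec I F J p u"
  unfolding sdec_full_def by blast

lemma onb_tensor_delta:
  assumes "finite X" "onb W J v"
  shows "onb (X \<times> W) (X \<times> J) (\<lambda>(a,j) (x,w). if x = a then v j w else 0)"
proof -
  note D = onbD[OF assms(2)]
  let ?s = "\<lambda>(a,j) (x,w). if x = a then v j w else 0"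
  have "ip (X \<times> W) (?s k) (?s l) = (if k = l then 1 else 0)" if kl: "k \<in> X \<times> J" "l \<in> X \<times> J" for k l
  proof -
    obtain a j b i where k: "k = (a,j)" "l = (b,i)" "a \<in> X" "j \<in> J" "b \<in> X" "i \<in> J" using kl by auto
    have "ip (X \<times> W) (?s k) (?s l) = (\<Sum>x\<in>X. \<Sum>w\<in>W. (if x = a then cnj (v j w) else 0) * (if x = b then v i w else 0))"
      unfolding ip_def k sum.cartesian_product by (intro sum.cong refl) auto
    also have "\<dots> = (\<Sum>x\<in>X. if x = a then (if a = b then ip W (v j) (v i) else 0) else 0)"
      unfolding ip_def by (intro sum.cong refl) auto
    also have "\<dots> = (if k = l then 1 else 0)" using k assms(1) D(3) by auto
    finally show ?thesis .
  qed
  moreover have "(\<Sum>k\<in>X \<times> J. ?s k y * cnj (?s k z)) = (if y = z then 1 else 0)"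
    if yz: "y \<in> X \<times> W" "z \<in> X \<times> W" for y z
  proof -
    obtain x w x' w' where k: "y = (x,w)" "z = (x',w')" "x \<in> X" "w \<in> W" "x' \<in> X" "w' \<in> W" using yz by auto
    have "(\<Sum>k\<in>X \<times> J. ?s k y * cnj (?s k z)) = (\<Sum>a\<in>X. \<Sum>j\<in>J. (if x = a then v j w else 0) * (if x' = a then cnj (v j w') else 0))"
      unfolding k sum.cartesian_product by (intro sum.cong refl) auto
    also have "\<dots> = (\<Sum>a\<in>X. if a = x then (if x = x' then (\<Sum>j\<in>J. v j w * cnj (v j w')) else 0) else 0)"
      by (intro sum.cong refl) auto
    also have "\<dots> = (if y = z then 1 else 0)" using k assms(1) D(4) by auto
    finally show ?thesis .
  qed
  ultimately show ?thesis unfolding onb_def using D(1,2) assms(1) by blast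
qed

lemma sum_p_ln_eq_kent:
  assumes "sdec I F J p u"
  shows "(\<Sum>j\<in>J. p j * ln (p j)) = - ln 2 * kent F"
proof -
  have "p j * ln (p j) = - ln 2 * eta (p j)" for j unfolding eta_def log_def by simp
  then show ?thesis unfolding kent_eq[OF assms] by (simp add: sum_distrib_left)
qed

text \<open>Relative entropy of \<open>F\<close> with respect to the (unnormalised) operator
  \<open>1 \<otimes> (\<tau> + e)\<close>, where \<open>\<tau>\<close> is the second marginal of \<open>F\<close>.\<close>
lemma relative_entropy_conditional:
  assumes F: "sdec_full (X \<times> W) F J p u" and T: "sdec_full W \<tau> J' q v"
    and \<tau>: "\<forall>w\<in>W. \<forall>w'\<in>W. \<tau> w w' = (\<Sum>a\<in>X. F (a,w) (a,w'))"
    and X: "finite X"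
  shows "(\<Sum>j\<in>J. \<Sum>k\<in>X \<times> J'. p j * (cmod (ip (X \<times> W) (u j) ((\<lambda>(a,j) (x,w). if x = a then v j w else 0) k)))\<^sup>2
      * (ln (p j) - ln (q (snd k) + e))) = - ln 2 * kent F - (\<Sum>i\<in>J'. q i * ln (q i + e))"
proof -
  let ?s = "\<lambda>(a,j) (x,w). if x = a then v j w else 0"
  let ?I = "X \<times> W" and ?K = "X \<times> J'"
  let ?w = "\<lambda>j k. (cmod (ip ?I (u j) (?s k)))\<^sup>2"
  note U = onb_of_sdec_full[OF F] and V0 = onb_of_sdec_full[OF T]
  note sF = sdec_full_sdec[OF F] and sT = sdec_full_sdec[OF T]
  note V = onb_tensor_delta[OF X V0]
  have "(\<Sum>j\<in>J. \<Sum>k\<in>?K. p j * ?w j k * ln (p j)) = (\<Sum>j\<in>J. p j * ln (p j))"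
  proof (intro sum.cong refl)
    fix j assume j: "j \<in> J"
    have "(\<Sum>k\<in>?K. ?w j k) = (\<Sum>k\<in>?K. (cmod (ip ?I (?s k) (u j)))\<^sup>2)"
      by (intro sum.cong refl) (metis ip_cnj complex_mod_cnj)
    also have "\<dots> = (\<Sum>x\<in>?I. (cmod (u j x))\<^sup>2)" by (rule parseval_norm[OF V, symmetric])
    also have "\<dots> = 1" using ip_self[of ?I "u j"] onbD(3)[OF U j j] by (metis of_real_eq_1_iff)
    finally have 1: "(\<Sum>k\<in>?K. ?w j k) = 1" .
    have "(\<Sum>k\<in>?K. p j * ?w j k * ln (p j)) = p j * ln (p j) * (\<Sum>k\<in>?K. ?w j k)"
      unfolding sum_distrib_left by (intro sum.cong refl) simp
    then show "(\<Sum>k\<in>?K. p j * ?w j k * ln (p j)) = p j * ln (p j)" using 1 by simp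
  qed
  then have A: "(\<Sum>j\<in>J. \<Sum>k\<in>?K. p j * ?w j k * ln (p j)) = - ln 2 * kent F"
    unfolding sum_p_ln_eq_kent[OF sF] .
  have "(\<Sum>j\<in>J. \<Sum>k\<in>?K. p j * ?w j k * ln (q (snd k) + e)) = (\<Sum>k\<in>?K. \<Sum>j\<in>J. p j * ?w j k * ln (q (snd k) + e))"
    by (rule sum.swap)
  also have "\<dots> = (\<Sum>(a,i)\<in>?K. (\<Sum>j\<in>J. p j * ?w j (a,i)) * ln (q i + e))"
    by (intro sum.cong refl) (auto simp: sum_distrib_right)
  also have "\<dots> = (\<Sum>a\<in>X. \<Sum>i\<in>J'. (\<Sum>j\<in>J. p j * ?w j (a,i)) * ln (q i + e))"
    by (rule sum.cartesian_product[symmetric])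
  also have "\<dots> = (\<Sum>i\<in>J'. \<Sum>a\<in>X. (\<Sum>j\<in>J. p j * ?w j (a,i)) * ln (q i + e))"
    by (rule sum.swap)
  also have "\<dots> = (\<Sum>i\<in>J'. q i * ln (q i + e))"
  proof (intro sum.cong refl)
    fix i assume i: "i \<in> J'"
    \<comment> \<open>Summing the quadratic forms of \<open>F\<close> at the vectors
      \<open>\<delta>_a \<otimes> v i\<close> over \<open>a\<close> gives the form of the marginal
      \<open>\<tau>\<close> at \<open>v i\<close>, which is \<open>q i\<close>.\<close>
    have "complex_of_real (\<Sum>a\<in>X. \<Sum>j\<in>J. p j * ?w j (a,i)) = (\<Sum>a\<in>X. \<Sum>x\<in>?I. \<Sum>y\<in>?I. cnj (?s (a,i) x) * F x y * ?s (a,i) y)"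
      unfolding sdec_quadratic_form[OF sF] by simp
    also have "\<dots> = (\<Sum>a\<in>X. \<Sum>w\<in>W. \<Sum>w'\<in>W. cnj (v i w) * F (a,w) (a,w') * v i w')"
    proof (intro sum.cong refl)
      fix a assume a: "a \<in> X"
      have "(\<Sum>x\<in>?I. \<Sum>y\<in>?I. cnj (?s (a,i) x) * F x y * ?s (a,i) y) =
        (\<Sum>b\<in>X. \<Sum>w\<in>W. \<Sum>c\<in>X. \<Sum>w'\<in>W. cnj (if b = a then v i w else 0) * F (b,w) (c,w') * (if c = a then v i w' else 0))"
        by (simp only: sum.cartesian_product' prod.case)
      also have "\<dots> = (\<Sum>b\<in>X. if b = a then (\<Sum>w\<in>W. \<Sum>c\<in>X. if c = a then (\<Sum>w'\<in>W. cnj (v i w) * F (a,w) (a,w') * v i w') else 0) else 0)"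
        by (intro sum.cong refl) (auto intro!: sum.cong)
      also have "\<dots> = (\<Sum>w\<in>W. \<Sum>w'\<in>W. cnj (v i w) * F (a,w) (a,w') * v i w')"
        using a X by simp
      finally show "(\<Sum>x\<in>?I. \<Sum>y\<in>?I. cnj (?s (a,i) x) * F x y * ?s (a,i) y) =
        (\<Sum>w\<in>W. \<Sum>w'\<in>W. cnj (v i w) * F (a,w) (a,w') * v i w')" .
    qed
    also have "\<dots> = (\<Sum>w\<in>W. \<Sum>a\<in>X. \<Sum>w'\<in>W. cnj (v i w) * F (a,w) (a,w') * v i w')" by (rule sum.swap)
    also have "\<dots> = (\<Sum>w\<in>W. \<Sum>w'\<in>W. \<Sum>a\<in>X. cnj (v i w) * F (a,w) (a,w') * v i w')"
      by (intro sum.cong refl sum.swap)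
    also have "\<dots> = (\<Sum>w\<in>W. \<Sum>w'\<in>W. cnj (v i w) * \<tau> w w' * v i w')"
      by (intro sum.cong refl) (simp add: \<tau> sum_distrib_left sum_distrib_right)
    also have "\<dots> = complex_of_real (\<Sum>j\<in>J'. q j * (cmod (ip W (v j) (v i)))\<^sup>2)"
      by (rule sdec_quadratic_form[OF sT])
    also have "(\<Sum>j\<in>J'. q j * (cmod (ip W (v j) (v i)))\<^sup>2) = (\<Sum>j\<in>J'. if j = i then q i else 0)"
      using onbD(3)[OF V0] i by (intro sum.cong refl) auto
    also have "\<dots> = q i" using i onbD(2)[OF V0] by simp
    finally have "(\<Sum>a\<in>X. \<Sum>j\<in>J. p j * ?w j (a,i)) = q i" by (simp only: of_real_eq_iff)
    then show "(\<Sum>a\<in>X. (\<Sum>j\<in>J. p j * ?w j (a,i)) * ln (q i + e)) = q i * ln (q i + e)"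
      by (simp only: sum_distrib_right[symmetric])
  qed
  finally have B: "(\<Sum>j\<in>J. \<Sum>k\<in>?K. p j * ?w j k * ln (q (snd k) + e)) = (\<Sum>i\<in>J'. q i * ln (q i + e))" .
  show ?thesis unfolding right_diff_distrib sum_subtractf A B ..
qed

text \<open>Spectral form of \<open>1 \<otimes> (\<tau> + e)\<close> in the product basis; the
  summand \<open>e\<close> is resolved by completeness of \<open>v\<close>.\<close>

lemma repr_tensor_delta:
  assumes T: "sdec_full W \<tau> J' q v" and X: "finite X" and xy: "x \<in> X \<times> W" "y \<in> X \<times> W"
  shows "(if fst x = fst y then \<tau> (snd x) (snd y) + (if snd x = snd y then complex_of_real e else 0) else 0) =
    (\<Sum>k\<in>X \<times> J'. complex_of_real (q (snd k) + e) * (\<lambda>(a,j) (x,w). if x = a then v j w else 0) k x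
      * cnj ((\<lambda>(a,j) (x,w). if x = a then v j w else 0) k y))"
proof -
  obtain a w b w' where k: "x = (a,w)" "y = (b,w')" "a \<in> X" "w \<in> W" "b \<in> X" "w' \<in> W" using xy by auto
  have "(\<Sum>k\<in>X \<times> J'. complex_of_real (q (snd k) + e) * (\<lambda>(a,j) (x,w). if x = a then v j w else 0) k x
      * cnj ((\<lambda>(a,j) (x,w). if x = a then v j w else 0) k y)) =
    (\<Sum>c\<in>X. \<Sum>j\<in>J'. complex_of_real (q j + e) * (if a = c then v j w else 0) * cnj (if b = c then v j w' else 0))"
    unfolding k by (simp add: sum.cartesian_product case_prod_beta)
  also have "\<dots> = (\<Sum>c\<in>X. if c = a then (if a = b then (\<Sum>j\<in>J'. complex_of_real (q j + e) * v j w * cnj (v j w')) else 0) else 0)"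
    by (intro sum.cong refl) auto
  also have "\<dots> = (if a = b then (\<Sum>j\<in>J'. complex_of_real (q j + e) * v j w * cnj (v j w')) else 0)"
    using k X by simp
  also have "(\<Sum>j\<in>J'. complex_of_real (q j + e) * v j w * cnj (v j w')) = \<tau> w w' + (if w = w' then complex_of_real e else 0)"
  proof -
    have "(\<Sum>j\<in>J'. complex_of_real (q j + e) * v j w * cnj (v j w')) =
      (\<Sum>j\<in>J'. complex_of_real (q j) * v j w * cnj (v j w')) + complex_of_real e * (\<Sum>j\<in>J'. v j w * cnj (v j w'))"
      by (simp add: sum_distrib_left algebra_simps sum.distrib)
    then show ?thesis using sdecD(5)[OF sdec_full_sdec[OF T], of w w'] onbD(4)[OF onb_of_sdec_full[OF T] k(4,6)]
      by simp
  qed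
  finally show ?thesis unfolding k by simp
qed

text \<open>With \<open>M \<otimes> 1\<close> as test matrix, the products occurring in
  \<open>qf\<close> are again of the form \<open>N \<otimes> 1\<close>, so trace duality turns each
  of the three terms into the one for the reductions.\<close>

lemma qf_tensor_id:
  assumes bij: "bij_betw (\<lambda>w. (\<pi> w, \<pi>' w)) I (I' \<times> Z)" and fin: "finite I'" "finite Z"
  shows "qf I F S t (\<lambda>v w. if \<pi>' v = \<pi>' w then M (\<pi> v) (\<pi> w) else 0) = qf I' (red I F \<pi> \<pi>') (red I S \<pi> \<pi>') t M"
proof -
  let ?M = "\<lambda>v w. if \<pi>' v = \<pi>' w then M (\<pi> v) (\<pi> w) else 0"
  have im: "\<pi> ` I \<subseteq> I'" "\<pi>' ` I \<subseteq> Z" using bij_betwE[OF bij] by auto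
  have split: "(\<Sum>z\<in>I. if c = \<pi>' z then h (\<pi> z) else 0) = (\<Sum>z\<in>I'. h z)" if c: "c \<in> Z" for h :: "'b \<Rightarrow> complex" and c
  proof -
    have "(\<Sum>z\<in>I. if c = \<pi>' z then h (\<pi> z) else 0) = (\<Sum>(z,d)\<in>I' \<times> Z. if c = d then h z else 0)"
      using sum.reindex_bij_betw[OF bij, of "\<lambda>(z,d). if c = d then h z else 0"] by simp
    also have "\<dots> = (\<Sum>(z,d)\<in>I' \<times> {c}. h z)"
      using c fin by (intro sum.mono_neutral_cong_right) (auto split: if_splits)
    also have "\<dots> = (\<Sum>z\<in>I'. h z)" by (simp add: sum.cartesian_product[symmetric])
    finally show ?thesis .
  qed
  have 1: "(\<Sum>x\<in>I. \<Sum>y\<in>I. ?M y x * F x y) = (\<Sum>x\<in>I'. \<Sum>y\<in>I'. M y x * red I F \<pi> \<pi>' x y)"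
    unfolding red_sum[OF fin(1) im(1)] by (intro sum.cong refl) auto
  have 2: "(\<Sum>x\<in>I. \<Sum>y\<in>I. (\<Sum>z\<in>I. ?M y z * cnj (?M x z)) * S x y) =
      (\<Sum>x\<in>I'. \<Sum>y\<in>I'. (\<Sum>z\<in>I'. M y z * cnj (M x z)) * red I S \<pi> \<pi>' x y)"
    unfolding red_sum[OF fin(1) im(1)]
  proof (intro sum.cong refl)
    fix x y assume xy: "x \<in> I" "y \<in> I"
    have "(\<Sum>z\<in>I. ?M y z * cnj (?M x z)) = (if \<pi>' x = \<pi>' y then \<Sum>z\<in>I. if \<pi>' y = \<pi>' z then M (\<pi> y) (\<pi> z) * cnj (M (\<pi> x) (\<pi> z)) else 0 else 0)"
      by (auto intro!: sum.cong sum.neutral)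
    also have "\<dots> = (if \<pi>' x = \<pi>' y then \<Sum>z\<in>I'. M (\<pi> y) z * cnj (M (\<pi> x) z) else 0)"
      using split[of "\<pi>' y" "\<lambda>z. M (\<pi> y) z * cnj (M (\<pi> x) z)"] im xy by auto
    finally show "(\<Sum>z\<in>I. ?M y z * cnj (?M x z)) * S x y = (if \<pi>' x = \<pi>' y then (\<Sum>z\<in>I'. M (\<pi> y) z * cnj (M (\<pi> x) z)) * S x y else 0)"
      by simp
  qed
  have 3: "(\<Sum>x\<in>I. \<Sum>y\<in>I. (\<Sum>z\<in>I. cnj (?M z y) * ?M z x) * F x y) =
      (\<Sum>x\<in>I'. \<Sum>y\<in>I'. (\<Sum>z\<in>I'. cnj (M z y) * M z x) * red I F \<pi> \<pi>' x y)"
    unfolding red_sum[OF fin(1) im(1)]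
  proof (intro sum.cong refl)
    fix x y assume xy: "x \<in> I" "y \<in> I"
    have "(\<Sum>z\<in>I. cnj (?M z y) * ?M z x) = (if \<pi>' x = \<pi>' y then \<Sum>z\<in>I. if \<pi>' y = \<pi>' z then cnj (M (\<pi> z) (\<pi> y)) * M (\<pi> z) (\<pi> x) else 0 else 0)"
      by (auto intro!: sum.cong sum.neutral)
    also have "\<dots> = (if \<pi>' x = \<pi>' y then \<Sum>z\<in>I'. cnj (M z (\<pi> y)) * M z (\<pi> x) else 0)"
      using split[of "\<pi>' y" "\<lambda>z. cnj (M z (\<pi> y)) * M z (\<pi> x)"] im xy by auto
    finally show "(\<Sum>z\<in>I. cnj (?M z y) * ?M z x) * F x y = (if \<pi>' x = \<pi>' y then (\<Sum>z\<in>I'. cnj (M z (\<pi> y)) * M z (\<pi> x)) * F x y else 0)"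
      by simp
  qed
  show ?thesis unfolding qf_def 1 2 3 ..
qed

text \<open>Where \<open>q i = 0\<close> the logarithm diverges, but its own factor annihilates the
  term.\<close>

lemma tendsto_sum_mult_ln:
  assumes "\<And>i. i \<in> J \<Longrightarrow> q i \<ge> 0"
  shows "((\<lambda>e. \<Sum>i\<in>J. q i * ln (q i + c * e)) \<longlongrightarrow> (\<Sum>i\<in>J. q i * ln (q i :: real))) (at_right 0)"
proof (rule tendsto_sum)
  fix i assume i: "i \<in> J"
  show "((\<lambda>e. q i * ln (q i + c * e)) \<longlongrightarrow> q i * ln (q i)) (at_right 0)"
  proof (cases "q i = 0")
    case False
    have "((\<lambda>e. q i + c * e) \<longlongrightarrow> q i + c * 0) (at_right 0)"
      by (intro tendsto_intros)
    then show ?thesis using False by (auto intro!: tendsto_intros)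
  qed simp
qed

text \<open>Monotonicity under tracing out \<open>Z\<close>, for \<open>F\<close> against
  \<open>1 \<otimes> T\<close> with \<open>T\<close> the marginal on \<open>Y \<times> Z\<close>: up
  to the factor \<open>ln 2\<close>, the relative entropy is \<open>S(YZ) - S(XYZ)\<close> before
  and \<open>S(Y) - S(XY)\<close> after.\<close>

theorem strong_subadditivity:
  fixes F :: "('x \<times> 'y \<times> 'z) \<Rightarrow> ('x \<times> 'y \<times> 'z) \<Rightarrow> complex"
  assumes d: "dens (X \<times> Y \<times> Z) F"
  shows "kent F + kent (red (X \<times> Y \<times> Z) F (\<lambda>(x,y,z). y) (\<lambda>(x,y,z). (x,z)))
    \<le> kent (red (X \<times> Y \<times> Z) F (\<lambda>(x,y,z). (x,y)) (\<lambda>(x,y,z). z))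
      + kent (red (X \<times> Y \<times> Z) F (\<lambda>(x,y,z). (y,z)) (\<lambda>(x,y,z). x))"
proof -
  define I where "I = X \<times> Y \<times> Z"
  define G where "G = red I F (\<lambda>(x,y,z). (x,y)) (\<lambda>(x,y,z). z)"
  define T where "T = red I F (\<lambda>(x,y,z). (y,z)) (\<lambda>(x,y,z). x)"
  define T' where "T' = red I F (\<lambda>(x,y,z). y) (\<lambda>(x,y,z). (x,z))"
  have dI: "dens I F" using d unfolding I_def .
  have "I \<noteq> {}" using dI unfolding dens_def by auto
  then have ne: "X \<noteq> {}" "Y \<noteq> {}" "Z \<noteq> {}" unfolding I_def by auto
  have finI: "finite I" using dI unfolding dens_def by blast
  then have fin: "finite X" "finite Y" "finite Z"
    unfolding I_def using ne by (auto dest: finite_cartesian_productD1 finite_cartesian_productD2)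
  have im: "(\<lambda>(x,y,z). (x,y)) ` I = X \<times> Y" "(\<lambda>(x,y,z). (y,z)) ` I = Y \<times> Z" "(\<lambda>(x,y,z). y) ` I = Y"
    unfolding I_def using ne by force+
  have dG: "dens (X \<times> Y) G" unfolding G_def im(1)[symmetric]
    by (rule dens_red[OF dI]) (auto simp: inj_on_def)
  have dT: "dens (Y \<times> Z) T" unfolding T_def im(2)[symmetric]
    by (rule dens_red[OF dI]) (auto simp: inj_on_def)
  have dT': "dens Y T'" unfolding T'_def im(3)[symmetric]
    by (rule dens_red[OF dI]) (auto simp: inj_on_def)
  have Tv: "T w w' = (\<Sum>a\<in>X. F (a,w) (a,w'))" if "w \<in> Y \<times> Z" "w' \<in> Y \<times> Z" for w w'
    unfolding T_def using fin(1) finI that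
    by (intro red_product[where W = "Y \<times> Z" and f = "\<lambda>w a. (a,w)"]) (auto simp: I_def)
  have Gv: "G w w' = (\<Sum>z\<in>Z. F (fst w, snd w, z) (fst w', snd w', z))" if "w \<in> X \<times> Y" "w' \<in> X \<times> Y" for w w'
    unfolding G_def using fin(3) finI that
    by (intro red_product[where W = "X \<times> Y" and f = "\<lambda>w z. (fst w, snd w, z)"]) (auto simp: I_def)
  have T'v: "T' y y' = (\<Sum>c\<in>X \<times> Z. F (fst c, y, snd c) (fst c, y', snd c))" if "y \<in> Y" "y' \<in> Y" for y y'
    unfolding T'_def using fin finI that
    by (intro red_product[where W = Y and f = "\<lambda>y c. (fst c, y, snd c)"]) (auto simp: I_def)
  have T'G: "T' y y' = (\<Sum>a\<in>X. G (a,y) (a,y'))" if "y \<in> Y" "y' \<in> Y" for y y'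
    using that by (simp add: T'v Gv sum.cartesian_product case_prod_beta)
  have T'T: "T' y y' = (\<Sum>z\<in>Z. T (y,z) (y',z))" if "y \<in> Y" "y' \<in> Y" for y y'
  proof -
    have "T' y y' = (\<Sum>a\<in>X. \<Sum>z\<in>Z. F (a,y,z) (a,y',z))"
      using that by (simp add: T'v sum.cartesian_product case_prod_beta)
    also have "\<dots> = (\<Sum>z\<in>Z. \<Sum>a\<in>X. F (a,y,z) (a,y',z))" by (rule sum.swap)
    finally show ?thesis using that by (simp add: Tv)
  qed
  obtain p u where sF: "sdec_full (X \<times> (Y \<times> Z)) F {..<card (X \<times> (Y \<times> Z))} p u" using sdec_full_exists[OF d] by auto
  obtain q v where sT: "sdec_full (Y \<times> Z) T {..<card (Y \<times> Z)} q v" using sdec_full_exists[OF dT] by auto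
  obtain p' u' where sG: "sdec_full (X \<times> Y) G {..<card (X \<times> Y)} p' u'" using sdec_full_exists[OF dG] by auto
  obtain q' v' where sT': "sdec_full Y T' {..<card Y} q' v'" using sdec_full_exists[OF dT'] by auto
  have p: "p j \<ge> 0" if "j \<in> {..<card (X \<times> (Y \<times> Z))}" for j using sdec_dens_nonneg[OF sdec_full_sdec[OF sF] d that] .
  have q: "q j \<ge> 0" if "j \<in> {..<card (Y \<times> Z)}" for j using sdec_dens_nonneg[OF sdec_full_sdec[OF sT] dT that] .
  have p': "p' j \<ge> 0" if "j \<in> {..<card (X \<times> Y)}" for j using sdec_dens_nonneg[OF sdec_full_sdec[OF sG] dG that] .
  have q': "q' j \<ge> 0" if "j \<in> {..<card Y}" for j using sdec_dens_nonneg[OF sdec_full_sdec[OF sT'] dT' that] .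
  \<comment> \<open>Tracing \<open>Z\<close> out of \<open>1 \<otimes> (T + e)\<close> adds up
    \<open>card Z\<close> copies of \<open>e\<close>, so the reduced reference operator carries the
    shift \<open>c * e\<close>.\<close>
  define c where "c = real (card Z)"
  have c: "c > 0" unfolding c_def using fin ne by (simp add: card_gt_0_iff)
  have main: "- ln 2 * kent G - (\<Sum>i<card Y. q' i * ln (q' i + c * e)) \<le> - ln 2 * kent F - (\<Sum>i<card (Y \<times> Z). q i * ln (q i + e))"
    if e: "e > 0" for e
  proof -
    define S where "S x y = (if fst x = fst y then T (snd x) (snd y) + (if snd x = snd y then complex_of_real e else 0) else 0)" for x y :: "'x \<times> 'y \<times> 'z"
    define S' where "S' x y = (if fst x = fst y then T' (snd x) (snd y) + (if snd x = snd y then complex_of_real (c * e) else 0) else 0)" for x y :: "'x \<times> 'y"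
    let ?\<pi> = "\<lambda>(x,y,z). (x,y)" and ?\<pi>' = "\<lambda>(x::'x,y::'y,z::'z). z"
    have redS: "red I S ?\<pi> ?\<pi>' w w' = S' w w'" if w: "w \<in> X \<times> Y" "w' \<in> X \<times> Y" for w w'
    proof -
      have "red I S ?\<pi> ?\<pi>' w w' = (\<Sum>z\<in>Z. S (fst w, snd w, z) (fst w', snd w', z))"
        using fin(3) finI w
        by (intro red_product[where W = "X \<times> Y" and f = "\<lambda>w z. (fst w, snd w, z)"]) (auto simp: I_def)
      also have "\<dots> = S' w w'"
        using w T'T[of "snd w" "snd w'"] by (auto simp: S_def S'_def sum.distrib c_def)
      finally show ?thesis .
    qed
    have bij: "bij_betw (\<lambda>w. (?\<pi> w, ?\<pi>' w)) I ((X \<times> Y) \<times> Z)"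
      unfolding I_def by (rule bij_betwI[where g = "\<lambda>((x,y),z). (x,y,z)"]) auto
    have lift: "\<exists>M. \<forall>t. qf (X \<times> (Y \<times> Z)) F S t M = qf (X \<times> Y) G S' t M'" for M'
    proof -
      have "qf I F S t (\<lambda>v w. if ?\<pi>' v = ?\<pi>' w then M' (?\<pi> v) (?\<pi> w) else 0) = qf (X \<times> Y) G S' t M'" for t
        unfolding qf_tensor_id[OF bij finite_cartesian_product[OF fin(1,2)] fin(3)]
        unfolding qf_def G_def by (simp add: redS)
      then show ?thesis unfolding I_def by (intro exI allI)
    qed
    have "(\<Sum>j<card (X \<times> Y). \<Sum>k\<in>X \<times> {..<card Y}. p' j * (cmod (ip (X \<times> Y) (u' j) ((\<lambda>(a,j) (x,w). if x = a then v' j w else 0) k)))\<^sup>2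
          * (ln (p' j) - ln (q' (snd k) + c * e)))
      \<le> (\<Sum>j<card (X \<times> (Y \<times> Z)). \<Sum>k\<in>X \<times> {..<card (Y \<times> Z)}. p j * (cmod (ip (X \<times> (Y \<times> Z)) (u j) ((\<lambda>(a,j) (x,w). if x = a then v j w else 0) k)))\<^sup>2
          * (ln (p j) - ln (q (snd k) + e)))"
    proof (rule relative_entropy_mono[where F = F and S = S and F' = G and S' = S'])
      show "onb (X \<times> (Y \<times> Z)) {..<card (X \<times> (Y \<times> Z))} u" by (rule onb_of_sdec_full[OF sF])
      show "onb (X \<times> Y) {..<card (X \<times> Y)} u'" by (rule onb_of_sdec_full[OF sG])
      show "onb (X \<times> (Y \<times> Z)) (X \<times> {..<card (Y \<times> Z)}) (\<lambda>(a,j) (x,w). if x = a then v j w else 0)"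
        by (rule onb_tensor_delta[OF fin(1) onb_of_sdec_full[OF sT]])
      show "onb (X \<times> Y) (X \<times> {..<card Y}) (\<lambda>(a,j) (x,w). if x = a then v' j w else 0)"
        by (rule onb_tensor_delta[OF fin(1) onb_of_sdec_full[OF sT']])
      show "F x y = (\<Sum>j<card (X \<times> (Y \<times> Z)). complex_of_real (p j) * u j x * cnj (u j y))" for x y
        by (rule sdecD(5)[OF sdec_full_sdec[OF sF]])
      show "G x y = (\<Sum>j<card (X \<times> Y). complex_of_real (p' j) * u' j x * cnj (u' j y))" for x y
        by (rule sdecD(5)[OF sdec_full_sdec[OF sG]])
      show "S x y = (\<Sum>k\<in>X \<times> {..<card (Y \<times> Z)}. complex_of_real (q (snd k) + e) * (\<lambda>(a,j) (x,w). if x = a then v j w else 0) k x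
        * cnj ((\<lambda>(a,j) (x,w). if x = a then v j w else 0) k y))" if "x \<in> X \<times> (Y \<times> Z)" "y \<in> X \<times> (Y \<times> Z)" for x y
        unfolding S_def by (rule repr_tensor_delta[OF sT fin(1) that])
      show "S' x y = (\<Sum>k\<in>X \<times> {..<card Y}. complex_of_real (q' (snd k) + c * e) * (\<lambda>(a,j) (x,w). if x = a then v' j w else 0) k x
        * cnj ((\<lambda>(a,j) (x,w). if x = a then v' j w else 0) k y))" if "x \<in> X \<times> Y" "y \<in> X \<times> Y" for x y
        unfolding S'_def by (rule repr_tensor_delta[OF sT' fin(1) that])
      show "(\<Sum>j<card (X \<times> (Y \<times> Z)). p j) = 1" by (rule sdec_dens_sum[OF sdec_full_sdec[OF sF] d])
      show "(\<Sum>j<card (X \<times> Y). p' j) = 1" by (rule sdec_dens_sum[OF sdec_full_sdec[OF sG] dG])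
      show "q (snd k) + e > 0" if "k \<in> X \<times> {..<card (Y \<times> Z)}" for k using q[of "snd k"] e that by auto
      show "q' (snd k) + c * e > 0" if "k \<in> X \<times> {..<card Y}" for k
        using q'[of "snd k"] mult_pos_pos[OF c e] that by auto
    qed (use p p' lift in auto)
    then show ?thesis
      using relative_entropy_conditional[OF sF sT _ fin(1), of e] relative_entropy_conditional[OF sG sT' _ fin(1), of "c * e"] Tv T'G by simp
  qed
  have "- ln 2 * kent G - (\<Sum>i<card Y. q' i * ln (q' i)) \<le> - ln 2 * kent F - (\<Sum>i<card (Y \<times> Z). q i * ln (q i))"
  proof (rule tendsto_le)
    show "((\<lambda>e. - ln 2 * kent F - (\<Sum>i<card (Y \<times> Z). q i * ln (q i + 1 * e))) \<longlongrightarrow> - ln 2 * kent F - (\<Sum>i<card (Y \<times> Z). q i * ln (q i))) (at_right 0)"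
      by (rule tendsto_diff[OF tendsto_const tendsto_sum_mult_ln[OF q]])
    show "((\<lambda>e. - ln 2 * kent G - (\<Sum>i<card Y. q' i * ln (q' i + c * e))) \<longlongrightarrow> - ln 2 * kent G - (\<Sum>i<card Y. q' i * ln (q' i))) (at_right 0)"
      by (rule tendsto_diff[OF tendsto_const tendsto_sum_mult_ln[OF q']])
    show "\<forall>\<^sub>F e in at_right 0. - ln 2 * kent G - (\<Sum>i<card Y. q' i * ln (q' i + c * e)) \<le> - ln 2 * kent F - (\<Sum>i<card (Y \<times> Z). q i * ln (q i + 1 * e))"
      using eventually_at_right_less[of 0] by eventually_elim (use main in simp)
  qed simp
  then have "ln 2 * (kent F + kent T') \<le> ln 2 * (kent G + kent T)"
    unfolding sum_p_ln_eq_kent[OF sdec_full_sdec[OF sT]] sum_p_ln_eq_kent[OF sdec_full_sdec[OF sT']]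
    by (simp add: algebra_simps)
  then show ?thesis unfolding G_def T_def T'_def I_def by (simp add: mult_le_cancel_left)
qed

lemma dens_mono:
  assumes "dens I F" "finite I'" "I \<subseteq> I'"
  shows "dens I' F"
proof -
  have z: "F x y = 0" if "x \<notin> I \<or> y \<notin> I" for x y using assms(1) that unfolding dens_def by blast
  have "(\<Sum>x\<in>I'. F x x) = (\<Sum>x\<in>I. F x x)"
    using assms z by (intro sum.mono_neutral_right) auto
  moreover have "(\<Sum>x\<in>I'. \<Sum>y\<in>I'. cnj (v x) * F x y * v y) = (\<Sum>x\<in>I. \<Sum>y\<in>I. cnj (v x) * F x y * v y)" for v
    using assms(2,3) z by (intro sum.mono_neutral_cong_right ballI) (auto intro!: sum.mono_neutral_cong_right sum.neutral)
  ultimately show ?thesis using assms z unfolding dens_def by auto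
qed

lemma dens_finite: "dens I F \<Longrightarrow> finite I" and dens_outside: "dens I F \<Longrightarrow> x \<notin> I \<or> y \<notin> I \<Longrightarrow> F x y = 0"
  and dens_trace: "dens I F \<Longrightarrow> (\<Sum>x\<in>I. F x x) = 1"
  unfolding dens_def by blast+

text \<open>The joint labels may fill only part of the product \<open>?P\<close>; the reduction is
  extended by 0 to all of it before \<open>strong_subadditivity\<close> applies. The label
  \<open>e\<close> stands for what is traced out from the start.\<close>

lemma strong_subadditivity_labels:
  assumes d: "dens \<Omega> F" and inj: "inj_on (\<lambda>w. (a w, b w, c w, e w)) \<Omega>"
  shows "kent (red \<Omega> F (\<lambda>w. (a w, b w, c w)) e) + kent (red \<Omega> F b (\<lambda>w. (a w, c w, e w)))
    \<le> kent (red \<Omega> F (\<lambda>w. (a w, b w)) (\<lambda>w. (c w, e w))) + kent (red \<Omega> F (\<lambda>w. (b w, c w)) (\<lambda>w. (a w, e w)))"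
proof -
  let ?\<pi> = "\<lambda>w. (a w, b w, c w)"
  let ?P = "a ` \<Omega> \<times> b ` \<Omega> \<times> c ` \<Omega>"
  have fin: "finite ?P" using dens_finite[OF d] by simp
  have im: "?\<pi> ` \<Omega> \<subseteq> ?P" by auto
  have "dens (?\<pi> ` \<Omega>) (red \<Omega> F ?\<pi> e)"
    by (rule dens_red[OF d]) (use inj in \<open>auto simp: inj_on_def\<close>)
  then have "dens ?P (red \<Omega> F ?\<pi> e)" by (rule dens_mono[OF _ fin im])
  note ssa = strong_subadditivity[OF this, unfolded red_red[OF fin im] prod.case]
  have "red \<Omega> F b (\<lambda>w. ((a w, c w), e w)) = red \<Omega> F b (\<lambda>w. (a w, c w, e w))"
    by (rule red_cong) auto
  then show ?thesis using ssa by simp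
qed

text \<open>Strong subadditivity with a trivial middle system, labelled \<open>()\<close>, whose
  entropy is nonnegative.\<close>

lemma subadditivity_labels:
  assumes d: "dens \<Omega> F" and inj: "inj_on (\<lambda>w. (a w, c w, e w)) \<Omega>"
  shows "kent (red \<Omega> F (\<lambda>w. (a w, c w)) e)
    \<le> kent (red \<Omega> F a (\<lambda>w. (c w, e w))) + kent (red \<Omega> F c (\<lambda>w. (a w, e w)))"
proof -
  have "kent (red \<Omega> F (\<lambda>w. (a w, (), c w)) e) + kent (red \<Omega> F (\<lambda>w. ()) (\<lambda>w. (a w, c w, e w)))
    \<le> kent (red \<Omega> F (\<lambda>w. (a w, ())) (\<lambda>w. (c w, e w))) + kent (red \<Omega> F (\<lambda>w. ((), c w)) (\<lambda>w. (a w, e w)))"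
    by (rule strong_subadditivity_labels[OF d]) (use inj in \<open>auto simp: inj_on_def\<close>)
  moreover have "kent (red \<Omega> F (\<lambda>w. ()) (\<lambda>w. (a w, c w, e w))) \<ge> 0"
    by (rule kent_nonneg[OF dens_red[OF d]]) (use inj in \<open>auto simp: inj_on_def\<close>)
  moreover have "kent (red \<Omega> F (\<lambda>w. (a w, (), c w)) e) = kent (red \<Omega> F (\<lambda>w. (a w, c w)) e)"
    by (rule kent_red_cong[OF d]) (use inj in \<open>auto simp: inj_on_def\<close>)
  moreover have "kent (red \<Omega> F (\<lambda>w. (a w, ())) (\<lambda>w. (c w, e w))) = kent (red \<Omega> F a (\<lambda>w. (c w, e w)))"
    by (rule kent_red_cong[OF d]) (use inj in \<open>auto simp: inj_on_def\<close>)
  moreover have "kent (red \<Omega> F (\<lambda>w. ((), c w)) (\<lambda>w. (a w, e w))) = kent (red \<Omega> F c (\<lambda>w. (a w, e w)))"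
    by (rule kent_red_cong[OF d]) (use inj in \<open>auto simp: inj_on_def\<close>)
  ultimately show ?thesis by linarith
qed

subsection \<open>Mixtures with classical flags\<close>

lemma ip_tensor:
  "ip (I \<times> M) (\<lambda>(x,m). a x * c m) (\<lambda>(x,m). b x * d m) = ip I a b * ip M c d"
  unfolding ip_def sum_product sum.cartesian_product by (intro sum.cong refl) (auto simp: mult_ac)

text \<open>Orthonormal flags make the products of eigenvectors of \<open>G k\<close> with
  \<open>c k\<close> a single orthonormal family with eigenvalues \<open>p k * q k j\<close>;
  \<open>eta_mult\<close> then separates the entropy. Flags are general vectors so that the
  eigenvectors of a second kernel can serve as flags, as in \<open>kent_tensor\<close>.\<close>

lemma flagged_mixture:
  fixes F :: "'x \<times> 'm \<Rightarrow> 'x \<times> 'm \<Rightarrow> complex"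
  assumes K: "finite K" "\<And>k. k \<in> K \<Longrightarrow> p k \<ge> (0::real)" "(\<Sum>k\<in>K. p k) = 1"
    and G: "\<And>k. k \<in> K \<Longrightarrow> dens I (G k)" and I: "finite I" and M: "finite M"
    and c0: "\<And>k m. k \<in> K \<Longrightarrow> m \<notin> M \<Longrightarrow> c k m = 0"
    and c: "\<And>k l. k \<in> K \<Longrightarrow> l \<in> K \<Longrightarrow> ip M (c k) (c l) = (if k = l then 1 else 0)"
    and F: "\<And>x m y n. F (x,m) (y,n) = (\<Sum>k\<in>K. complex_of_real (p k) * G k x y * (c k m * cnj (c k n)))"
  shows "dens (I \<times> M) F" "kent F = (\<Sum>k\<in>K. eta (p k)) + (\<Sum>k\<in>K. p k * kent (G k))"
proof -
  have "\<forall>k. \<exists>q u. k \<in> K \<longrightarrow> sdec I (G k) {..<card I} q u"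
    using G dens_sdec_exists by metis
  then obtain q u where s: "\<And>k. k \<in> K \<Longrightarrow> sdec I (G k) {..<card I} (q k) (u k)" by metis
  let ?J = "K \<times> {..<card I}"
  let ?p = "\<lambda>(k,j). p k * q k j"
  let ?u = "\<lambda>(k,j) (x,m). u k j x * c k m"
  have S: "sdec (I \<times> M) F ?J ?p ?u"
    unfolding sdec_def
  proof (intro conjI ballI allI impI)
    show "finite (I \<times> M)" "finite ?J" using I M K by auto
  next
    fix i xm assume *: "i \<in> ?J" "xm \<notin> I \<times> M"
    obtain k j x m where kj: "i = (k,j)" "xm = (x,m)" "k \<in> K" "j < card I" "x \<notin> I \<or> m \<notin> M"
      using * by (cases i, cases xm) auto
    have "u k j x = 0 \<or> c k m = 0" using sdecD(3)[OF s[OF kj(3)], of j x] c0[OF kj(3), of m] kj(4,5) by auto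
    then show "?u i xm = 0" unfolding kj(1,2) by auto
  next
    fix i l assume il: "i \<in> ?J" "l \<in> ?J"
    obtain k j k' j' where kj: "i = (k,j)" "l = (k',j')" "k \<in> K" "k' \<in> K" "j < card I" "j' < card I" using il by auto
    have "ip (I \<times> M) (?u i) (?u l) = ip I (u k j) (u k' j') * ip M (c k) (c k')"
      unfolding kj(1,2) prod.case by (rule ip_tensor)
    then show "ip (I \<times> M) (?u i) (?u l) = (if i = l then 1 else 0)"
      using kj c[OF kj(3,4)] sdecD(4)[OF s[OF kj(3)], of j j'] by auto
  next
    fix a b :: "'x \<times> 'm"
    obtain x m y n where ab: "a = (x,m)" "b = (y,n)" by (metis surj_pair)
    have "F a b = (\<Sum>k\<in>K. \<Sum>j<card I. complex_of_real (p k * q k j) * (u k j x * c k m) * cnj (u k j y * c k n))"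
      unfolding ab F
    proof (intro sum.cong refl)
      fix k assume "k \<in> K"
      show "complex_of_real (p k) * G k x y * (c k m * cnj (c k n)) =
        (\<Sum>j<card I. complex_of_real (p k * q k j) * (u k j x * c k m) * cnj (u k j y * c k n))"
        unfolding sdecD(5)[OF s[OF \<open>k \<in> K\<close>]] by (simp add: sum_distrib_left sum_distrib_right mult_ac)
    qed
    then show "F a b = (\<Sum>j\<in>?J. complex_of_real (?p j) * ?u j a * cnj (?u j b))"
      unfolding ab by (simp add: sum.cartesian_product case_prod_beta)
  qed
  have q: "q k j \<ge> 0" if "k \<in> K" "j < card I" for k j
    using sdec_dens_nonneg[OF s[OF that(1)] G[OF that(1)], of j] that by simp
  have q1: "(\<Sum>j<card I. q k j) = 1" if "k \<in> K" for k
    by (rule sdec_dens_sum[OF s[OF that] G[OF that]])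
  show "dens (I \<times> M) F"
  proof (rule sdec_densI[OF S])
    show "(\<Sum>j\<in>?J. ?p j) = 1"
      using q1 K(3) by (simp add: sum.cartesian_product[symmetric] sum_distrib_left[symmetric])
  qed (use K(2) q in auto)
  have "kent F = (\<Sum>k\<in>K. \<Sum>j<card I. eta (p k * q k j))"
    unfolding kent_eq[OF S] by (simp add: sum.cartesian_product case_prod_beta)
  also have "\<dots> = (\<Sum>k\<in>K. eta (p k) + p k * kent (G k))"
  proof (intro sum.cong refl)
    fix k assume k: "k \<in> K"
    have "(\<Sum>j<card I. eta (p k * q k j)) = (\<Sum>j<card I. q k j * eta (p k) + p k * eta (q k j))"
      using K(2)[OF k] q[OF k] by (intro sum.cong refl eta_mult) auto
    also have "\<dots> = (\<Sum>j<card I. q k j) * eta (p k) + p k * (\<Sum>j<card I. eta (q k j))"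
      by (simp add: sum.distrib sum_distrib_left sum_distrib_right)
    finally show "(\<Sum>j<card I. eta (p k * q k j)) = eta (p k) + p k * kent (G k)"
      unfolding q1[OF k] kent_eq[OF s[OF k]] by simp
  qed
  finally show "kent F = (\<Sum>k\<in>K. eta (p k)) + (\<Sum>k\<in>K. p k * kent (G k))"
    by (simp add: sum.distrib)
qed

text \<open>The second factor is expanded in its eigenvectors, which act as flags attached to the
  constant family \<open>G\<close>.\<close>

lemma kent_tensor:
  assumes G: "dens I G" and H: "dens M H"
    and F: "\<And>x m y n. F (x,m) (y,n) = G x y * H m n"
  shows "dens (I \<times> M) F" "kent F = kent G + kent H"
proof -
  obtain q c where s: "sdec M H {..<card M} q c" using dens_sdec_exists[OF H] .
  note D = sdecD[OF s]
  note q = sdec_dens_nonneg[OF s H] and q1 = sdec_dens_sum[OF s H]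
  have F': "F (x,m) (y,n) = (\<Sum>k<card M. complex_of_real (q k) * G x y * (c k m * cnj (c k n)))" for x m y n
    unfolding F D(5) by (simp add: sum_distrib_left mult_ac)
  note X = flagged_mixture[of "{..<card M}" q I "\<lambda>_. G" M c F]
  show "dens (I \<times> M) F" by (rule X(1)) (use D q q1 F' G dens_finite[OF G] in auto)
  have "kent F = (\<Sum>k<card M. eta (q k)) + (\<Sum>k<card M. q k * kent G)"
    by (rule X(2)) (use D q q1 F' G dens_finite[OF G] in auto)
  then show "kent F = kent G + kent H" unfolding kent_eq[OF s] using q1 by (simp flip: sum_distrib_right)
qed

lemma red_id:
  assumes "finite \<Omega>" "\<And>v w. v \<notin> \<Omega> \<or> w \<notin> \<Omega> \<Longrightarrow> H v w = 0"
  shows "red \<Omega> H (\<lambda>v. v) (\<lambda>v. ()) x y = H x y"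
proof (cases "x \<in> \<Omega> \<and> y \<in> \<Omega>")
  case True
  have "red \<Omega> H (\<lambda>v. v) (\<lambda>v. ()) x y = (\<Sum>z\<in>{()}. H x y)"
    using True assms(1) by (intro red_product[where W = \<Omega> and f = "\<lambda>w z. w"]) auto
  then show ?thesis by simp
next
  case False
  then show ?thesis using assms(2) by (auto intro!: red_outside)
qed

lemma red_fst:
  assumes "finite I" "finite M" "\<And>x y. x \<notin> I \<or> y \<notin> I \<Longrightarrow> G x y = 0"
    "\<And>x y. x \<in> I \<Longrightarrow> y \<in> I \<Longrightarrow> G x y = (\<Sum>m\<in>M. F (x,m) (y,m))"
  shows "red (I \<times> M) F fst snd = G"
proof (intro ext)
  fix x y
  show "red (I \<times> M) F fst snd x y = G x y"
  proof (cases "x \<in> I \<and> y \<in> I")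
    case True
    then have "red (I \<times> M) F fst snd x y = (\<Sum>m\<in>M. F (x,m) (y,m))"
      using assms(1,2) by (intro red_product[where W = I]) auto
    then show ?thesis using True assms(4) by simp
  next
    case False
    then show ?thesis using assms(3) by (auto intro!: red_outside)
  qed
qed

lemma red_snd:
  assumes "finite I" "finite M" "\<And>x y. x \<notin> M \<or> y \<notin> M \<Longrightarrow> G x y = 0"
    "\<And>x y. x \<in> M \<Longrightarrow> y \<in> M \<Longrightarrow> G x y = (\<Sum>m\<in>I. F (m,x) (m,y))"
  shows "red (I \<times> M) F snd fst = G"
proof (intro ext)
  fix x y
  show "red (I \<times> M) F snd fst x y = G x y"
  proof (cases "x \<in> M \<and> y \<in> M")
    case True
    then have "red (I \<times> M) F snd fst x y = (\<Sum>m\<in>I. F (m,x) (m,y))"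
      using assms(1,2) by (intro red_product[where W = M and f = "\<lambda>w z. (z,w)"]) auto
    then show ?thesis using True assms(4) by simp
  next
    case False
    then show ?thesis using assms(3) by (auto intro!: red_outside)
  qed
qed

lemma ip_delta:
  assumes "finite M" "a \<in> M"
  shows "ip M (\<lambda>m. if m = a then 1 else 0) (\<lambda>m. if m = b then 1 else 0) = (if a = b then 1 else 0)"
proof -
  have "ip M (\<lambda>m. if m = a then 1 else 0) (\<lambda>m. if m = b then 1 else 0) = (\<Sum>m\<in>M. if m = a then (if a = b then 1 else 0) else 0)"
    unfolding ip_def by (intro sum.cong refl) auto
  then show ?thesis using assms by simp
qed

lemma sdec_diagonal:
  assumes "finite K"
  shows "sdec K (\<lambda>k l. if k = l \<and> k \<in> K then complex_of_real (p k) else 0) K p (\<lambda>k m. if m = k then 1 else 0)"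
  unfolding sdec_def
proof (intro conjI ballI allI impI)
  fix x y
  have "(\<Sum>j\<in>K. complex_of_real (p j) * (if x = j then 1 else 0) * cnj (if y = j then 1 else 0)) =
    (\<Sum>j\<in>K. if j = x then (if x = y then complex_of_real (p x) else 0) else 0)"
    by (intro sum.cong refl) auto
  then show "(if x = y \<and> x \<in> K then complex_of_real (p x) else 0) =
    (\<Sum>j\<in>K. complex_of_real (p j) * (if x = j then 1 else 0) * cnj (if y = j then 1 else 0))"
    using assms by auto
qed (use assms in \<open>auto simp: ip_delta\<close>)

text \<open>With a flag register attached, the entropy is exactly \<open>?s\<close>. Discarding the
  register lowers it by at most the flag entropy (subadditivity, which gives concavity) and cannot
  raise it.\<close>

lemma mixture_bounds:
  assumes K: "finite K" "\<And>k. k \<in> K \<Longrightarrow> p k \<ge> (0::real)" "(\<Sum>k\<in>K. p k) = 1"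
    and G: "\<And>k. k \<in> K \<Longrightarrow> dens I (G k)"
    and R: "\<And>x y. R x y = (\<Sum>k\<in>K. complex_of_real (p k) * G k x y)"
  shows "dens I R" "(\<Sum>k\<in>K. p k * kent (G k)) \<le> kent R"
    "kent R \<le> (\<Sum>k\<in>K. eta (p k)) + (\<Sum>k\<in>K. p k * kent (G k))"
proof -
  let ?s = "(\<Sum>k\<in>K. eta (p k)) + (\<Sum>k\<in>K. p k * kent (G k))"
  have "K \<noteq> {}" using K(3) by auto
  then have I: "finite I" using G dens_finite by blast
  have z: "G k x y = 0" if "k \<in> K" "x \<notin> I \<or> y \<notin> I" for k x y using dens_outside[OF G[OF that(1)] that(2)] .
  have Rz: "R x y = 0" if "x \<notin> I \<or> y \<notin> I" for x y unfolding R using z that by (intro sum.neutral) auto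
  define F where "F a b = (\<Sum>k\<in>K. complex_of_real (p k) * G k (fst a) (fst b)
      * ((if snd a = k then 1 else 0) * cnj (if snd b = k then 1 else 0)))" for a b
  have Fv: "F (x,k) (y,l) = (if k = l \<and> k \<in> K then complex_of_real (p k) * G k x y else 0)" for x k y l
  proof -
    have "F (x,k) (y,l) = (\<Sum>i\<in>K. if i = k then (if k = l then complex_of_real (p k) * G k x y else 0) else 0)"
      unfolding F_def by (intro sum.cong refl) auto
    then show ?thesis using K(1) by auto
  qed
  note XF = flagged_mixture[of K p I G K "\<lambda>k m. if m = k then 1 else 0" F]
  have dF: "dens (I \<times> K) F" by (rule XF(1)) (use K G I in \<open>auto simp: F_def ip_delta\<close>)
  have kF: "kent F = ?s" by (rule XF(2)) (use K G I in \<open>auto simp: F_def ip_delta\<close>)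
  have RF: "red (I \<times> K) F fst snd = R"
    by (rule red_fst) (use I K(1) Rz in \<open>auto simp: Fv R\<close>)
  have "dens (fst ` (I \<times> K)) R" unfolding RF[symmetric]
    by (rule dens_red[OF dF]) (auto simp: inj_on_def)
  then show dR: "dens I R" using \<open>K \<noteq> {}\<close> by simp
  have "kent (red (I \<times> K) F (\<lambda>w. (fst w, snd w)) (\<lambda>w. ()))
    \<le> kent (red (I \<times> K) F fst (\<lambda>w. (snd w, ()))) + kent (red (I \<times> K) F snd (\<lambda>w. (fst w, ())))"
    by (rule subadditivity_labels[OF dF]) (auto simp: inj_on_def)
  moreover have "red (I \<times> K) F (\<lambda>w. (fst w, snd w)) (\<lambda>w. ()) = F"
    using red_id[OF dens_finite[OF dF] dens_outside[OF dF]] by (simp add: fun_eq_iff)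
  moreover have "red (I \<times> K) F fst (\<lambda>w. (snd w, ())) = R"
    unfolding RF[symmetric] by (rule red_cong) auto
  moreover have "kent (red (I \<times> K) F snd (\<lambda>w. (fst w, ()))) = (\<Sum>k\<in>K. eta (p k))"
  proof -
    have "red (I \<times> K) F snd (\<lambda>w. (fst w, ())) = red (I \<times> K) F snd fst" by (rule red_cong) auto
    also have "\<dots> = (\<lambda>k l. if k = l \<and> k \<in> K then complex_of_real (p k) else 0)"
    proof (rule red_snd)
      fix k l assume "k \<in> K" "l \<in> K"
      then show "(if k = l \<and> k \<in> K then complex_of_real (p k) else 0) = (\<Sum>m\<in>I. F (m,k) (m,l))"
        using dens_trace[OF G, of k] by (auto simp: Fv simp flip: sum_distrib_left)
    qed (use I K in auto)
    finally show ?thesis using kent_eq[OF sdec_diagonal[OF K(1), of p]] by simp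
  qed
  ultimately show "(\<Sum>k\<in>K. p k * kent (G k)) \<le> kent R" using kF by simp
  text \<open>For the upper bound the flag is stored twice: removing one copy does not change the
    entropy, so strong subadditivity gives monotonicity under removal of the other copy.\<close>
  define H where "H a b = (\<Sum>k\<in>K. complex_of_real (p k) * G k (fst a) (fst b)
      * ((if snd a = (k,k) then 1 else 0) * cnj (if snd b = (k,k) then 1 else 0)))" for a b
  have Hv: "H (x,k,k') (y,l,l') = (if k' = k \<and> k = l \<and> l' = k \<and> k \<in> K then complex_of_real (p k) * G k x y else 0)" for x k k' y l l'
  proof -
    have "H (x,k,k') (y,l,l') = (\<Sum>i\<in>K. if i = k then (if k' = k \<and> k = l \<and> l' = k then complex_of_real (p k) * G k x y else 0) else 0)"
      unfolding H_def by (intro sum.cong refl) auto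
    then show ?thesis using K(1) by auto
  qed
  note XH = flagged_mixture[of K p I G "K \<times> K" "\<lambda>k m. if m = (k,k) then 1 else 0" H]
  have dH: "dens (I \<times> (K \<times> K)) H" by (rule XH(1)) (use K G I in \<open>auto simp: H_def ip_delta\<close>)
  have kH: "kent H = ?s" by (rule XH(2)) (use K G I in \<open>auto simp: H_def ip_delta\<close>)
  let ?\<Omega> = "I \<times> (K \<times> K)"
  let ?q = "\<lambda>(x,k,k'). x" and ?e = "\<lambda>(x,k,k'). k" and ?e' = "\<lambda>(x,k,k'). k'"
  have "kent (red ?\<Omega> H (\<lambda>w. (?e w, ?q w, ?e' w)) (\<lambda>w. ())) + kent (red ?\<Omega> H ?q (\<lambda>w. (?e w, ?e' w, ())))
    \<le> kent (red ?\<Omega> H (\<lambda>w. (?e w, ?q w)) (\<lambda>w. (?e' w, ()))) + kent (red ?\<Omega> H (\<lambda>w. (?q w, ?e' w)) (\<lambda>w. (?e w, ())))"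
    by (rule strong_subadditivity_labels[OF dH]) (auto simp: inj_on_def)
  moreover have "kent (red ?\<Omega> H (\<lambda>w. (?e w, ?q w, ?e' w)) (\<lambda>w. ())) = kent H"
  proof (rule kent_transfer(1)[OF dH, of "\<lambda>w. (?e w, ?q w, ?e' w)"])
    fix x y assume xy: "x \<in> ?\<Omega>" "y \<in> ?\<Omega>"
    have "red ?\<Omega> H (\<lambda>w. (?e w, ?q w, ?e' w)) (\<lambda>w. ()) (?e x, ?q x, ?e' x) (?e y, ?q y, ?e' y)
      = (\<Sum>z\<in>{()}. H ((\<lambda>(k,x,k') _. (x,k,k')) (?e x, ?q x, ?e' x) z) ((\<lambda>(k,x,k') _. (x,k,k')) (?e y, ?q y, ?e' y) z))"
      using xy I K(1) by (intro red_product[where W = "K \<times> I \<times> K" and Z = "{()}"]) auto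
    then show "red ?\<Omega> H (\<lambda>w. (?e w, ?q w, ?e' w)) (\<lambda>w. ()) (?e x, ?q x, ?e' x) (?e y, ?q y, ?e' y) = H x y"
      by (auto split: prod.splits)
  qed ((auto simp: inj_on_def)[1], erule red_outside)
  moreover have "red ?\<Omega> H ?q (\<lambda>w. (?e w, ?e' w, ())) = R"
  proof -
    have "red ?\<Omega> H ?q (\<lambda>w. (?e w, ?e' w, ())) = red ?\<Omega> H fst snd" by (rule red_cong) auto
    also have "\<dots> = R"
    proof (rule red_fst)
      fix x y
      have "(\<Sum>m\<in>K \<times> K. H (x,m) (y,m)) = (\<Sum>k\<in>K. \<Sum>k'\<in>K. if k' = k then complex_of_real (p k) * G k x y else 0)"
        unfolding sum.cartesian_product by (intro sum.cong refl) (auto simp: Hv)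
      also have "\<dots> = R x y" unfolding R using K(1) by simp
      finally show "R x y = (\<Sum>m\<in>K \<times> K. H (x,m) (y,m))" ..
    qed (use I K Rz in auto)
    finally show ?thesis .
  qed
  moreover have "kent (red ?\<Omega> H (\<lambda>w. (?e w, ?q w)) (\<lambda>w. (?e' w, ()))) = kent F"
  proof (rule kent_transfer(1)[OF dF, of "\<lambda>(x,k). (k,x)"])
    fix a b assume ab: "a \<in> I \<times> K" "b \<in> I \<times> K"
    obtain x k y l where k: "a = (x,k)" "b = (y,l)" "x \<in> I" "k \<in> K" "y \<in> I" "l \<in> K" using ab by auto
    have "red ?\<Omega> H (\<lambda>w. (?e w, ?q w)) (\<lambda>w. (?e' w, ())) (k,x) (l,y)
      = (\<Sum>z\<in>K \<times> {()}. H (x,k,fst z) (y,l,fst z))"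
      using k I K(1) by (subst red_product[where W = "K \<times> I" and Z = "K \<times> {()}" and f = "\<lambda>w z. (snd w, fst w, fst z)"]) auto
    also have "\<dots> = (\<Sum>z\<in>K. if z = k then F (x,k) (y,l) else 0)"
      unfolding sum.cartesian_product'[of _ K "{()}"] by (intro sum.cong refl) (auto simp: Hv Fv)
    also have "\<dots> = F a b" using k K(1) by simp
    finally show "red ?\<Omega> H (\<lambda>w. (?e w, ?q w)) (\<lambda>w. (?e' w, ())) ((\<lambda>(x,k). (k,x)) a) ((\<lambda>(x,k). (k,x)) b) = F a b"
      unfolding k by simp
  qed (auto simp: inj_on_def intro!: red_outside)
  moreover have "kent (red ?\<Omega> H (\<lambda>w. (?q w, ?e' w)) (\<lambda>w. (?e w, ()))) = kent F"
  proof (rule kent_transfer(1)[OF dF, of "\<lambda>(x,k). (x,k)"])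
    fix a b assume ab: "a \<in> I \<times> K" "b \<in> I \<times> K"
    obtain x k y l where k: "a = (x,k)" "b = (y,l)" "x \<in> I" "k \<in> K" "y \<in> I" "l \<in> K" using ab by auto
    have "red ?\<Omega> H (\<lambda>w. (?q w, ?e' w)) (\<lambda>w. (?e w, ())) (x,k) (y,l)
      = (\<Sum>z\<in>K \<times> {()}. H (x,fst z,k) (y,fst z,l))"
      using k I K(1) by (subst red_product[where W = "I \<times> K" and Z = "K \<times> {()}" and f = "\<lambda>w z. (fst w, fst z, snd w)"]) auto
    also have "\<dots> = (\<Sum>z\<in>K. if z = k then F (x,k) (y,l) else 0)"
      unfolding sum.cartesian_product'[of _ K "{()}"] by (intro sum.cong refl) (auto simp: Hv Fv)
    also have "\<dots> = F a b" using k K(1) by simp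
    finally show "red ?\<Omega> H (\<lambda>w. (?q w, ?e' w)) (\<lambda>w. (?e w, ())) ((\<lambda>(x,k). (x,k)) a) ((\<lambda>(x,k). (x,k)) b) = F a b"
      unfolding k by simp
  qed (auto simp: inj_on_def intro!: red_outside)
  ultimately show "kent R \<le> ?s" using kF kH by simp
qed

subsection \<open>Composite systems in mixed-radix encoding\<close>

lemma enc_Cons: "enc (d # ds) (x # xs) = x * prod_list ds + enc ds xs"
  unfolding enc_def by (simp add: sum.lessThan_Suc_shift del: sum.lessThan_Suc)

lemma enc_append:
  "length xs = length ds \<Longrightarrow> enc (ds @ es) (xs @ ys) = enc ds xs * prod_list es + enc es ys"
proof (induction ds arbitrary: xs)
  case Nil
  then show ?case by (simp add: enc_def)
next
  case (Cons d ds)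
  then show ?case by (cases xs) (auto simp: enc_Cons algebra_simps)
qed

lemma enc_less: "list_all2 (<) xs ds \<Longrightarrow> enc ds xs < prod_list ds"
proof (induction rule: list_all2_induct)
  case Nil
  then show ?case by (simp add: enc_def)
next
  case (Cons x xs d ds)
  have "x * prod_list ds + enc ds xs < Suc x * prod_list ds" using Cons by simp
  also have "\<dots> \<le> d * prod_list ds" using Cons by (intro mult_right_mono) auto
  finally show ?case by (simp add: enc_Cons)
qed

lemma dig_Cons_0: "dig (d # ds) k 0 = (k div prod_list ds) mod d"
  and dig_Cons_Suc: "dig (d # ds) k (Suc p) = dig ds k p"
  unfolding dig_def by auto

lemma dig_add_multiple:
  assumes "p < length ds"
  shows "dig ds (x * prod_list ds + k) p = dig ds k p"
proof -
  let ?Q = "prod_list (drop (Suc p) ds)"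
  have "prod_list ds = prod_list (take p ds) * (ds ! p * ?Q)"
    using id_take_nth_drop[OF assms] by (metis prod_list.Cons prod_list.append)
  then have eq: "x * prod_list ds + k = (x * prod_list (take p ds) * ds ! p) * ?Q + k" by simp
  show ?thesis
  proof (cases "?Q = 0")
    \<comment> \<open>A later dimension is 0, and division by 0 gives 0 on both sides.\<close>
    case True
    then show ?thesis unfolding dig_def by (simp only: div_by_0)
  next
    case False
    show ?thesis unfolding dig_def eq div_mult_self3[OF False] by (rule mod_mult_self3)
  qed
qed

lemma dig_enc: "list_all2 (<) xs ds \<Longrightarrow> p < length ds \<Longrightarrow> dig ds (enc ds xs) p = xs ! p"
proof (induction arbitrary: p rule: list_all2_induct)
  case (Cons x xs d ds)
  have "enc ds xs < prod_list ds" using Cons by (intro enc_less)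
  then have "(x * prod_list ds + enc ds xs) div prod_list ds = x" by (subst div_mult_self3) (linarith, simp)
  then show ?case using Cons
    by (cases p) (auto simp: enc_Cons dig_Cons_0 dig_Cons_Suc dig_add_multiple)
qed simp

lemma enc_dig: "k < prod_list ds \<Longrightarrow> enc ds (map (dig ds k) [0..<length ds]) = k"
proof (induction ds arbitrary: k)
  case Nil
  then show ?case by (simp add: enc_def)
next
  case (Cons d ds)
  have pos: "prod_list ds > 0" using Cons(2) by (cases "prod_list ds") auto
  have "map (dig (d # ds) k) [0..<length (d # ds)] = (k div prod_list ds) mod d # map (dig ds k) [0..<length ds]"
    by (simp only: length_Cons map_upt_Suc dig_Cons_0 dig_Cons_Suc)
  moreover have "k div prod_list ds < d" using Cons(2) by (simp add: less_mult_imp_div_less)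
  moreover have "enc ds (map (dig ds k) [0..<length ds]) = k mod prod_list ds"
  proof -
    have "dig ds k p = dig ds (k mod prod_list ds) p" if "p < length ds" for p
      using dig_add_multiple[OF that, of "k div prod_list ds" "k mod prod_list ds"] by simp
    then have "map (dig ds k) [0..<length ds] = map (dig ds (k mod prod_list ds)) [0..<length ds]" by simp
    then show ?thesis using Cons(1)[of "k mod prod_list ds"] pos by (metis mod_less_divisor)
  qed
  ultimately show ?case by (simp add: enc_Cons)
qed

lemma dig_less:
  assumes "prod_list ds > 0" "p < length ds"
  shows "dig ds k p < ds ! p"
proof -
  have "0 \<notin> set ds" using assms(1) by (metis not_less_zero prod_list_zero_iff)
  then have "ds ! p > 0" using assms(2) by (metis gr0I nth_mem)
  then show ?thesis unfolding dig_def by simp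
qed

lemma valid_digits:
  assumes "prod_list ds > 0"
  shows "list_all2 (<) (map (dig ds k) [0..<length ds]) ds"
  using dig_less[OF assms] by (auto simp: list_all2_conv_all_nth)

lemma list_all2_nths: "list_all2 P xs ys \<Longrightarrow> list_all2 P (nths xs S) (nths ys S)"
  by (induction arbitrary: S rule: list_all2_induct) (auto simp: nths_Cons)

lemma restr_less:
  assumes "prod_list ds > 0"
  shows "restr ds S k < prod_list (nths ds S)"
  unfolding restr_def by (intro enc_less list_all2_nths valid_digits assms)

lemma restr_eq_iff:
  assumes "prod_list ds > 0"
  shows "restr ds S k = restr ds S l \<longleftrightarrow> (\<forall>p<length ds. p \<in> S \<longrightarrow> dig ds k p = dig ds l p)"
proof -
  let ?d = "\<lambda>k. nths (map (dig ds k) [0..<length ds]) S"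
  have v: "list_all2 (<) (?d k) (nths ds S)" for k by (intro list_all2_nths valid_digits assms)
  have "restr ds S k = restr ds S l \<longleftrightarrow> ?d k = ?d l"
  proof
    assume eq: "restr ds S k = restr ds S l"
    show "?d k = ?d l"
    proof (rule nth_equalityI)
      show "length (?d k) = length (?d l)" by (simp add: length_nths)
      fix p assume "p < length (?d k)"
      then have p: "p < length (nths ds S)" by (simp add: length_nths)
      show "?d k ! p = ?d l ! p"
        using eq dig_enc[OF v[of k] p] dig_enc[OF v[of l] p] unfolding restr_def by simp
    qed
  qed (simp add: restr_def)
  also have "\<dots> \<longleftrightarrow> (\<forall>p<length ds. p \<in> S \<longrightarrow> dig ds k p = dig ds l p)"
    unfolding nths_map by (auto simp: set_nths)
  finally show ?thesis .
qed

lemma index_eq_iff: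
  assumes "k < prod_list ds" "l < prod_list ds"
  shows "k = l \<longleftrightarrow> (\<forall>p<length ds. dig ds k p = dig ds l p)"
proof
  assume "\<forall>p<length ds. dig ds k p = dig ds l p"
  then have "map (dig ds k) [0..<length ds] = map (dig ds l) [0..<length ds]" by simp
  then show "k = l" using enc_dig[OF assms(1)] enc_dig[OF assms(2)] by metis
qed simp

text \<open>Induces the same partition of indices as \<open>restr\<close>, which is all that
  entropies see, but without re-encoding: equality of labels unfolds directly to agreement of
  digits.\<close>

definition lab :: "nat list \<Rightarrow> nat set \<Rightarrow> nat \<Rightarrow> nat \<Rightarrow> nat" where
  "lab ds S k p = (if p \<in> S \<and> p < length ds then dig ds k p else 0)"

lemma lab_eq_iff: "lab ds S k = lab ds S l \<longleftrightarrow> (\<forall>p<length ds. p \<in> S \<longrightarrow> dig ds k p = dig ds l p)"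
  unfolding lab_def fun_eq_iff by auto

lemma lab_joint_inj: "inj_on (\<lambda>k. (lab ds S k, lab ds (- S) k)) {..<prod_list ds}"
  by (rule inj_onI) (use index_eq_iff[of _ ds] in \<open>auto simp: lab_eq_iff\<close>)

lemma stateD:
  assumes "state ds \<rho>"
  shows "\<rho> \<in> carrier_mat (prod_list ds) (prod_list ds)" "dens {..<prod_list ds} (mk \<rho>)" "prod_list ds > 0"
proof -
  show 1: "\<rho> \<in> carrier_mat (prod_list ds) (prod_list ds)" "dens {..<prod_list ds} (mk \<rho>)"
    using assms unfolding state_def is_density_iff by auto
  show "prod_list ds > 0" using dens_trace[OF 1(2)] by (cases "prod_list ds") auto
qed

lemma stateI: "\<rho> \<in> carrier_mat (prod_list ds) (prod_list ds) \<Longrightarrow> dens {..<prod_list ds} (mk \<rho>) \<Longrightarrow> state ds \<rho>"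
  unfolding state_def is_density_iff by auto

lemma mk_inject:
  assumes "A \<in> carrier_mat n n" "B \<in> carrier_mat n n" "\<And>i j. i < n \<Longrightarrow> j < n \<Longrightarrow> mk A i j = mk B i j"
  shows "A = B"
proof (rule eq_matI)
  fix i j assume "i < dim_row B" "j < dim_col B"
  then show "A $$ (i,j) = B $$ (i,j)" using assms(3)[of i j] assms(1,2) by (auto simp: mk_def)
qed (use assms in auto)

lemma mk_ptrace:
  assumes "state ds \<rho>"
  shows "mk (ptrace ds S \<rho>) = red {..<prod_list ds} (mk \<rho>) (restr ds S) (lab ds (- S))"
proof (intro ext)
  fix i j
  note D = stateD[OF assms]
  show "mk (ptrace ds S \<rho>) i j = red {..<prod_list ds} (mk \<rho>) (restr ds S) (lab ds (- S)) i j"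
  proof (cases "i < prod_list (nths ds S) \<and> j < prod_list (nths ds S)")
    case True
    then show ?thesis using D(1) unfolding red_def lab_eq_iff mk_def ptrace_def
      by (auto intro!: sum.cong)
  next
    case False
    then have "red {..<prod_list ds} (mk \<rho>) (restr ds S) (lab ds (- S)) i j = 0"
      using restr_less[OF D(3), of S] by (intro red_outside) auto
    then show ?thesis using False by (auto simp: mk_def ptrace_def)
  qed
qed

lemma ptrace_carrier: "ptrace ds S \<rho> \<in> carrier_mat (prod_list (nths ds S)) (prod_list (nths ds S))"
  unfolding ptrace_def by simp

lemma state_ptrace:
  assumes "state ds \<rho>"
  shows "state (nths ds S) (ptrace ds S \<rho>)"
proof (rule stateI[OF ptrace_carrier], unfold mk_ptrace[OF assms])
  note D = stateD[OF assms]
  have "dens (restr ds S ` {..<prod_list ds}) (red {..<prod_list ds} (mk \<rho>) (restr ds S) (lab ds (- S)))"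
    by (rule dens_red[OF D(2)], rule inj_onI)
      (use index_eq_iff[of _ ds] in \<open>auto simp: lab_eq_iff restr_eq_iff[OF D(3)]\<close>)
  then show "dens {..<prod_list (nths ds S)} (red {..<prod_list ds} (mk \<rho>) (restr ds S) (lab ds (- S)))"
    by (rule dens_mono) (use restr_less[OF D(3)] in auto)
qed

text \<open>Interface between concrete systems and kernels: any labels with the right fibres compute
  the entropy, so tuples of \<open>lab\<close> values can be fitted to the shape that
  \<open>strong_subadditivity_labels\<close> or \<open>kent_tensor\<close> expects.\<close>

lemma ent_labels:
  assumes st: "state ds \<rho>"
    and \<mu>: "\<And>k l. k < prod_list ds \<Longrightarrow> l < prod_list ds \<Longrightarrow> \<mu> k = \<mu> l \<longleftrightarrow> (\<forall>p<length ds. p \<in> S \<longrightarrow> dig ds k p = dig ds l p)"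
    and \<mu>': "\<And>k l. k < prod_list ds \<Longrightarrow> l < prod_list ds \<Longrightarrow> \<mu>' k = \<mu>' l \<longleftrightarrow> (\<forall>p<length ds. p \<notin> S \<longrightarrow> dig ds k p = dig ds l p)"
  shows "ent ds \<rho> S = kent (red {..<prod_list ds} (mk \<rho>) \<mu> \<mu>')"
proof -
  note D = stateD[OF st]
  have "ent ds \<rho> S = kent (mk (ptrace ds S \<rho>))"
    unfolding ent_def using stateD(2)[OF state_ptrace[OF st]]
    by (intro vN_entropy_eq_kent[OF ptrace_carrier]) auto
  also have "\<dots> = kent (red {..<prod_list ds} (mk \<rho>) \<mu> \<mu>')"
    unfolding mk_ptrace[OF st]
  proof (rule kent_red_cong[OF D(2), symmetric])
    show "inj_on (\<lambda>w. (restr ds S w, lab ds (- S) w)) {..<prod_list ds}"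
      by (rule inj_onI) (use index_eq_iff[of _ ds] in \<open>auto simp: lab_eq_iff restr_eq_iff[OF D(3)]\<close>)
  qed (auto simp: \<mu> \<mu>' lab_eq_iff restr_eq_iff[OF D(3)])
  finally show ?thesis .
qed

lemma ent_lab:
  assumes "state ds \<rho>"
  shows "ent ds \<rho> S = kent (red {..<prod_list ds} (mk \<rho>) (lab ds S) (lab ds (- S)))"
  by (rule ent_labels[OF assms]) (auto simp: lab_eq_iff)

lemma ent_strong_subadditivity:
  assumes st: "state ds \<rho>" and disj: "A \<inter> B = {}" "A \<inter> C = {}" "B \<inter> C = {}"
  shows "ent ds \<rho> (A \<union> B \<union> C) + ent ds \<rho> B \<le> ent ds \<rho> (A \<union> B) + ent ds \<rho> (B \<union> C)"
proof -
  let ?E = "- (A \<union> B \<union> C)"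
  let ?l = "\<lambda>S. lab ds S"
  have "kent (red {..<prod_list ds} (mk \<rho>) (\<lambda>w. (?l A w, ?l B w, ?l C w)) (?l ?E)) + kent (red {..<prod_list ds} (mk \<rho>) (?l B) (\<lambda>w. (?l A w, ?l C w, ?l ?E w)))
    \<le> kent (red {..<prod_list ds} (mk \<rho>) (\<lambda>w. (?l A w, ?l B w)) (\<lambda>w. (?l C w, ?l ?E w))) + kent (red {..<prod_list ds} (mk \<rho>) (\<lambda>w. (?l B w, ?l C w)) (\<lambda>w. (?l A w, ?l ?E w)))"
    by (rule strong_subadditivity_labels[OF stateD(2)[OF st]], rule inj_onI)
      (use index_eq_iff[of _ ds] in \<open>auto simp: lab_eq_iff\<close>)
  moreover have "ent ds \<rho> (A \<union> B \<union> C) = kent (red {..<prod_list ds} (mk \<rho>) (\<lambda>w. (?l A w, ?l B w, ?l C w)) (?l ?E))"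
    by (rule ent_labels[OF st]) (use disj in \<open>auto simp: lab_eq_iff\<close>)
  moreover have "ent ds \<rho> B = kent (red {..<prod_list ds} (mk \<rho>) (?l B) (\<lambda>w. (?l A w, ?l C w, ?l ?E w)))"
    by (rule ent_labels[OF st]) (use disj in \<open>auto simp: lab_eq_iff\<close>)
  moreover have "ent ds \<rho> (A \<union> B) = kent (red {..<prod_list ds} (mk \<rho>) (\<lambda>w. (?l A w, ?l B w)) (\<lambda>w. (?l C w, ?l ?E w)))"
    by (rule ent_labels[OF st]) (use disj in \<open>auto simp: lab_eq_iff\<close>)
  moreover have "ent ds \<rho> (B \<union> C) = kent (red {..<prod_list ds} (mk \<rho>) (\<lambda>w. (?l B w, ?l C w)) (\<lambda>w. (?l A w, ?l ?E w)))"
    by (rule ent_labels[OF st]) (use disj in \<open>auto simp: lab_eq_iff\<close>)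
  ultimately show ?thesis by linarith
qed

lemma ent_nonneg:
  assumes "state ds \<rho>"
  shows "ent ds \<rho> S \<ge> 0"
  unfolding ent_lab[OF assms] by (rule kent_nonneg[OF dens_red[OF stateD(2)[OF assms] lab_joint_inj]])

lemma ent_le:
  assumes "state ds \<rho>"
  shows "ent ds \<rho> S \<le> log 2 (prod_list ds)"
proof -
  note D = stateD[OF assms]
  have "ent ds \<rho> S \<le> log 2 (card (lab ds S ` {..<prod_list ds}))"
    unfolding ent_lab[OF assms] by (intro kent_le_log_card dens_red D lab_joint_inj)
  also have "\<dots> \<le> log 2 (prod_list ds)"
    using card_image_le[of "{..<prod_list ds}" "lab ds S"] D(3)
    by (intro log_mono) (auto simp: card_gt_0_iff)
  finally show ?thesis .
qed

text \<open>The reduction to no system lives on a one-element index set, and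
  \<open>log 2 1 = 0\<close>.\<close>

lemma ent_empty:
  assumes "state ds \<rho>"
  shows "ent ds \<rho> {} = 0"
proof -
  note D = stateD[OF assms]
  have "ent ds \<rho> {} \<le> log 2 (card (lab ds {} ` {..<prod_list ds}))"
    unfolding ent_lab[OF assms] by (intro kent_le_log_card dens_red D lab_joint_inj)
  moreover have "lab ds {} ` {..<prod_list ds} = {\<lambda>_. 0}" using D(3) by (auto simp: lab_def fun_eq_iff)
  ultimately show ?thesis using ent_nonneg[OF assms, of "{}"] by simp
qed

lemma mutinf_nonneg:
  assumes "state ds \<rho>" "X \<inter> Y = {}"
  shows "mutinf ds \<rho> X Y \<ge> 0"
  using ent_strong_subadditivity[OF assms(1), of X "{}" Y] assms(2) ent_empty[OF assms(1)]
  unfolding mutinf_def by simp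

text \<open>Crude but sufficient: it bounds the contribution of the rounding remainder in
  \<open>ensemble_discretise\<close>.\<close>

lemma mutinf_le:
  assumes "state ds \<rho>"
  shows "mutinf ds \<rho> X Y \<le> 2 * log 2 (prod_list ds)"
  using ent_le[OF assms, of X] ent_le[OF assms, of Y] ent_nonneg[OF assms, of "X \<union> Y"]
  unfolding mutinf_def by linarith

subsection \<open>Tensor products and mixtures of states\<close>

lemma bij_betw_div_mod:
  "bij_betw (\<lambda>(i,j). i * n + j) ({..<m} \<times> {..<n}) {..<m * n :: nat}"
proof (rule bij_betwI[where g = "\<lambda>k. (k div n, k mod n)"])
  show "(\<lambda>(i,j). i * n + j) \<in> {..<m} \<times> {..<n} \<rightarrow> {..<m * n}"
  proof safe
    fix i j assume ij: "i < m" "j < n"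
    have "i * n + j < Suc i * n" using ij by simp
    also have "\<dots> \<le> m * n" using ij by (intro mult_right_mono) auto
    finally show "i * n + j < m * n" .
  qed
  show "(\<lambda>k. (k div n, k mod n)) \<in> {..<m * n} \<rightarrow> {..<m} \<times> {..<n}"
  proof
    fix k assume "k \<in> {..<m * n}"
    then have k: "k < m * n" by simp
    then have "n > 0" by (cases n) auto
    then show "(k div n, k mod n) \<in> {..<m} \<times> {..<n}" using k by (simp add: less_mult_imp_div_less)
  qed
qed auto

lemma div_pair: "j < n \<Longrightarrow> (i * n + j) div n = (i :: nat)"
  by (subst div_mult_self3) auto

lemma dig_append:
  assumes "p < length ds + length es"
  shows "dig (ds @ es) k p = (if p < length ds then dig ds (k div prod_list es) p
    else dig es (k mod prod_list es) (p - length ds))"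
  using assms
proof (induction ds arbitrary: p)
  case Nil
  then show ?case using dig_add_multiple[of p es "k div prod_list es" "k mod prod_list es"] by simp
next
  case (Cons d ds)
  show ?case
  proof (cases p)
    case 0
    have "k div (prod_list ds * prod_list es) = k div prod_list es div prod_list ds"
      by (metis div_mult2_eq mult.commute)
    then show ?thesis using 0 by (simp add: dig_Cons_0)
  next
    case (Suc q)
    then show ?thesis using Cons(1)[of q] Cons(2) by (simp add: dig_Cons_Suc)
  qed
qed

lemma all_less_add: "(\<forall>p<a + b. P p) \<longleftrightarrow> (\<forall>p<a. P p) \<and> (\<forall>p<b. P (p + a))" for a b :: nat
proof safe
  fix p assume *: "\<forall>p<a. P p" "\<forall>p<b. P (p + a)" "p < a + b"
  show "P p"
  proof (cases "p < a")
    case False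
    then have "P ((p - a) + a)" using * by (intro *(2)[rule_format]) auto
    then show ?thesis using False by simp
  qed (use * in auto)
qed auto

text \<open>Big-endian encoding: the quotient by \<open>prod_list es\<close> holds the digits of the
  first systems, the remainder those of the appended ones, whose positions are shifted by
  \<open>length ds\<close>.\<close>

lemma agree_append:
  "(\<forall>p<length (ds @ es). p \<in> S \<longrightarrow> dig (ds @ es) k p = dig (ds @ es) l p) \<longleftrightarrow>
    lab ds S (k div prod_list es) = lab ds S (l div prod_list es) \<and>
    lab es {p. p + length ds \<in> S} (k mod prod_list es) = lab es {p. p + length ds \<in> S} (l mod prod_list es)"
  unfolding lab_eq_iff length_append all_less_add by (auto simp: dig_append)

lemma restr_append:
  "restr (ds @ es) S k = restr ds S (k div prod_list es) * prod_list (nths es {p. p + length ds \<in> S})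
    + restr es {p. p + length ds \<in> S} (k mod prod_list es)"
proof -
  have "map (dig (ds @ es) k) [0..<length (ds @ es)] =
      map (dig ds (k div prod_list es)) [0..<length ds] @ map (dig es (k mod prod_list es)) [0..<length es]"
    by (rule nth_equalityI) (auto simp: nth_append dig_append)
  then show ?thesis unfolding restr_def by (simp add: nths_append enc_append length_nths)
qed

lemma kron_carrier [simp]:
  "A \<in> carrier_mat m m \<Longrightarrow> B \<in> carrier_mat n n \<Longrightarrow> kron A B \<in> carrier_mat (m * n) (m * n)"
  unfolding kron_def by auto

lemma mk_kron:
  assumes "A \<in> carrier_mat m m" "B \<in> carrier_mat n n" "j < n" "l < n"
  shows "mk (kron A B) (i * n + j) (k * n + l) = mk A i k * mk B j l"
proof -
  have *: "i * n + j < m * n \<longleftrightarrow> i < m" if "j < n" for i j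
  proof
    assume "i * n + j < m * n"
    then have "i * n < m * n" by linarith
    then show "i < m" by simp
  next
    assume "i < m"
    then show "i * n + j < m * n" using bij_betwE[OF bij_betw_div_mod[of n m]] that by auto
  qed
  have "dim_row A = m" "dim_col A = m" "dim_row B = n" "dim_col B = n" using assms(1,2) by auto
  then show ?thesis using assms(3,4) by (auto simp: mk_def kron_def *)
qed

lemma kron_one_left: "kron (1\<^sub>m 1) A = A"
  unfolding kron_def by (intro eq_matI) auto

lemma kron_one_right: "kron A (1\<^sub>m 1) = A"
  unfolding kron_def by (intro eq_matI) auto

lemma kron_assoc: "kron (kron A B) C = kron A (kron B C)"
proof (rule eq_matI)
  fix i j assume "i < dim_row (kron A (kron B C))" "j < dim_col (kron A (kron B C))"
  then have ij: "i < dim_row A * (dim_row B * dim_row C)" "j < dim_col A * (dim_col B * dim_col C)"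
    unfolding kron_def by auto
  have key: "i mod (b * c) div c = i div c mod b \<and> i div (b * c) = i div c div b \<and> i mod (b * c) mod c = i mod c" for i b c :: nat
  proof -
    have "i mod (b * c) = c * (i div c mod b) + i mod c" by (metis mod_mult2_eq mult.commute)
    then show ?thesis by (cases "c = 0") (auto simp: div_mult2_eq mult.commute[of b c])
  qed
  have pos: "0 < dim_row C" "0 < dim_col C" "0 < dim_row B" "0 < dim_col B"
    using ij by (auto intro!: Nat.gr0I)
  have b: "i div dim_row C < dim_row A * dim_row B" "j div dim_col C < dim_col A * dim_col B"
    using ij by (auto intro!: less_mult_imp_div_less simp: mult.assoc)
  have c: "i mod (dim_row B * dim_row C) < dim_row B * dim_row C" "j mod (dim_col B * dim_col C) < dim_col B * dim_col C"
    using pos by auto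
  show "kron (kron A B) C $$ (i,j) = kron A (kron B C) $$ (i,j)"
    using ij b c key[of i "dim_row B" "dim_row C"] key[of j "dim_col B" "dim_col C"] unfolding kron_def by (simp add: mult.assoc)
qed (auto simp: kron_def)

lemma red_tensor:
  assumes "\<And>i j k l. F (i,j) (k,l) = G i k * H j l"
  shows "red (\<Omega>1 \<times> \<Omega>2) F (\<lambda>(i,j). (\<pi> i, \<nu> j)) (\<lambda>(i,j). (\<pi>' i, \<nu>' j)) (x,m) (y,n) =
    red \<Omega>1 G \<pi> \<pi>' x y * red \<Omega>2 H \<nu> \<nu>' m n"
proof -
  have "red \<Omega>1 G \<pi> \<pi>' x y * red \<Omega>2 H \<nu> \<nu>' m n =
      (\<Sum>i\<in>\<Omega>1. \<Sum>j\<in>\<Omega>2. \<Sum>k\<in>\<Omega>1. \<Sum>l\<in>\<Omega>2. (if \<pi> i = x \<and> \<pi> k = y \<and> \<pi>' i = \<pi>' k then G i k else 0)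
        * (if \<nu> j = m \<and> \<nu> l = n \<and> \<nu>' j = \<nu>' l then H j l else 0))"
    unfolding red_def sum_product ..
  also have "\<dots> = red (\<Omega>1 \<times> \<Omega>2) F (\<lambda>(i,j). (\<pi> i, \<nu> j)) (\<lambda>(i,j). (\<pi>' i, \<nu>' j)) (x,m) (y,n)"
    unfolding red_def sum.cartesian_product' prod.case by (intro sum.cong refl) (auto simp: assms)
  finally show ?thesis ..
qed

lemma red_inj:
  assumes "inj_on h A" "\<pi> ` \<Omega> \<subseteq> A" "a \<in> A" "b \<in> A"
  shows "red \<Omega> F (\<lambda>w. h (\<pi> w)) \<pi>' (h a) (h b) = red \<Omega> F \<pi> \<pi>' a b"
  unfolding red_def using assms by (intro sum.cong refl if_cong) (auto dest: inj_onD)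

definition pairk :: "complex mat \<Rightarrow> complex mat \<Rightarrow> nat \<times> nat \<Rightarrow> nat \<times> nat \<Rightarrow> complex" where
  "pairk A B v w = mk A (fst v) (fst w) * mk B (snd v) (snd w)"

lemma red_kron:
  assumes A: "A \<in> carrier_mat m m" and B: "B \<in> carrier_mat n n"
  shows "red {..<m * n} (mk (kron A B)) \<pi> \<pi>' =
    red ({..<m} \<times> {..<n}) (pairk A B) (\<lambda>(i,j). \<pi> (i * n + j)) (\<lambda>(i,j). \<pi>' (i * n + j))"
  unfolding red_reindex[OF bij_betw_div_mod]
  by (rule red_cong) (auto simp: mk_kron[OF A B] pairk_def)

lemma state_kron:
  assumes "state ds \<sigma>" "state es \<tau>"
  shows "state (ds @ es) (kron \<sigma> \<tau>)"
proof (rule stateI)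
  let ?m = "prod_list ds" and ?n = "prod_list es"
  note A = stateD[OF assms(1)] and B = stateD[OF assms(2)]
  show c: "kron \<sigma> \<tau> \<in> carrier_mat (prod_list (ds @ es)) (prod_list (ds @ es))" using A B by simp
  have d: "dens ({..<?m} \<times> {..<?n}) (pairk \<sigma> \<tau>)"
    by (rule kent_tensor(1)[OF A(2) B(2)]) (simp add: pairk_def)
  have im: "(\<lambda>(i,j). i * ?n + j) ` ({..<?m} \<times> {..<?n}) = {..<?m * ?n}"
    using bij_betw_div_mod by (rule bij_betw_imp_surj_on)
  have "dens ((\<lambda>(i,j). i * ?n + j) ` ({..<?m} \<times> {..<?n})) (mk (kron \<sigma> \<tau>))"
  proof (rule kent_transfer(2)[OF d])
    show "inj_on (\<lambda>(i,j). i * ?n + j) ({..<?m} \<times> {..<?n})"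
      using bij_betw_div_mod by (rule bij_betw_imp_inj_on)
    show "mk (kron \<sigma> \<tau>) x y = 0"
      if "x \<notin> (\<lambda>(i,j). i * ?n + j) ` ({..<?m} \<times> {..<?n}) \<or> y \<notin> (\<lambda>(i,j). i * ?n + j) ` ({..<?m} \<times> {..<?n})" for x y
      using that c unfolding im mk_def by auto
  qed (auto simp: mk_kron[OF A(1) B(1)] pairk_def)
  then show "dens {..<prod_list (ds @ es)} (mk (kron \<sigma> \<tau>))" unfolding im by simp
qed

text \<open>Both labels of the composite split into pairs along quotient and remainder, so the
  reduction is a tensor product of reductions and \<open>kent_tensor\<close> applies.\<close>

lemma ent_kron:
  assumes st: "state ds \<sigma>" "state es \<tau>"
  shows "ent (ds @ es) (kron \<sigma> \<tau>) S = ent ds \<sigma> S + ent es \<tau> {p. p + length ds \<in> S}"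
proof -
  let ?m = "prod_list ds" and ?n = "prod_list es"
  let ?T = "{p. p + length ds \<in> S}"
  note A = stateD[OF st(1)] and B = stateD[OF st(2)]
  have T: "{p. p + length ds \<in> - S} = - ?T" by auto
  have "ent (ds @ es) (kron \<sigma> \<tau>) S = kent (red {..<prod_list (ds @ es)} (mk (kron \<sigma> \<tau>))
      (\<lambda>k. (lab ds S (k div ?n), lab es ?T (k mod ?n))) (\<lambda>k. (lab ds (- S) (k div ?n), lab es (- ?T) (k mod ?n))))"
    using agree_append[of ds es S] agree_append[of ds es "- S", unfolded T]
    by (intro ent_labels[OF state_kron[OF st]]) auto
  also have "\<dots> = kent (red ({..<?m} \<times> {..<?n}) (pairk \<sigma> \<tau>) (\<lambda>(i,j). (lab ds S i, lab es ?T j)) (\<lambda>(i,j). (lab ds (- S) i, lab es (- ?T) j)))"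
    unfolding prod_list.append red_kron[OF A(1) B(1)] by (intro arg_cong[where f = kent] red_cong) (auto simp: div_pair)
  also have "\<dots> = kent (red {..<?m} (mk \<sigma>) (lab ds S) (lab ds (- S))) + kent (red {..<?n} (mk \<tau>) (lab es ?T) (lab es (- ?T)))"
    by (rule kent_tensor(2)[OF dens_red[OF A(2) lab_joint_inj] dens_red[OF B(2) lab_joint_inj]])
      (rule red_tensor, simp add: pairk_def)
  finally show ?thesis unfolding ent_lab[OF st(1)] ent_lab[OF st(2)] .
qed

text \<open>Unlike \<open>ent_kron\<close> this is an equality of matrices and sensitive to the
  encoding: \<open>restr\<close> of a composite index is again a quotient times a dimension plus a
  remainder, and \<open>red_inj\<close> strips this encoding off.\<close>

lemma ptrace_kron:
  assumes st: "state ds \<sigma>" "state es \<tau>"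
  shows "ptrace (ds @ es) S (kron \<sigma> \<tau>) = kron (ptrace ds S \<sigma>) (ptrace es {p. p + length ds \<in> S} \<tau>)"
proof -
  let ?m = "prod_list ds" and ?n = "prod_list es"
  let ?T = "{p. p + length ds \<in> S}"
  let ?M = "prod_list (nths ds S)" and ?N = "prod_list (nths es ?T)"
  note A = stateD[OF st(1)] and B = stateD[OF st(2)]
  have T: "{p. p + length ds \<in> - S} = - ?T" by auto
  show ?thesis
  proof (rule mk_inject[where n = "?M * ?N"])
    show "ptrace (ds @ es) S (kron \<sigma> \<tau>) \<in> carrier_mat (?M * ?N) (?M * ?N)"
      using ptrace_carrier[of "ds @ es" S] by (simp add: nths_append)
    show "kron (ptrace ds S \<sigma>) (ptrace es ?T \<tau>) \<in> carrier_mat (?M * ?N) (?M * ?N)"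
      by (intro kron_carrier ptrace_carrier)
    fix i j assume ij: "i < ?M * ?N" "j < ?M * ?N"
    let ?h = "\<lambda>(x,y). x * ?N + y"
    define a b c d where "a = i div ?N" and "b = i mod ?N" and "c = j div ?N" and "d = j mod ?N"
    have "?N > 0" using ij(1) by (metis gr_zeroI mult_0_right not_less_zero)
    then have h: "i = ?h (a,b)" "j = ?h (c,d)" "(a,b) \<in> {..<?M} \<times> {..<?N}" "(c,d) \<in> {..<?M} \<times> {..<?N}"
      using ij unfolding a_def b_def c_def d_def by (auto intro: less_mult_imp_div_less)
    have "mk (ptrace (ds @ es) S (kron \<sigma> \<tau>)) i j = red ({..<?m} \<times> {..<?n}) (pairk \<sigma> \<tau>)
        (\<lambda>w. ?h ((\<lambda>(i,j). (restr ds S i, restr es ?T j)) w)) (\<lambda>(i,j). (lab ds (- S) i, lab es (- ?T) j)) i j"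
      unfolding mk_ptrace[OF state_kron[OF st]] prod_list.append red_kron[OF A(1) B(1)]
      using agree_append[of ds es "- S", unfolded T]
      by (intro fun_cong[where f = "red _ _ _ _ _"] fun_cong[where f = "red _ _ _ _"] red_cong)
        (auto simp: restr_append lab_eq_iff[of "ds @ es"] div_pair)
    also have "\<dots> = red ({..<?m} \<times> {..<?n}) (pairk \<sigma> \<tau>) (\<lambda>(i,j). (restr ds S i, restr es ?T j))
        (\<lambda>(i,j). (lab ds (- S) i, lab es (- ?T) j)) (a,b) (c,d)"
      unfolding h(1,2)
      by (rule red_inj[OF bij_betw_imp_inj_on[OF bij_betw_div_mod]])
        (use h(3,4) restr_less[OF A(3)] restr_less[OF B(3)] in auto)
    also have "\<dots> = mk (ptrace ds S \<sigma>) a c * mk (ptrace es ?T \<tau>) b d"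
      unfolding mk_ptrace[OF st(1)] mk_ptrace[OF st(2)] by (rule red_tensor) (simp add: pairk_def)
    also have "\<dots> = mk (kron (ptrace ds S \<sigma>) (ptrace es ?T \<tau>)) i j"
      unfolding h(1,2) prod.case using h(3,4)
      by (intro mk_kron[OF ptrace_carrier ptrace_carrier, symmetric]) auto
    finally show "mk (ptrace (ds @ es) S (kron \<sigma> \<tau>)) i j = mk (kron (ptrace ds S \<sigma>) (ptrace es ?T \<tau>)) i j" .
  qed
qed

lemma state_Nil:
  assumes "state [] \<rho>"
  shows "\<rho> = 1\<^sub>m 1"
proof -
  note D = stateD[OF assms]
  have "mk \<rho> 0 0 = 1" using dens_trace[OF D(2)] by simp
  then show ?thesis using D(1) by (intro eq_matI) (auto simp: mk_def)
qed

text \<open>Tracing out everything leaves the trace as a 1 by 1 matrix, the unit of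
  \<open>kron\<close>; this makes one factor disappear in the two lemmas that follow.\<close>

lemma ptrace_empty: "state ds \<rho> \<Longrightarrow> (\<And>p. p < length ds \<Longrightarrow> p \<notin> S) \<Longrightarrow> ptrace ds S \<rho> = 1\<^sub>m 1"
proof -
  assume "state ds \<rho>" and S: "\<And>p. p < length ds \<Longrightarrow> p \<notin> S"
  then have "state (nths ds S) (ptrace ds S \<rho>)" by (intro state_ptrace)
  moreover have "length (nths ds S) = 0" unfolding length_nths using S by auto
  ultimately show ?thesis using state_Nil by (metis length_0_conv)
qed

lemma ptrace_kron_left:
  assumes "state ds \<sigma>" "state es \<tau>" "S \<subseteq> {..<length ds}"
  shows "ptrace (ds @ es) S (kron \<sigma> \<tau>) = ptrace ds S \<sigma>"
proof -
  have "ptrace es {p. p + length ds \<in> S} \<tau> = 1\<^sub>m 1"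
    by (rule ptrace_empty[OF assms(2)]) (use assms(3) in auto)
  then show ?thesis unfolding ptrace_kron[OF assms(1,2)] by (simp only: kron_one_right)
qed

lemma ptrace_kron_right:
  assumes "state ds \<sigma>" "state es \<tau>" "S \<inter> {..<length ds} = {}"
  shows "ptrace (ds @ es) S (kron \<sigma> \<tau>) = ptrace es {p. p + length ds \<in> S} \<tau>"
proof -
  have "ptrace ds S \<sigma> = 1\<^sub>m 1"
    by (rule ptrace_empty[OF assms(1)]) (use assms(3) in auto)
  then show ?thesis unfolding ptrace_kron[OF assms(1,2)] by (simp only: kron_one_left)
qed

section \<open>Convex mixtures of states\<close>

definition emix :: "nat \<Rightarrow> 'k set \<Rightarrow> ('k \<Rightarrow> real) \<Rightarrow> ('k \<Rightarrow> complex mat) \<Rightarrow> complex mat" where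
  "emix N A p R = mat N N (\<lambda>(i,j). \<Sum>k\<in>A. complex_of_real (p k) * R k $$ (i,j))"

lemma emix_carrier [simp]: "emix N A p R \<in> carrier_mat N N"
  unfolding emix_def by simp

lemma mk_emix:
  assumes "\<And>k. k \<in> A \<Longrightarrow> R k \<in> carrier_mat N N"
  shows "mk (emix N A p R) i j = (\<Sum>k\<in>A. complex_of_real (p k) * mk (R k) i j)"
proof -
  have "dim_row (R k) = N" "dim_col (R k) = N" if "k \<in> A" for k using assms[OF that] by auto
  then show ?thesis unfolding mk_def emix_def by auto
qed

lemma red_linear:
  assumes "\<And>v w. F v w = (\<Sum>k\<in>A. c k * G k v w)"
  shows "red \<Omega> F \<pi> \<pi>' x y = (\<Sum>k\<in>A. c k * red \<Omega> (G k) \<pi> \<pi>' x y)"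
proof -
  let ?b = "\<lambda>v w. \<pi> v = x \<and> \<pi> w = y \<and> \<pi>' v = \<pi>' w"
  have "red \<Omega> F \<pi> \<pi>' x y = (\<Sum>v\<in>\<Omega>. \<Sum>w\<in>\<Omega>. \<Sum>k\<in>A. if ?b v w then c k * G k v w else 0)"
    unfolding red_def by (intro sum.cong refl) (auto simp: assms)
  also have "\<dots> = (\<Sum>v\<in>\<Omega>. \<Sum>k\<in>A. \<Sum>w\<in>\<Omega>. if ?b v w then c k * G k v w else 0)"
    by (intro sum.cong refl sum.swap)
  also have "\<dots> = (\<Sum>k\<in>A. \<Sum>v\<in>\<Omega>. \<Sum>w\<in>\<Omega>. if ?b v w then c k * G k v w else 0)"
    by (rule sum.swap)
  also have "\<dots> = (\<Sum>k\<in>A. c k * red \<Omega> (G k) \<pi> \<pi>' x y)"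
    unfolding red_def sum_distrib_left by (intro sum.cong refl) auto
  finally show ?thesis .
qed

context
  fixes ds :: "nat list" and A :: "'k set" and p :: "'k \<Rightarrow> real" and R :: "'k \<Rightarrow> complex mat"
  assumes A: "finite A" and p: "\<And>k. k \<in> A \<Longrightarrow> p k \<ge> 0" and p1: "(\<Sum>k\<in>A. p k) = 1"
    and R: "\<And>k. k \<in> A \<Longrightarrow> state ds (R k)"
begin

lemma emix_bounds:
  shows "state ds (emix (prod_list ds) A p R)"
    and "(\<Sum>k\<in>A. p k * ent ds (R k) S) \<le> ent ds (emix (prod_list ds) A p R) S"
    and "ent ds (emix (prod_list ds) A p R) S \<le> (\<Sum>k\<in>A. eta (p k)) + (\<Sum>k\<in>A. p k * ent ds (R k) S)"
proof -
  let ?N = "prod_list ds" and ?M = "emix (prod_list ds) A p R"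
  have mk: "mk ?M i j = (\<Sum>k\<in>A. complex_of_real (p k) * mk (R k) i j)" for i j
    by (rule mk_emix) (rule stateD(1)[OF R])
  have "dens {..<?N} (mk ?M)"
    by (rule mixture_bounds(1)[OF A p p1 stateD(2)[OF R] mk])
  then show st: "state ds ?M" by (intro stateI emix_carrier)
  let ?G = "\<lambda>k. red {..<?N} (mk (R k)) (lab ds S) (lab ds (- S))"
  have G: "dens (lab ds S ` {..<?N}) (?G k)" if "k \<in> A" for k
    by (rule dens_red[OF stateD(2)[OF R[OF that]] lab_joint_inj])
  have mix: "red {..<?N} (mk ?M) (lab ds S) (lab ds (- S)) x y = (\<Sum>k\<in>A. complex_of_real (p k) * ?G k x y)" for x y
    by (rule red_linear) (rule mk)
  have e: "(\<Sum>k\<in>A. p k * ent ds (R k) S) = (\<Sum>k\<in>A. p k * kent (?G k))"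
    by (intro sum.cong refl) (simp add: ent_lab[OF R])
  show "(\<Sum>k\<in>A. p k * ent ds (R k) S) \<le> ent ds ?M S"
    unfolding e ent_lab[OF st] by (rule mixture_bounds(2)[OF A p p1 G mix])
  show "ent ds ?M S \<le> (\<Sum>k\<in>A. eta (p k)) + (\<Sum>k\<in>A. p k * ent ds (R k) S)"
    unfolding e ent_lab[OF st] by (rule mixture_bounds(3)[OF A p p1 G mix])
qed

lemma ptrace_emix:
  "ptrace ds S (emix (prod_list ds) A p R) = emix (prod_list (nths ds S)) A p (\<lambda>k. ptrace ds S (R k))"
proof (rule mk_inject[OF ptrace_carrier emix_carrier])
  fix i j
  have mk: "mk (emix (prod_list ds) A p R) i j = (\<Sum>k\<in>A. complex_of_real (p k) * mk (R k) i j)" for i j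
    by (rule mk_emix) (rule stateD(1)[OF R])
  have "mk (ptrace ds S (emix (prod_list ds) A p R)) i j =
      (\<Sum>k\<in>A. complex_of_real (p k) * red {..<prod_list ds} (mk (R k)) (restr ds S) (lab ds (- S)) i j)"
    unfolding mk_ptrace[OF emix_bounds(1)] by (rule red_linear) (rule mk)
  also have "\<dots> = (\<Sum>k\<in>A. complex_of_real (p k) * mk (ptrace ds S (R k)) i j)"
    by (intro sum.cong refl) (simp add: mk_ptrace[OF R])
  also have "\<dots> = mk (emix (prod_list (nths ds S)) A p (\<lambda>k. ptrace ds S (R k))) i j"
    by (rule mk_emix[symmetric]) (rule ptrace_carrier)
  finally show "mk (ptrace ds S (emix (prod_list ds) A p R)) i j =
    mk (emix (prod_list (nths ds S)) A p (\<lambda>k. ptrace ds S (R k))) i j" .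
qed

end

subsection \<open>Classical squashed entanglement as an infimum over ensembles\<close>

lemma restr_full: "k < prod_list ds \<Longrightarrow> restr ds {0..<length ds} k = k"
  unfolding restr_def using enc_dig[of k ds] by (simp add: nths_all)

lemma ptrace_full:
  assumes "state ds \<rho>"
  shows "ptrace ds {0..<length ds} \<rho> = \<rho>"
proof (rule mk_inject)
  note D = stateD[OF assms]
  have n: "nths ds {0..<length ds} = ds" by (simp add: nths_all)
  show "ptrace ds {0..<length ds} \<rho> \<in> carrier_mat (prod_list ds) (prod_list ds)"
    using ptrace_carrier[of ds "{0..<length ds}"] unfolding n .
  fix i j assume ij: "i < prod_list ds" "j < prod_list ds"
  have "mk (ptrace ds {0..<length ds} \<rho>) i j = red {..<prod_list ds} (mk \<rho>) (\<lambda>k. k) (\<lambda>k. ()) i j"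
    unfolding mk_ptrace[OF assms]
    by (intro fun_cong[where f = "red _ _ _ _ _"] fun_cong[where f = "red _ _ _ _"] red_cong)
      (auto simp: restr_full lab_eq_iff)
  also have "\<dots> = (\<Sum>z\<in>{()}. mk \<rho> i j)"
    using ij by (intro red_product[where W = "{..<prod_list ds}" and f = "\<lambda>w z. w"]) auto
  finally show "mk (ptrace ds {0..<length ds} \<rho>) i j = mk \<rho> i j" by simp
qed (rule stateD(1)[OF assms])

text \<open>Positions beyond \<open>length ds\<close> are invisible, which is what permits the
  infinite sets \<open>Ev\<close> and \<open>Od\<close> later.\<close>

lemma ent_cong:
  assumes "\<And>p. p < length ds \<Longrightarrow> p \<in> S \<longleftrightarrow> p \<in> S'"
  shows "state ds \<rho> \<Longrightarrow> ent ds \<rho> S = ent ds \<rho> S'"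
proof -
  assume "state ds \<rho>"
  have "lab ds S = lab ds S'" "lab ds (- S) = lab ds (- S')"
    using assms by (auto simp: lab_def fun_eq_iff)
  then show ?thesis by (simp add: ent_lab[OF \<open>state ds \<rho>\<close>])
qed

lemma mutinf_cong:
  assumes "state ds \<rho>" "\<And>p. p < length ds \<Longrightarrow> p \<in> X \<longleftrightarrow> p \<in> X'" "\<And>p. p < length ds \<Longrightarrow> p \<in> Y \<longleftrightarrow> p \<in> Y'"
  shows "mutinf ds \<rho> X Y = mutinf ds \<rho> X' Y'"
  unfolding mutinf_def using assms
    ent_cong[of ds X X' \<rho>] ent_cong[of ds Y Y' \<rho>] ent_cong[of ds "X \<union> Y" "X' \<union> Y'" \<rho>] by simp

lemma mutinf_kron:
  assumes "state ds \<sigma>" "state es \<tau>"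
  shows "mutinf (ds @ es) (kron \<sigma> \<tau>) X Y = mutinf ds \<sigma> X Y
    + mutinf es \<tau> {p. p + length ds \<in> X} {p. p + length ds \<in> Y}"
proof -
  have "{p. p + length ds \<in> X \<union> Y} = {p. p + length ds \<in> X} \<union> {p. p + length ds \<in> Y}" by auto
  then show ?thesis unfolding mutinf_def ent_kron[OF assms] by simp
qed

lemma mk_proj: "k < K \<Longrightarrow> mk (proj K k) m n = (if m = k then 1 else 0) * cnj (if n = k then 1 else 0)"
  unfolding mk_def proj_def by auto

lemma state_proj:
  assumes "k < K"
  shows "state [K] (proj K k)"
proof (rule stateI)
  show "proj K k \<in> carrier_mat (prod_list [K]) (prod_list [K])" by (simp add: proj_def)
  have "sdec {..<K} (mk (proj K k)) {k} (\<lambda>_. 1) (\<lambda>j m. if m = j then 1 else 0)"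
    unfolding sdec_def using assms by (auto simp: mk_proj ip_delta)
  then have "dens {..<K} (mk (proj K k))" by (rule sdec_densI) auto
  then show "dens {..<prod_list [K]} (mk (proj K k))" by simp
qed

text \<open>The classical-quantum state in the definition of \<open>Esq_C\<close> is the mixture of the products
  \<open>R k \<otimes> \<bar>k\<rangle>\<langle>k\<bar>\<close>.\<close>
context
  fixes ds :: "nat list" and K :: nat and p :: "nat \<Rightarrow> real" and R :: "nat \<Rightarrow> complex mat"
  assumes p: "\<And>k. k < K \<Longrightarrow> p k \<ge> 0" and p1: "(\<Sum>k<K. p k) = 1"
    and R: "\<And>k. k < K \<Longrightarrow> state ds (R k)"
begin

abbreviation cq :: "complex mat" where
  "cq \<equiv> emix (prod_list (ds @ [K])) {..<K} p (\<lambda>k. kron (R k) (proj K k))"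

lemma state_cq: "state (ds @ [K]) cq"
  by (rule emix_bounds(1)) (use p p1 R state_kron state_proj in auto)

lemma ptrace_cq: "ptrace (ds @ [K]) {0..<length ds} cq = emix (prod_list ds) {..<K} p R"
proof -
  have *: "ptrace (ds @ [K]) {0..<length ds} (kron (R k) (proj K k)) = R k" if "k < K" for k
    using ptrace_kron_left[OF R[OF that] state_proj[OF that], of "{0..<length ds}"] ptrace_full[OF R[OF that]] by (simp add: lessThan_atLeast0)
  have "ptrace (ds @ [K]) {0..<length ds} cq = emix (prod_list (nths (ds @ [K]) {0..<length ds})) {..<K} p
      (\<lambda>k. ptrace (ds @ [K]) {0..<length ds} (kron (R k) (proj K k)))"
    by (rule ptrace_emix) (use p p1 R state_kron state_proj in auto)
  also have "\<dots> = emix (prod_list ds) {..<K} p R"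
    unfolding emix_def using * by (auto simp: nths_append nths_all intro!: cong_mat sum.cong)
  finally show ?thesis .
qed

text \<open>The classical register survives in \<open>S\<close>, so the reduction is a mixture with
  orthonormal flags, for which \<open>flagged_mixture\<close> is exact.\<close>

lemma ent_cq:
  assumes "length ds \<in> S"
  shows "ent (ds @ [K]) cq S = (\<Sum>k<K. eta (p k)) + (\<Sum>k<K. p k * ent ds (R k) S)"
proof -
  let ?N = "prod_list ds"
  \<comment> \<open>The register contributes its value to the kept label and a unit to the
    traced-out one, giving both the pair shape required by \<open>red_tensor\<close>.\<close>
  let ?\<mu> = "\<lambda>i. (lab ds S (i div K), i mod K)" and ?\<mu>' = "\<lambda>i. (lab ds (- S) (i div K), ())"
  let ?G = "\<lambda>k. red {..<?N} (mk (R k)) (lab ds S) (lab ds (- S))"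
  have K: "K > 0" using p1 by (cases K) auto
  have mk: "mk cq i j = (\<Sum>k<K. complex_of_real (p k) * mk (kron (R k) (proj K k)) i j)" for i j
    by (rule mk_emix, rule stateD(1)) (use R state_kron state_proj in auto)
  have e: "ent (ds @ [K]) cq S = kent (red {..<prod_list (ds @ [K])} (mk cq) ?\<mu> ?\<mu>')"
  proof (rule ent_labels[OF state_cq])
    fix k l
    have s: "{p. p + length ds \<in> - S} \<inter> {0} = {}" "0 \<in> {p. p + length ds \<in> S}" using assms by auto
    show "(?\<mu> k = ?\<mu> l) = (\<forall>p<length (ds @ [K]). p \<in> S \<longrightarrow> dig (ds @ [K]) k p = dig (ds @ [K]) l p)"
      unfolding agree_append using s(2) by (auto simp: lab_eq_iff[of "[K]"] dig_def)
    show "(?\<mu>' k = ?\<mu>' l) = (\<forall>p<length (ds @ [K]). p \<notin> S \<longrightarrow> dig (ds @ [K]) k p = dig (ds @ [K]) l p)"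
      using agree_append[of ds "[K]" "- S" k l] s(1) by (auto simp: lab_eq_iff[of "[K]"])
  qed
  have F: "red {..<prod_list (ds @ [K])} (mk cq) ?\<mu> ?\<mu>' (x,m) (y,n) =
      (\<Sum>k<K. complex_of_real (p k) * ?G k x y * ((if m = k then 1 else 0) * cnj (if n = k then 1 else 0)))" for x m y n
  proof -
    have "red {..<prod_list (ds @ [K])} (mk cq) ?\<mu> ?\<mu>' (x,m) (y,n) =
      (\<Sum>k<K. complex_of_real (p k) * red {..<prod_list (ds @ [K])} (mk (kron (R k) (proj K k))) ?\<mu> ?\<mu>' (x,m) (y,n))"
      by (rule red_linear) (rule mk)
    also have "\<dots> = (\<Sum>k<K. complex_of_real (p k) * ?G k x y * ((if m = k then 1 else 0) * cnj (if n = k then 1 else 0)))"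
    proof (intro sum.cong refl)
      fix k assume "k \<in> {..<K}"
      then have k: "k < K" by simp
      have "red {..<prod_list (ds @ [K])} (mk (kron (R k) (proj K k))) ?\<mu> ?\<mu>' (x,m) (y,n) =
        red ({..<?N} \<times> {..<K}) (pairk (R k) (proj K k)) (\<lambda>(i,j). (lab ds S i, j)) (\<lambda>(i,j). (lab ds (- S) i, ())) (x,m) (y,n)"
        using red_kron[OF stateD(1)[OF R[OF k]], of "proj K k" K ?\<mu> ?\<mu>'] stateD(1)[OF state_proj[OF k]]
        by simp (intro fun_cong[where f = "red _ _ _ _ _"] fun_cong[where f = "red _ _ _ _"] red_cong, auto simp: div_pair)
      also have "\<dots> = ?G k x y * red {..<K} (mk (proj K k)) (\<lambda>j. j) (\<lambda>j. ()) m n"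
        by (rule red_tensor) (simp add: pairk_def)
      also have "red {..<K} (mk (proj K k)) (\<lambda>j. j) (\<lambda>j. ()) m n = mk (proj K k) m n"
        by (rule red_id) (auto simp: mk_def proj_def)
      finally show "complex_of_real (p k) * red {..<prod_list (ds @ [K])} (mk (kron (R k) (proj K k))) ?\<mu> ?\<mu>' (x,m) (y,n)
        = complex_of_real (p k) * ?G k x y * ((if m = k then 1 else 0) * cnj (if n = k then 1 else 0))"
        by (simp add: mk_proj[OF k])
    qed
    finally show ?thesis .
  qed
  have "kent (red {..<prod_list (ds @ [K])} (mk cq) ?\<mu> ?\<mu>') = (\<Sum>k<K. eta (p k)) + (\<Sum>k<K. p k * kent (?G k))"
  proof (rule flagged_mixture(2)[where I = "lab ds S ` {..<?N}" and M = "{..<K}" and c = "\<lambda>k m. if m = k then 1 else 0"])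
    show "dens (lab ds S ` {..<?N}) (?G k)" if "k \<in> {..<K}" for k
      by (rule dens_red[OF stateD(2)[OF R] lab_joint_inj]) (use that in simp)
    show "red {..<prod_list (ds @ [K])} (mk cq) ?\<mu> ?\<mu>' (x,m) (y,n) =
      (\<Sum>k<K. complex_of_real (p k) * ?G k x y * ((if m = k then 1 else 0) * cnj (if n = k then 1 else 0)))" for x m y n
      by (rule F)
  qed (use p p1 in \<open>auto simp: ip_delta\<close>)
  also have "(\<Sum>k<K. p k * kent (?G k)) = (\<Sum>k<K. p k * ent ds (R k) S)"
    by (intro sum.cong refl) (simp add: ent_lab[OF R])
  finally show ?thesis unfolding e .
qed

text \<open>\<open>S(X)\<close> cancels, and the four remaining entropies all contain the register;
  their Shannon terms occur with signs \<open>+ - - +\<close> and cancel as well.\<close>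

lemma mutinf_cq:
  assumes "X \<subseteq> {..<length ds}" "Y \<subseteq> {..<length ds}"
  shows "mutinf (ds @ [K]) cq X (Y \<union> {length ds}) - mutinf (ds @ [K]) cq X {length ds}
    = (\<Sum>k<K. p k * mutinf ds (R k) X Y)"
proof -
  let ?l = "length ds"
  have c: "(\<Sum>k<K. p k * ent ds (R k) (S \<union> {?l})) = (\<Sum>k<K. p k * ent ds (R k) S)" for S
    by (intro sum.cong refl arg_cong2[where f = "(*)"] ent_cong R) auto
  have c0: "(\<Sum>k<K. p k * ent ds (R k) {?l}) = 0"
    using c[of "{}"] by (simp add: ent_empty[OF R])
  have u: "X \<union> (Y \<union> {?l}) = (X \<union> Y) \<union> {?l}" by auto
  have "mutinf (ds @ [K]) cq X (Y \<union> {?l}) - mutinf (ds @ [K]) cq X {?l} =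
      (\<Sum>k<K. p k * ent ds (R k) Y) - (\<Sum>k<K. p k * ent ds (R k) (X \<union> Y)) + (\<Sum>k<K. p k * ent ds (R k) X)"
    unfolding mutinf_def u
    using ent_cq[of "Y \<union> {?l}"] ent_cq[of "(X \<union> Y) \<union> {?l}"] ent_cq[of "{?l}"] ent_cq[of "X \<union> {?l}"] c[of Y] c[of "X \<union> Y"] c[of X] c0
    by simp
  also have "\<dots> = (\<Sum>k<K. p k * mutinf ds (R k) X Y)"
    unfolding mutinf_def by (simp add: algebra_simps sum.distrib sum_subtractf)
  finally show ?thesis .
qed

end

text \<open>The infimum of this set is the mixed convex roof of the mutual information.\<close>

definition ensemble_values :: "nat list \<Rightarrow> nat set \<Rightarrow> nat set \<Rightarrow> complex mat \<Rightarrow> real set" where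
  "ensemble_values ds X Y \<rho> = {\<Sum>k<K. p k * mutinf ds (R k) X Y | (K :: nat) p R.
     (\<forall>k<K. p k \<ge> 0 \<and> state ds (R k)) \<and> (\<Sum>k<K. p k) = 1 \<and> emix (prod_list ds) {..<K} p R = \<rho>}"

text \<open>A classical extension carries its ensemble with it: by \<open>ptrace_cq\<close> the
  extension condition says that the ensemble averages to \<open>\<rho>\<close>, and
  \<open>mutinf_cq\<close> evaluates the objective.\<close>

lemma Esq_C_eq:
  assumes X: "X \<subseteq> {..<length ds}" and Y: "Y \<subseteq> {..<length ds}"
  shows "Esq_C ds X Y \<rho> = 1/2 * Inf (ensemble_values ds X Y \<rho>)"
proof -
  have \<sigma>: "mat (prod_list ds * K) (prod_list ds * K) (\<lambda>(i,j). \<Sum>k<K. complex_of_real (p k) * kron (R k) (proj K k) $$ (i,j))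
    = emix (prod_list (ds @ [K])) {..<K} p (\<lambda>k. kron (R k) (proj K k))" for K p R
    unfolding emix_def by simp
  have ext: "is_ext ds \<rho> [K] (emix (prod_list (ds @ [K])) {..<K} p (\<lambda>k. kron (R k) (proj K k))) \<longleftrightarrow>
      emix (prod_list ds) {..<K} p R = \<rho>"
    if "\<forall>k<K. p k \<ge> 0 \<and> state ds (R k)" "(\<Sum>k<K. p k) = 1" for K p R
    unfolding is_ext_def using state_cq[of K p ds R] ptrace_cq[of K p ds R] that by auto
  have val: "mutinf (ds @ [K]) (emix (prod_list (ds @ [K])) {..<K} p (\<lambda>k. kron (R k) (proj K k))) X (Y \<union> {length ds})
      - mutinf (ds @ [K]) (emix (prod_list (ds @ [K])) {..<K} p (\<lambda>k. kron (R k) (proj K k))) X {length ds}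
    = (\<Sum>k<K. p k * mutinf ds (R k) X Y)"
    if "\<forall>k<K. p k \<ge> 0 \<and> state ds (R k)" "(\<Sum>k<K. p k) = 1" for K p R
    by (rule mutinf_cq[OF _ _ _ X Y]) (use that in auto)
  have "{mutinf (ds @ [K]) \<sigma> X (Y \<union> {length ds}) - mutinf (ds @ [K]) \<sigma> X {length ds}
      | K \<sigma> p R. (\<forall>k<K. p k \<ge> 0 \<and> state ds (R k)) \<and> (\<Sum>k<K. p k) = 1 \<and>
          \<sigma> = mat (prod_list ds * K) (prod_list ds * K)
                (\<lambda>(i,j). \<Sum>k<K. complex_of_real (p k) * kron (R k) (proj K k) $$ (i,j)) \<and>
          is_ext ds \<rho> [K] \<sigma>} = ensemble_values ds X Y \<rho>" (is "?L = ?R")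
  proof (rule Set.set_eqI)
    fix v
    have "v \<in> ?L \<longleftrightarrow> (\<exists>K p R. (\<forall>k<K. p k \<ge> 0 \<and> state ds (R k)) \<and> (\<Sum>k<K. p k) = 1 \<and>
        is_ext ds \<rho> [K] (emix (prod_list (ds @ [K])) {..<K} p (\<lambda>k. kron (R k) (proj K k))) \<and>
        v = mutinf (ds @ [K]) (emix (prod_list (ds @ [K])) {..<K} p (\<lambda>k. kron (R k) (proj K k))) X (Y \<union> {length ds})
          - mutinf (ds @ [K]) (emix (prod_list (ds @ [K])) {..<K} p (\<lambda>k. kron (R k) (proj K k))) X {length ds})"
      unfolding \<sigma> by blast
    also have "\<dots> \<longleftrightarrow> (\<exists>(K :: nat) p R. (\<forall>k<K. p k \<ge> 0 \<and> state ds (R k)) \<and> (\<Sum>k<K. p k) = 1 \<and>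
        emix (prod_list ds) {..<K} p R = \<rho> \<and> v = (\<Sum>k<K. p k * mutinf ds (R k) X Y))"
      by (intro iff_exI conj_cong refl) (simp_all only: ext val)
    also have "\<dots> \<longleftrightarrow> v \<in> ?R" unfolding ensemble_values_def by blast
    finally show "v \<in> ?L \<longleftrightarrow> v \<in> ?R" .
  qed
  then show ?thesis unfolding Esq_C_def by simp
qed

text \<open>Finite index sets are renumbered here once, so that product ensembles can be used
  without an explicit enumeration of pairs.\<close>

lemma ensemble_valuesI:
  assumes A: "finite A" and p: "\<And>k. k \<in> A \<Longrightarrow> p k \<ge> 0" and p1: "(\<Sum>k\<in>A. p k) = 1"
    and R: "\<And>k. k \<in> A \<Longrightarrow> state ds (R k)" and \<rho>: "emix (prod_list ds) A p R = \<rho>"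
  shows "(\<Sum>k\<in>A. p k * mutinf ds (R k) X Y) \<in> ensemble_values ds X Y \<rho>"
proof -
  obtain h where h: "bij_betw h {..<card A} A"
    using ex_bij_betw_nat_finite[OF A] by (auto simp: lessThan_atLeast0)
  have hA: "h k \<in> A" if "k < card A" for k using h that bij_betwE by blast
  have "(\<Sum>k<card A. p (h k) * mutinf ds (R (h k)) X Y) \<in> ensemble_values ds X Y \<rho>"
    unfolding ensemble_values_def mem_Collect_eq
  proof (rule exI[of _ "card A"], rule exI[of _ "\<lambda>k. p (h k)"], rule exI[of _ "\<lambda>k. R (h k)"], intro conjI refl)
    show "\<forall>k<card A. 0 \<le> p (h k) \<and> state ds (R (h k))" using hA p R by blast
    show "(\<Sum>k<card A. p (h k)) = 1" using sum.reindex_bij_betw[OF h, of p] p1 by simp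
    show "emix (prod_list ds) {..<card A} (\<lambda>k. p (h k)) (\<lambda>k. R (h k)) = \<rho>"
      unfolding \<rho>[symmetric] emix_def
      using sum.reindex_bij_betw[OF h, of "\<lambda>k. complex_of_real (p k) * R k $$ _"] by simp
  qed
  then show ?thesis using sum.reindex_bij_betw[OF h, of "\<lambda>k. p k * mutinf ds (R k) X Y"] by simp
qed

lemma ensemble_values_mutinf:
  assumes "state ds \<rho>"
  shows "mutinf ds \<rho> X Y \<in> ensemble_values ds X Y \<rho>"
proof -
  have "(\<Sum>k\<in>{()}. 1 * mutinf ds \<rho> X Y) \<in> ensemble_values ds X Y \<rho>"
  proof (rule ensemble_valuesI)
    show "emix (prod_list ds) {()} (\<lambda>_. 1) (\<lambda>_. \<rho>) = \<rho>"
      unfolding emix_def using stateD(1)[OF assms] by (intro eq_matI) auto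
  qed (use assms in auto)
  then show ?thesis by simp
qed

lemma ensemble_values_nonneg:
  assumes "X \<inter> Y = {}" "v \<in> ensemble_values ds X Y \<rho>"
  shows "v \<ge> 0"
  using assms(2) unfolding ensemble_values_def
  by (auto intro!: sum_nonneg mult_nonneg_nonneg mutinf_nonneg assms(1))

lemma emix_kron:
  assumes "\<And>k. k \<in> A \<Longrightarrow> R k \<in> carrier_mat M M" "\<And>k. k \<in> B \<Longrightarrow> T k \<in> carrier_mat N N"
  shows "emix (M * N) (A \<times> B) (\<lambda>(k,l). p k * q l) (\<lambda>(k,l). kron (R k) (T l)) = kron (emix M A p R) (emix N B q T)"
proof (rule eq_matI)
  fix i j assume "i < dim_row (kron (emix M A p R) (emix N B q T))" "j < dim_col (kron (emix M A p R) (emix N B q T))"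
  then have ij: "i < M * N" "j < M * N" unfolding kron_def emix_def by auto
  have "N > 0" using ij by (cases N) auto
  have b: "i div N < M" "j div N < M" "i mod N < N" "j mod N < N"
    using ij \<open>N > 0\<close> by (auto intro: less_mult_imp_div_less)
  have "kron (R k) (T l) $$ (i,j) = R k $$ (i div N, j div N) * T l $$ (i mod N, j mod N)" if "k \<in> A" "l \<in> B" for k l
    using assms(1)[OF that(1)] assms(2)[OF that(2)] ij unfolding kron_def by auto
  then have "emix (M * N) (A \<times> B) (\<lambda>(k,l). p k * q l) (\<lambda>(k,l). kron (R k) (T l)) $$ (i,j) =
    (\<Sum>k\<in>A. \<Sum>l\<in>B. (complex_of_real (p k) * R k $$ (i div N, j div N)) * (complex_of_real (q l) * T l $$ (i mod N, j mod N)))"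
    unfolding emix_def using ij by (simp add: sum.cartesian_product' mult_ac)
  also have "\<dots> = kron (emix M A p R) (emix N B q T) $$ (i,j)"
    unfolding kron_def emix_def using ij b by (simp add: sum_product)
  finally show "emix (M * N) (A \<times> B) (\<lambda>(k,l). p k * q l) (\<lambda>(k,l). kron (R k) (T l)) $$ (i,j) = kron (emix M A p R) (emix N B q T) $$ (i,j)" .
qed (auto simp: kron_def emix_def)

text \<open>The product ensemble with weights \<open>p k * q l\<close> averages to the product
  state, and mutual information is additive on products.\<close>

lemma ensemble_values_kron:
  assumes u: "u \<in> ensemble_values ds X Y \<rho>"
    and v: "v \<in> ensemble_values es {p. p + length ds \<in> X} {p. p + length ds \<in> Y} \<tau>"
  shows "u + v \<in> ensemble_values (ds @ es) X Y (kron \<rho> \<tau>)"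
proof -
  let ?X = "{p. p + length ds \<in> X}" and ?Y = "{p. p + length ds \<in> Y}"
  obtain K :: nat and p R where 1: "u = (\<Sum>k<K. p k * mutinf ds (R k) X Y)" "\<forall>k<K. p k \<ge> 0 \<and> state ds (R k)"
    "(\<Sum>k<K. p k) = 1" "emix (prod_list ds) {..<K} p R = \<rho>"
    using u unfolding ensemble_values_def by blast
  obtain L :: nat and q T where 2: "v = (\<Sum>k<L. q k * mutinf es (T k) ?X ?Y)" "\<forall>k<L. q k \<ge> 0 \<and> state es (T k)"
    "(\<Sum>k<L. q k) = 1" "emix (prod_list es) {..<L} q T = \<tau>"
    using v unfolding ensemble_values_def by blast
  have "(\<Sum>i\<in>{..<K} \<times> {..<L}. (\<lambda>(k,l). p k * q l) i * mutinf (ds @ es) ((\<lambda>(k,l). kron (R k) (T l)) i) X Y)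
    \<in> ensemble_values (ds @ es) X Y (kron \<rho> \<tau>)"
  proof (rule ensemble_valuesI)
    show "(\<Sum>i\<in>{..<K} \<times> {..<L}. (\<lambda>(k,l). p k * q l) i) = 1"
      using 1(3) 2(3) by (simp add: sum.cartesian_product' flip: sum_product)
    show "emix (prod_list (ds @ es)) ({..<K} \<times> {..<L}) (\<lambda>(k,l). p k * q l) (\<lambda>(k,l). kron (R k) (T l)) = kron \<rho> \<tau>"
      unfolding 1(4)[symmetric] 2(4)[symmetric] prod_list.append
      by (rule emix_kron; rule stateD(1)) (use 1(2) 2(2) in auto)
  qed (use 1(2) 2(2) state_kron in auto)
  also have "(\<Sum>i\<in>{..<K} \<times> {..<L}. (\<lambda>(k,l). p k * q l) i * mutinf (ds @ es) ((\<lambda>(k,l). kron (R k) (T l)) i) X Y)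
    = (\<Sum>k<K. \<Sum>l<L. p k * q l * (mutinf ds (R k) X Y + mutinf es (T l) ?X ?Y))"
    unfolding sum.cartesian_product' prod.case using 1(2) 2(2)
    by (intro sum.cong refl) (simp add: mutinf_kron)
  also have "\<dots> = (\<Sum>k<K. p k * mutinf ds (R k) X Y * (\<Sum>l<L. q l)) + (\<Sum>k<K. p k * (\<Sum>l<L. q l * mutinf es (T l) ?X ?Y))"
    by (simp add: sum_distrib_left sum_distrib_right sum.distrib algebra_simps)
  also have "\<dots> = u + v" unfolding 1(1) 2(1) using 1(3) 2(3) by (simp flip: sum_distrib_right)
  finally show ?thesis .
qed

subsection \<open>Regularizations\<close>

text \<open>Supplies the existence of the limits hidden behind \<open>lim\<close> in the two
  regularizations. The lower bound by \<open>L\<close> at \<open>n = 1\<close> is what the first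
  inequality of the chain rests on.\<close>

lemma fekete:
  fixes a :: "nat \<Rightarrow> real"
  assumes sub: "\<And>m n. m \<ge> 1 \<Longrightarrow> n \<ge> 1 \<Longrightarrow> a (m + n) \<le> a m + a n" and nn: "\<And>n. n \<ge> 1 \<Longrightarrow> a n \<ge> 0"
  shows "\<exists>L. (\<lambda>n. a n / real n) \<longlonglongrightarrow> L \<and> (\<forall>n\<ge>1. L \<le> a n / real n)"
proof -
  define L where "L = (INF n\<in>{1..}. a n / real n)"
  have bdd: "bdd_below ((\<lambda>n. a n / real n) ` {1..})"
    using nn by (intro bdd_belowI[of _ 0]) auto
  have L: "L \<le> a n / real n" if "n \<ge> 1" for n
    unfolding L_def using that by (intro cINF_lower[OF bdd]) auto
  \<comment> \<open>The hypotheses do not control \<open>a 0\<close>, so a zero remainder is made to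
    contribute 0.\<close>
  have mult: "a (q * m + r) \<le> real q * a m + (if r = 0 then 0 else a r)" if "m \<ge> 1" "q * m + r \<ge> 1" for q m r
    using that(2)
  proof (induction q)
    case 0
    then show ?case by auto
  next
    case (Suc q)
    show ?case
    proof (cases "q * m + r = 0")
      case True
      then have "q = 0" "r = 0" using that(1) by auto
      then show ?thesis by simp
    next
      case False
      then have ge: "q * m + r \<ge> 1" by linarith
      have "a (m + (q * m + r)) \<le> a m + a (q * m + r)" by (rule sub[OF that(1) ge])
      also have "\<dots> \<le> a m + (real q * a m + (if r = 0 then 0 else a r))" using Suc(1)[OF ge] by simp
      finally show ?thesis by (simp add: algebra_simps)
    qed
  qed
  have "(\<lambda>n. a n / real n) \<longlonglongrightarrow> L"
  proof (rule LIMSEQ_I)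
    fix e :: real assume e: "e > 0"
    have "\<exists>m\<in>{1..}. a m / real m < L + e / 2"
      unfolding L_def using e by (intro cINF_less_iff[THEN iffD1, OF _ bdd]) auto
    then obtain m where m: "m \<ge> 1" "a m / real m < L + e / 2" by auto
    \<comment> \<open>As all terms are nonnegative, this sum bounds every possible remainder term,
      independently of \<open>n\<close>.\<close>
    define C where "C = (\<Sum>r\<in>{1..<m}. a r)"
    have C: "(if r = 0 then 0 else a r) \<le> C" if "r < m" for r
    proof (cases "r = 0")
      case True
      then show ?thesis unfolding C_def using nn by (auto intro: sum_nonneg)
    next
      case False
      then have "a r \<le> C" unfolding C_def using that nn by (intro member_le_sum) auto
      then show ?thesis using False by simp
    qed
    obtain N where N: "real N > 2 * C / e" using reals_Archimedean2 by blast
    show "\<exists>N. \<forall>n\<ge>N. norm (a n / real n - L) < e"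
    proof (intro exI allI impI)
      fix n assume n: "n \<ge> max N 1"
      have n1: "n \<ge> 1" using n by simp
      have "a n = a (n div m * m + n mod m)" by simp
      also have "\<dots> \<le> real (n div m) * a m + (if n mod m = 0 then 0 else a (n mod m))"
        using n1 by (intro mult m) simp
      also have "\<dots> \<le> real (n div m) * a m + C" using m C[of "n mod m"] by simp
      finally have "a n \<le> real (n div m) * a m + C" .
      moreover have "real (n div m) * a m \<le> real n * (a m / real m)"
      proof -
        have "real (n div m) * real m \<le> real n" by (metis div_times_less_eq_dividend of_nat_le_iff of_nat_mult)
        then have "real (n div m) * real m * (a m / real m) \<le> real n * (a m / real m)"
          using nn[OF m(1)] by (intro mult_right_mono) auto
        then show ?thesis using m(1) by simp
      qed
      ultimately have "a n \<le> real n * (a m / real m) + C" by linarith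
      then have "a n / real n \<le> a m / real m + C / real n" using n1 by (simp add: field_simps)
      moreover have "C / real n < e / 2"
      proof -
        have "2 * C / e < real n" using N n by linarith
        then show ?thesis using e n1 by (simp add: field_simps)
      qed
      ultimately have "a n / real n < L + e" using m(2) by linarith
      then show "norm (a n / real n - L) < e" using L[OF n1] e by simp
    qed
  qed
  then show ?thesis using L by blast
qed

lemma length_nds: "length (nds dA dB n) = 2 * n"
  unfolding nds_def by (induction n) auto

lemma nds_add: "nds dA dB (m + n) = nds dA dB m @ nds dA dB n"
  unfolding nds_def by (simp add: replicate_add)

lemma nds_Suc: "nds dA dB (Suc n) = nds dA dB n @ [dA, dB]"
  using nds_add[of dA dB n 1] unfolding nds_def by simp

lemma nds_0: "nds dA dB 0 = []" and nds_1: "nds dA dB (Suc 0) = [dA, dB]"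
  unfolding nds_def by auto

lemma nds_nth: "k < n \<Longrightarrow> nds dA dB n ! (2 * k) = dA \<and> nds dA dB n ! Suc (2 * k) = dB"
proof (induction n)
  case (Suc n)
  show ?case
  proof (cases "k = n")
    case True
    then show ?thesis using nth_append_length_plus[of "nds dA dB n" "[dA, dB]" 0] nth_append_length_plus[of "nds dA dB n" "[dA, dB]" 1]
      unfolding nds_Suc by (simp add: length_nds)
  next
    case False
    then show ?thesis using Suc unfolding nds_Suc by (simp add: nth_append length_nds)
  qed
qed simp

lemma state_one: "state [] (1\<^sub>m 1)"
proof (rule stateI)
  have "sdec {..<1} (mk (1\<^sub>m 1)) {0::nat} (\<lambda>_. 1) (\<lambda>j m. if m = 0 then 1 else 0)"
    unfolding sdec_def ip_def by (auto simp: mk_def)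
  then have "dens {..<1} (mk (1\<^sub>m 1))" by (rule sdec_densI) auto
  then show "dens {..<prod_list []} (mk (1\<^sub>m 1))" by simp
qed auto

lemma state_tpow: "state [dA, dB] \<rho> \<Longrightarrow> state (nds dA dB n) (tpow \<rho> n)"
proof (induction n)
  case 0
  show ?case unfolding nds_0 tpow.simps by (rule state_one)
next
  case (Suc n)
  then show ?case unfolding nds_Suc tpow.simps by (intro state_kron) auto
qed

lemma tpow_add: "tpow \<rho> (m + n) = kron (tpow \<rho> m) (tpow \<rho> n)"
  by (induction n) (auto simp: kron_one_right[simplified] kron_assoc)

lemma tpow_1: "tpow \<rho> (Suc 0) = \<rho>"
  using kron_one_left[of \<rho>] by simp

text \<open>Since \<open>nds dA dB n\<close> has even length, the A- and B-parts may be taken to be all even and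
  all odd positions; this makes them independent of \<open>n\<close> and invariant under appending copies.\<close>
abbreviation Ev :: "nat set" where "Ev \<equiv> {p. even p}"
abbreviation Od :: "nat set" where "Od \<equiv> {p. odd p}"

lemma shift_nds:
  "{p. p + length (nds dA dB n) \<in> Ev} = Ev" "{p. p + length (nds dA dB n) \<in> Od} = Od"
  by (auto simp: length_nds)

lemma mutinf_Apos_Bpos:
  assumes "state (nds dA dB n) \<sigma>"
  shows "mutinf (nds dA dB n) \<sigma> (Apos n) (Bpos n) = mutinf (nds dA dB n) \<sigma> Ev Od"
  by (rule mutinf_cong[OF assms]) (auto simp: Apos_def Bpos_def length_nds)

lemma mutinf_nds_kron:
  assumes "state (nds dA dB m) \<sigma>" "state es \<tau>"
  shows "mutinf (nds dA dB m @ es) (kron \<sigma> \<tau>) Ev Od = mutinf (nds dA dB m) \<sigma> Ev Od + mutinf es \<tau> Ev Od"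
  using mutinf_kron[OF assms, of Ev Od] by (simp only: shift_nds)

lemma mutinf_EvOd_nonneg: "state ds \<sigma> \<Longrightarrow> mutinf ds \<sigma> Ev Od \<ge> 0"
  by (rule mutinf_nonneg) auto

lemma ptrace_nds_kron:
  assumes "state (nds dA dB m) \<sigma>" "state (nds dA dB n) \<tau>"
  shows "k < m \<Longrightarrow> ptrace (nds dA dB (m + n)) {2*k, 2*k+1} (kron \<sigma> \<tau>) = ptrace (nds dA dB m) {2*k, 2*k+1} \<sigma>"
    and "ptrace (nds dA dB (m + n)) {2*(m+k), 2*(m+k)+1} (kron \<sigma> \<tau>) = ptrace (nds dA dB n) {2*k, 2*k+1} \<tau>"
proof -
  show "ptrace (nds dA dB (m + n)) {2*k, 2*k+1} (kron \<sigma> \<tau>) = ptrace (nds dA dB m) {2*k, 2*k+1} \<sigma>" if "k < m"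
    unfolding nds_add by (rule ptrace_kron_left[OF assms]) (use that in \<open>auto simp: length_nds\<close>)
  have "{p. p + length (nds dA dB m) \<in> {2*(m+k), 2*(m+k)+1}} = {2*k, 2*k+1}"
    by (auto simp: length_nds)
  then show "ptrace (nds dA dB (m + n)) {2*(m+k), 2*(m+k)+1} (kron \<sigma> \<tau>) = ptrace (nds dA dB n) {2*k, 2*k+1} \<tau>"
    unfolding nds_add by (subst ptrace_kron_right[OF assms]) (auto simp: length_nds)
qed

context
  fixes dA dB :: nat and \<rho> :: "complex mat"
  assumes \<rho>: "state [dA, dB] \<rho>"
begin

definition ens :: "nat \<Rightarrow> real set" where
  "ens n = ensemble_values (nds dA dB n) Ev Od (tpow \<rho> n)"

lemma Esq_C_ens: "Esq_C (nds dA dB n) (Apos n) (Bpos n) (tpow \<rho> n) = 1/2 * Inf (ens n)"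
proof -
  have "(\<Sum>k<K. p k * mutinf (nds dA dB n) (R k) (Apos n) (Bpos n)) = (\<Sum>k<K. p k * mutinf (nds dA dB n) (R k) Ev Od)"
    if "\<forall>k<K. p k \<ge> 0 \<and> state (nds dA dB n) (R k)" for K :: nat and p R
    using that by (intro sum.cong refl) (simp add: mutinf_Apos_Bpos)
  then have "ensemble_values (nds dA dB n) (Apos n) (Bpos n) (tpow \<rho> n) = ens n"
    unfolding ens_def ensemble_values_def by (intro Collect_cong iff_exI) auto
  moreover have "Apos n \<subseteq> {..<length (nds dA dB n)}" "Bpos n \<subseteq> {..<length (nds dA dB n)}"
    by (auto simp: Apos_def Bpos_def length_nds)
  ultimately show ?thesis using Esq_C_eq by simp
qed

lemma ens_nonempty: "ens n \<noteq> {}"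
  unfolding ens_def using ensemble_values_mutinf[OF state_tpow[OF \<rho>]] by blast

lemma ens_nonneg: "v \<in> ens n \<Longrightarrow> v \<ge> 0"
  unfolding ens_def by (rule ensemble_values_nonneg[rotated]) auto

lemma ens_bdd: "bdd_below (ens n)"
  using ens_nonneg by (intro bdd_belowI[of _ 0])

text \<open>Product ensembles give sums of values; the infima over the two factors are then taken
  one after the other, so that no optimal ensemble enters.\<close>

lemma Inf_ens_subadditive: "Inf (ens (m + n)) \<le> Inf (ens m) + Inf (ens n)"
proof -
  have add: "u + v \<in> ens (m + n)" if "u \<in> ens m" "v \<in> ens n" for u v
    using ensemble_values_kron[of u "nds dA dB m" Ev Od "tpow \<rho> m" v "nds dA dB n" "tpow \<rho> n"] that
    unfolding ens_def shift_nds nds_add tpow_add by blast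
  have "Inf (ens (m + n)) - Inf (ens n) \<le> Inf (ens m)"
  proof (rule cInf_greatest[OF ens_nonempty])
    fix u assume u: "u \<in> ens m"
    have "Inf (ens (m + n)) - u \<le> Inf (ens n)"
    proof (rule cInf_greatest[OF ens_nonempty])
      fix v assume "v \<in> ens n"
      then have "Inf (ens (m + n)) \<le> u + v" using add[OF u] by (intro cInf_lower ens_bdd)
      then show "Inf (ens (m + n)) - u \<le> v" by linarith
    qed
    then show "Inf (ens (m + n)) - Inf (ens n) \<le> u" by linarith
  qed
  then show ?thesis by linarith
qed

lemma Esq_C_reg_props:
  shows "(\<lambda>n. Inf (ens n) / real n) \<longlonglongrightarrow> 2 * Esq_C_reg dA dB \<rho>"
    and "2 * Esq_C_reg dA dB \<rho> \<le> 2 * Esq_C [dA, dB] {0} {1} \<rho>"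
proof -
  have nn: "Inf (ens n) \<ge> 0" for n using ens_nonneg by (intro cInf_greatest ens_nonempty)
  obtain L where L: "(\<lambda>n. Inf (ens n) / real n) \<longlonglongrightarrow> L" "\<forall>n\<ge>1. L \<le> Inf (ens n) / real n"
    using fekete[of "\<lambda>n. Inf (ens n)"] Inf_ens_subadditive nn by blast
  have "(\<lambda>n. Esq_C (nds dA dB n) (Apos n) (Bpos n) (tpow \<rho> n) / real n) \<longlonglongrightarrow> 1/2 * L"
    unfolding Esq_C_ens using tendsto_mult_left[OF L(1), of "1/2"] by simp
  then have "Esq_C_reg dA dB \<rho> = 1/2 * L" unfolding Esq_C_reg_def by (rule limI)
  then have "2 * Esq_C_reg dA dB \<rho> = L" by simp
  then show 1: "(\<lambda>n. Inf (ens n) / real n) \<longlonglongrightarrow> 2 * Esq_C_reg dA dB \<rho>" using L(1) by (simp only:)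
  have "Apos 1 = {0}" "Bpos 1 = {1}"
    unfolding Apos_def Bpos_def by (auto simp: less_Suc_eq numeral_2_eq_2)
  then have "Esq_C [dA, dB] {0} {1} \<rho> = 1/2 * Inf (ens 1)"
    using Esq_C_ens[of 1] by (simp add: nds_1 tpow_1 del: tpow.simps)
  moreover have "L \<le> Inf (ens 1)" using L(2) by force
  ultimately show "2 * Esq_C_reg dA dB \<rho> \<le> 2 * Esq_C [dA, dB] {0} {1} \<rho>"
    using LIMSEQ_unique[OF L(1) 1] by simp
qed

section \<open>Broadcast values and their regularization\<close>

definition broadcast :: "nat \<Rightarrow> complex mat \<Rightarrow> bool" where
  "broadcast n \<sigma> \<longleftrightarrow> state (nds dA dB n) \<sigma> \<and> (\<forall>k<n. ptrace (nds dA dB n) {2*k, 2*k+1} \<sigma> = \<rho>)"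

definition bvals :: "nat \<Rightarrow> real set" where
  "bvals n = {mutinf (nds dA dB n) \<sigma> Ev Od | \<sigma>. broadcast n \<sigma>}"

lemma Ib_n_bvals: "Ib_n dA dB \<rho> n = Inf (bvals n)"
proof -
  have "{mutinf (nds dA dB n) \<sigma> (Apos n) (Bpos n) | \<sigma>.
      state (nds dA dB n) \<sigma> \<and> (\<forall>k<n. ptrace (nds dA dB n) {2*k, 2*k+1} \<sigma> = \<rho>)} = bvals n"
    unfolding bvals_def broadcast_def by (intro Collect_cong iff_exI) (auto simp: mutinf_Apos_Bpos)
  then show ?thesis unfolding Ib_n_def by simp
qed

lemma broadcast_kron:
  assumes "broadcast m \<sigma>" "broadcast n \<tau>"
  shows "broadcast (m + n) (kron \<sigma> \<tau>)"
proof -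
  have st: "state (nds dA dB m) \<sigma>" "state (nds dA dB n) \<tau>" using assms unfolding broadcast_def by auto
  have "ptrace (nds dA dB (m + n)) {2*k, 2*k+1} (kron \<sigma> \<tau>) = \<rho>" if k: "k < m + n" for k
  proof (cases "k < m")
    case True
    then show ?thesis using ptrace_nds_kron(1)[OF st True] assms(1) unfolding broadcast_def by simp
  next
    case False
    then have "k = m + (k - m)" "k - m < n" using k by auto
    then show ?thesis using ptrace_nds_kron(2)[OF st, of "k - m"] assms(2) unfolding broadcast_def by metis
  qed
  then show ?thesis using state_kron[OF st] unfolding broadcast_def nds_add by blast
qed

text \<open>Independent copies form a broadcast state, which keeps the infimum from ranging over the
  empty set.\<close>

lemma broadcast_tpow: "broadcast n (tpow \<rho> n)"
proof (induction n)
  case 0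
  show ?case unfolding broadcast_def using state_tpow[OF \<rho>, of 0] by simp
next
  case (Suc n)
  have "{0..<length [dA, dB]} = {2 * 0, 2 * 0 + 1}" by auto
  then have "ptrace [dA, dB] {2 * 0, 2 * 0 + 1} \<rho> = \<rho>" using ptrace_full[OF \<rho>] by metis
  then have "broadcast 1 \<rho>" unfolding broadcast_def using \<rho> by (simp add: nds_1)
  then show ?case using broadcast_kron[OF Suc, of 1 \<rho>] by simp
qed

lemma bvals_nonempty: "bvals n \<noteq> {}"
  unfolding bvals_def using broadcast_tpow by blast

lemma bvals_nonneg: "v \<in> bvals n \<Longrightarrow> v \<ge> 0"
  unfolding bvals_def broadcast_def using mutinf_EvOd_nonneg by auto

lemma bvals_bdd: "bdd_below (bvals n)"
  using bvals_nonneg by (intro bdd_belowI[of _ 0])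

lemma Inf_bvals_subadditive: "Inf (bvals (m + n)) \<le> Inf (bvals m) + Inf (bvals n)"
proof -
  have add: "u + v \<in> bvals (m + n)" if uv: "u \<in> bvals m" "v \<in> bvals n" for u v
  proof -
    obtain \<sigma> \<tau> where *: "u = mutinf (nds dA dB m) \<sigma> Ev Od" "broadcast m \<sigma>" "v = mutinf (nds dA dB n) \<tau> Ev Od" "broadcast n \<tau>"
      using uv unfolding bvals_def by blast
    have "state (nds dA dB m) \<sigma>" "state (nds dA dB n) \<tau>" using * unfolding broadcast_def by auto
    then have "u + v = mutinf (nds dA dB (m + n)) (kron \<sigma> \<tau>) Ev Od"
      using mutinf_nds_kron * unfolding nds_add by simp
    then show ?thesis using broadcast_kron[OF *(2,4)] unfolding bvals_def by blast
  qed
  have "Inf (bvals (m + n)) - Inf (bvals n) \<le> Inf (bvals m)"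
  proof (rule cInf_greatest[OF bvals_nonempty])
    fix u assume u: "u \<in> bvals m"
    have "Inf (bvals (m + n)) - u \<le> Inf (bvals n)"
    proof (rule cInf_greatest[OF bvals_nonempty])
      fix v assume "v \<in> bvals n"
      then have "Inf (bvals (m + n)) \<le> u + v" using add[OF u] by (intro cInf_lower bvals_bdd)
      then show "Inf (bvals (m + n)) - u \<le> v" by linarith
    qed
    then show "Inf (bvals (m + n)) - Inf (bvals n) \<le> u" by linarith
  qed
  then show ?thesis by linarith
qed

lemma Ib_reg_lim: "(\<lambda>n. Inf (bvals n) / real n) \<longlonglongrightarrow> Ib_reg dA dB \<rho>"
proof -
  have nn: "Inf (bvals n) \<ge> 0" for n using bvals_nonneg by (intro cInf_greatest bvals_nonempty)
  obtain L where L: "(\<lambda>n. Inf (bvals n) / real n) \<longlonglongrightarrow> L"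
    using fekete[of "\<lambda>n. Inf (bvals n)"] Inf_bvals_subadditive nn by blast
  then show ?thesis unfolding Ib_reg_def Ib_n_bvals using limI[OF L] by simp
qed

end

subsection \<open>Broadcast states from ensembles\<close>

primrec prodst :: "(nat \<Rightarrow> complex mat) \<Rightarrow> nat \<Rightarrow> complex mat" where
  "prodst \<tau> 0 = 1\<^sub>m 1"
| "prodst \<tau> (Suc n) = kron (prodst \<tau> n) (\<tau> n)"

lemma nds_mult_Suc: "nds dA dB (Suc n * m) = nds dA dB (n * m) @ nds dA dB m"
  by (simp add: add.commute[of m] nds_add)

lemma state_prodst:
  assumes "\<And>i. i < n \<Longrightarrow> state (nds dA dB m) (\<tau> i)"
  shows "state (nds dA dB (n * m)) (prodst \<tau> n)"
  using assms
proof (induction n)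
  case 0
  show ?case using state_one by (simp add: nds_0)
next
  case (Suc n)
  then show ?case unfolding nds_mult_Suc prodst.simps by (intro state_kron) auto
qed

text \<open>The condition \<open>inv\<close> says that \<open>S\<close> looks the same from every
  block boundary. It holds for \<open>Ev\<close>, \<open>Od\<close> and their union because blocks
  have even length.\<close>

lemma ent_prodst:
  assumes "\<And>i. i < n \<Longrightarrow> state (nds dA dB m) (\<tau> i)"
    and inv: "\<And>j. {p. p + length (nds dA dB j) \<in> S} = S"
  shows "ent (nds dA dB (n * m)) (prodst \<tau> n) S = (\<Sum>i<n. ent (nds dA dB m) (\<tau> i) S)"
  using assms(1)
proof (induction n)
  case 0
  have "ent [] (1\<^sub>m 1) S = ent [] (1\<^sub>m 1) {}" by (rule ent_cong[OF _ state_one]) simp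
  then show ?case using ent_empty[OF state_one] by (simp add: nds_0)
next
  case (Suc n)
  have st: "state (nds dA dB (n * m)) (prodst \<tau> n)" using Suc(2) by (intro state_prodst) auto
  show ?case unfolding nds_mult_Suc prodst.simps using Suc(2)
    by (subst ent_kron[OF st]) (auto simp: inv Suc(1))
qed

lemma ptrace_prodst:
  assumes "\<And>i. i < n \<Longrightarrow> state (nds dA dB m) (\<tau> i)" "i < n" "j < m"
  shows "ptrace (nds dA dB (n * m)) {2 * (i * m + j), 2 * (i * m + j) + 1} (prodst \<tau> n)
    = ptrace (nds dA dB m) {2 * j, 2 * j + 1} (\<tau> i)"
  using assms(1,2)
proof (induction n)
  case (Suc n)
  have st: "state (nds dA dB (n * m)) (prodst \<tau> n)" "state (nds dA dB m) (\<tau> n)"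
    using Suc(2) by (auto intro: state_prodst)
  have e: "Suc n * m = n * m + m" by simp
  show ?case
  proof (cases "i < n")
    case True
    have "i * m + j < Suc i * m" using assms(3) by simp
    also have "\<dots> \<le> n * m" using True by (intro mult_right_mono) auto
    finally have lt: "i * m + j < n * m" .
    show ?thesis unfolding e prodst.simps ptrace_nds_kron(1)[OF st lt]
      by (rule Suc(1)) (use Suc(2) True in auto)
  next
    case False
    then have "i = n" using Suc(3) by simp
    then show ?thesis unfolding e prodst.simps using ptrace_nds_kron(2)[OF st] by simp
  qed
qed simp

lemma bij_betw_cyclic_shift: "bij_betw (\<lambda>s. (i + s) mod n) {..<n} {..<n :: nat}"
proof -
  have aux: "s = t" if "s \<le> t" "t < n" "(i + s) mod n = (i + t) mod n" for s t
  proof -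
    have "n dvd (i + t) - (i + s)" using that mod_eq_dvd_iff_nat[of "i + s" "i + t" n] by simp
    then have "n dvd t - s" by simp
    then show ?thesis using that dvd_imp_le[of n "t - s"] by (cases "s = t") auto
  qed
  have inj: "inj_on (\<lambda>s. (i + s) mod n) {..<n}"
  proof (rule inj_onI)
    fix s t assume *: "s \<in> {..<n}" "t \<in> {..<n}" "(i + s) mod n = (i + t) mod n"
    show "s = t"
    proof (cases "s \<le> t")
      case True
      then show ?thesis using aux[of s t] * by simp
    next
      case False
      then show ?thesis using aux[of t s] * by simp
    qed
  qed
  moreover have "(\<lambda>s. (i + s) mod n) ` {..<n} \<subseteq> {..<n}" by auto
  ultimately show ?thesis by (simp add: bij_betw_def endo_inj_surj)
qed

lemma sum_list_blocks:
  fixes g :: "'a \<Rightarrow> 'b :: comm_semiring_1"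
  shows "sum_list (map g (concat (map (\<lambda>k. replicate (c k) (R k)) [0..<K]))) = (\<Sum>k<K. of_nat (c k) * g (R k))"
  by (induction K) (auto simp: sum_list_replicate)

text \<open>Rounding down the weights of an ensemble and collecting the remainders in a single state gives,
  for every \<open>n\<close>, a list of \<open>n\<close> states with exactly the same average.\<close>
lemma ensemble_discretise:
  assumes K: "\<And>k. k < K \<Longrightarrow> p k \<ge> 0 \<and> state ds (R k)" and p1: "(\<Sum>k<K. p k) = 1" and n: "n \<ge> 1"
  shows "\<exists>\<tau>. (\<forall>i<n. state ds (\<tau> i)) \<and>
    emix (prod_list ds) {..<n} (\<lambda>_. 1 / real n) \<tau> = emix (prod_list ds) {..<K} p R \<and>
    (\<Sum>i<n. mutinf ds (\<tau> i) Ev Od) \<le> real n * (\<Sum>k<K. p k * mutinf ds (R k) Ev Od) + real K * (2 * log 2 (prod_list ds))"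
proof -
  let ?N = "prod_list ds"
  have "K > 0" using p1 by (cases K) auto
  then have N: "?N > 0" using stateD(3) K by blast
  define c where "c k = nat \<lfloor>real n * p k\<rfloor>" for k
  define f where "f k = real n * p k - real (c k)" for k
  have c: "real (c k) \<le> real n * p k" "f k \<ge> 0" "f k \<le> 1" if "k < K" for k
  proof -
    have "real n * p k \<ge> 0" using K[OF that] by simp
    then have "real (c k) = of_int \<lfloor>real n * p k\<rfloor>" unfolding c_def by simp
    then show "real (c k) \<le> real n * p k" "f k \<ge> 0" "f k \<le> 1" unfolding f_def by linarith+
  qed
  have "real (\<Sum>k<K. c k) \<le> (\<Sum>k<K. real n * p k)" unfolding of_nat_sum by (intro sum_mono) (use c in auto)
  also have "\<dots> = real n" using p1 by (simp flip: sum_distrib_left)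
  finally have cn: "(\<Sum>k<K. c k) \<le> n" by (simp only: of_nat_le_iff)
  define r where "r = n - (\<Sum>k<K. c k)"
  have rf: "real r = (\<Sum>k<K. f k)"
    unfolding r_def f_def sum_subtractf using cn p1 by (simp add: of_nat_diff flip: sum_distrib_left)
  \<comment> \<open>For \<open>r = 0\<close> the matrix \<open>R'\<close> defined below is no state,
    but then all fractional parts vanish and \<open>R'\<close> occurs with multiplicity 0.\<close>
  have f0: "f k = 0" if "r = 0" "k < K" for k
    using rf that sum_nonneg_eq_0_iff[of "{..<K}" f] c(2) by auto
  have rK: "real r \<le> real K"
    unfolding rf using sum_bounded_above[of "{..<K}" f 1] c(3) by auto
  define R' where "R' = emix ?N {..<K} (\<lambda>k. f k / real r) R"
  have R': "state ds R'" if "r > 0"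
    unfolding R'_def by (rule emix_bounds(1)) (use K c rf that in \<open>auto simp flip: sum_divide_distrib\<close>)
  have R'f: "of_nat r * R' $$ (a,b) = (\<Sum>k<K. complex_of_real (f k) * R k $$ (a,b))" if "a < ?N" "b < ?N" for a b
  proof (cases "r = 0")
    case False
    then show ?thesis unfolding R'_def emix_def using that by (simp add: sum_distrib_left)
  qed (simp add: f0)
  define l where "l = concat (map (\<lambda>k. replicate (c k) (R k)) [0..<K]) @ replicate r R'"
  have len: "length l = n"
    using cn unfolding l_def r_def by (simp add: length_concat comp_def interv_sum_list_conv_sum_set_nat lessThan_atLeast0)
  \<comment> \<open>General in the target type: it is applied to complex matrix entries and to real
    mutual informations.\<close>
  have sums: "(\<Sum>i<n. g (l ! i)) = (\<Sum>k<K. of_nat (c k) * g (R k)) + of_nat r * g R'" for g :: "complex mat \<Rightarrow> 'b :: comm_semiring_1"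
  proof -
    have "(\<Sum>i<n. g (l ! i)) = sum_list (map g l)"
      unfolding sum_list_sum_nth len[symmetric] by (simp add: lessThan_atLeast0)
    then show ?thesis unfolding l_def map_append sum_list_append sum_list_blocks by (simp add: sum_list_replicate)
  qed
  show ?thesis
  proof (intro exI[of _ "\<lambda>i. l ! i"] conjI allI impI)
    fix i assume "i < n"
    then have "l ! i \<in> set l" using len by simp
    then show "state ds (l ! i)" unfolding l_def using K R' by (auto split: if_splits)
  next
    show "emix ?N {..<n} (\<lambda>_. 1 / real n) (\<lambda>i. l ! i) = emix ?N {..<K} p R"
    proof (rule eq_matI)
      fix a b assume "a < dim_row (emix ?N {..<K} p R)" "b < dim_col (emix ?N {..<K} p R)"
      then have ab: "a < ?N" "b < ?N" unfolding emix_def by auto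
      have "emix ?N {..<n} (\<lambda>_. 1 / real n) (\<lambda>i. l ! i) $$ (a,b) = complex_of_real (1 / real n) * (\<Sum>i<n. (\<lambda>M. M $$ (a,b)) (l ! i))"
        unfolding emix_def using ab by (simp only: index_mat prod.case sum_distrib_left)
      also have "(\<Sum>i<n. (\<lambda>M. M $$ (a,b)) (l ! i)) = (\<Sum>k<K. of_nat (c k) * R k $$ (a,b)) + of_nat r * R' $$ (a,b)"
        by (rule sums)
      also have "\<dots> = (\<Sum>k<K. complex_of_real (real n * p k) * R k $$ (a,b))"
        unfolding R'f[OF ab] sum.distrib[symmetric] by (intro sum.cong refl) (simp add: f_def algebra_simps)
      also have "complex_of_real (1 / real n) * \<dots> = emix ?N {..<K} p R $$ (a,b)"
        unfolding emix_def using ab n by (simp add: sum_distrib_left)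
      finally show "emix ?N {..<n} (\<lambda>_. 1 / real n) (\<lambda>i. l ! i) $$ (a,b) = emix ?N {..<K} p R $$ (a,b)" .
    qed (auto simp: emix_def)
  next
    have "(\<Sum>i<n. mutinf ds (l ! i) Ev Od) = (\<Sum>k<K. real (c k) * mutinf ds (R k) Ev Od) + real r * mutinf ds R' Ev Od"
      by (rule sums)
    moreover have "(\<Sum>k<K. real (c k) * mutinf ds (R k) Ev Od) \<le> (\<Sum>k<K. real n * p k * mutinf ds (R k) Ev Od)"
      by (intro sum_mono mult_right_mono mutinf_EvOd_nonneg) (use c K in auto)
    \<comment> \<open>At most \<open>K\<close> remainder copies occur, so the error does not grow
      with \<open>n\<close>.\<close>
    moreover have "real r * mutinf ds R' Ev Od \<le> real K * (2 * log 2 ?N)"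
    proof (cases "r = 0")
      case True
      then show ?thesis using N by simp
    next
      case False
      then show ?thesis using R' rK by (intro mult_mono mutinf_le mutinf_EvOd_nonneg) auto
    qed
    ultimately show "(\<Sum>i<n. mutinf ds (l ! i) Ev Od) \<le> real n * (\<Sum>k<K. p k * mutinf ds (R k) Ev Od) + real K * (2 * log 2 ?N)"
      by (simp add: sum_distrib_left mult.assoc)
  qed
qed

context
  fixes dA dB :: nat and \<rho> :: "complex mat"
  assumes \<rho>: "state [dA, dB] \<rho>"
begin

text \<open>As the shift \<open>s\<close> varies, block \<open>i\<close> passes through every
  \<open>\<tau> l\<close> exactly once, so its reduction is the average
  \<open>tpow \<rho> m\<close>, all of whose copies are \<open>\<rho>\<close>. A shift only permutes
  the blocks and leaves the entropies of the A-part, the B-part and the whole unchanged.\<close>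

lemma cyclic_broadcast:
  assumes n: "n \<ge> 1" and st: "\<And>i. i < n \<Longrightarrow> state (nds dA dB m) (\<tau> i)"
    and avg: "emix (prod_list (nds dA dB m)) {..<n} (\<lambda>_. 1 / real n) \<tau> = tpow \<rho> m"
  shows "\<exists>\<sigma>. broadcast dA dB \<rho> (n * m) \<sigma> \<and>
    mutinf (nds dA dB (n * m)) \<sigma> Ev Od \<le> 2 * log 2 (real n) + (\<Sum>i<n. mutinf (nds dA dB m) (\<tau> i) Ev Od)"
proof -
  let ?D = "nds dA dB m" and ?E = "nds dA dB (n * m)"
  let ?P = "\<lambda>s. prodst (\<lambda>i. \<tau> ((i + s) mod n)) n"
  let ?q = "\<lambda>_::nat. 1 / real n"
  define \<sigma> where "\<sigma> = emix (prod_list ?E) {..<n} ?q ?P"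
  have st': "state ?D (\<tau> (i mod n))" for i using st n by simp
  have P: "state ?E (?P s)" for s by (rule state_prodst) (rule st')
  have q: "(\<Sum>s<n. ?q s) = 1" using n by simp
  have q0: "?q s \<ge> 0" for s by simp
  have P': "\<And>s. s \<in> {..<n} \<Longrightarrow> state ?E (?P s)" using P by blast
  note mb = emix_bounds[of "{..<n}" ?q ?E ?P, OF finite_lessThan q0 q P', folded \<sigma>_def]
  have \<sigma>: "state ?E \<sigma>" by (rule mb(1))
  have e: "(\<Sum>s<n. ?q s * ent ?E (?P s) S) = (\<Sum>i<n. ent ?D (\<tau> i) S)"
    if inv: "\<And>j. {p. p + length (nds dA dB j) \<in> S} = S" for S
  proof -
    have "ent ?E (?P s) S = (\<Sum>i<n. ent ?D (\<tau> i) S)" for s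
    proof -
      have "ent ?E (?P s) S = (\<Sum>i<n. ent ?D (\<tau> ((i + s) mod n)) S)"
        by (rule ent_prodst[OF st' inv])
      also have "\<dots> = (\<Sum>i<n. ent ?D (\<tau> i) S)"
        using sum.reindex_bij_betw[OF bij_betw_cyclic_shift[of s n], of "\<lambda>i. ent ?D (\<tau> i) S"] by (simp add: add.commute)
      finally show ?thesis .
    qed
    then show ?thesis using n by simp
  qed
  have H: "(\<Sum>s<n. eta (?q s)) = log 2 (real n)"
    using n by (simp add: eta_def log_divide)
  have "ent ?E \<sigma> Ev \<le> log 2 (real n) + (\<Sum>i<n. ent ?D (\<tau> i) Ev)"
    using mb(3)[of Ev] unfolding H e[OF shift_nds(1)] .
  moreover have "ent ?E \<sigma> Od \<le> log 2 (real n) + (\<Sum>i<n. ent ?D (\<tau> i) Od)"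
    using mb(3)[of Od] unfolding H e[OF shift_nds(2)] .
  \<comment> \<open>The joint entropy enters with a minus sign, so concavity is the right bound for
    it, and only the two local entropies cost a term \<open>log 2 n\<close>.\<close>
  moreover have "(\<Sum>i<n. ent ?D (\<tau> i) (Ev \<union> Od)) \<le> ent ?E \<sigma> (Ev \<union> Od)"
  proof -
    have "{p. p + length (nds dA dB j) \<in> Ev \<union> Od} = Ev \<union> Od" for j by auto
    then show ?thesis using mb(2)[of "Ev \<union> Od"] e[of "Ev \<union> Od"] by simp
  qed
  ultimately have I: "mutinf ?E \<sigma> Ev Od \<le> 2 * log 2 (real n) + (\<Sum>i<n. mutinf ?D (\<tau> i) Ev Od)"
    unfolding mutinf_def sum_subtractf sum.distrib by linarith
  have "ptrace ?E {2 * k, 2 * k + 1} \<sigma> = \<rho>" if k: "k < n * m" for k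
  proof -
    define i j where "i = k div m" and "j = k mod m"
    have "m > 0" using k by (cases m) auto
    then have ij: "k = i * m + j" "i < n" "j < m" unfolding i_def j_def using k by (auto intro: less_mult_imp_div_less)
    let ?S = "{2 * k, 2 * k + 1}" and ?T = "{2 * j, 2 * j + 1}"
    have pP: "ptrace ?E ?S (?P s) = ptrace ?D ?T (\<tau> ((i + s) mod n))" for s
      unfolding ij(1) by (rule ptrace_prodst[OF st' ij(2,3)])
    have \<tau>m: "ptrace ?D ?T (emix (prod_list ?D) {..<n} ?q \<tau>) = emix (prod_list (nths ?D ?T)) {..<n} ?q (\<lambda>i. ptrace ?D ?T (\<tau> i))"
      by (rule ptrace_emix) (use n st in auto)
    \<comment> \<open>The dimensions are read off from an equality of matrices, which spares a
      computation with \<open>nths\<close> on lists of different length.\<close>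
    have "dim_row (ptrace ?E ?S (?P 0)) = dim_row (ptrace ?D ?T (\<tau> (i mod n)))" using pP[of 0] by simp
    then have dim: "prod_list (nths ?E ?S) = prod_list (nths ?D ?T)" unfolding ptrace_def by simp
    have "ptrace ?E ?S \<sigma> = emix (prod_list (nths ?E ?S)) {..<n} ?q (\<lambda>s. ptrace ?E ?S (?P s))"
      unfolding \<sigma>_def by (rule ptrace_emix) (use n P in auto)
    also have "\<dots> = emix (prod_list (nths ?D ?T)) {..<n} ?q (\<lambda>i. ptrace ?D ?T (\<tau> i))"
      unfolding dim pP emix_def
      using sum.reindex_bij_betw[OF bij_betw_cyclic_shift[of i n], of "\<lambda>l. complex_of_real (1 / real n) * ptrace ?D ?T (\<tau> l) $$ _"] by simp
    also have "\<dots> = ptrace ?D ?T (tpow \<rho> m)" unfolding \<tau>m[symmetric] avg ..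
    also have "\<dots> = \<rho>" using broadcast_tpow[OF \<rho>, of m] ij(3) unfolding broadcast_def[OF \<rho>] by simp
    finally show ?thesis .
  qed
  then show ?thesis using \<sigma> I unfolding broadcast_def[OF \<rho>] by blast
qed

text \<open>The constant \<open>B\<close> comes from rounding and depends only on the ensemble and
  on \<open>m\<close>; the logarithm comes from averaging over the \<open>n\<close> shifts.\<close>

lemma Inf_bvals_le_ens:
  assumes "v \<in> ens dA dB \<rho> m"
  shows "\<exists>B. \<forall>n\<ge>1. Inf (bvals dA dB \<rho> (n * m)) \<le> real n * v + B + 2 * log 2 (real n)"
proof -
  obtain K :: nat and p R where v: "v = (\<Sum>k<K. p k * mutinf (nds dA dB m) (R k) Ev Od)"
    "\<forall>k<K. p k \<ge> 0 \<and> state (nds dA dB m) (R k)" "(\<Sum>k<K. p k) = 1"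
    "emix (prod_list (nds dA dB m)) {..<K} p R = tpow \<rho> m"
    using assms unfolding ens_def[OF \<rho>] ensemble_values_def by blast
  show ?thesis
  proof (intro exI allI impI)
    fix n :: nat assume n: "n \<ge> 1"
    obtain \<tau> where \<tau>: "\<forall>i<n. state (nds dA dB m) (\<tau> i)"
      "emix (prod_list (nds dA dB m)) {..<n} (\<lambda>_. 1 / real n) \<tau> = emix (prod_list (nds dA dB m)) {..<K} p R"
      "(\<Sum>i<n. mutinf (nds dA dB m) (\<tau> i) Ev Od) \<le> real n * v + real K * (2 * log 2 (prod_list (nds dA dB m)))"
      using ensemble_discretise[of K p "nds dA dB m" R n] v n by blast
    obtain \<sigma> where \<sigma>: "broadcast dA dB \<rho> (n * m) \<sigma>"
      "mutinf (nds dA dB (n * m)) \<sigma> Ev Od \<le> 2 * log 2 (real n) + (\<Sum>i<n. mutinf (nds dA dB m) (\<tau> i) Ev Od)"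
      using cyclic_broadcast[OF n, of m \<tau>] \<tau> v(4) by auto
    have "Inf (bvals dA dB \<rho> (n * m)) \<le> mutinf (nds dA dB (n * m)) \<sigma> Ev Od"
      using \<sigma>(1) by (intro cInf_lower bvals_bdd[OF \<rho>]) (auto simp: bvals_def[OF \<rho>])
    then show "Inf (bvals dA dB \<rho> (n * m)) \<le> real n * v + real K * (2 * log 2 (prod_list (nds dA dB m))) + 2 * log 2 (real n)"
      using \<sigma>(2) \<tau>(3) by linarith
  qed
qed

lemma log_over_n_tendsto_0: "(\<lambda>n. log 2 (real n) / real n) \<longlonglongrightarrow> 0"
proof -
  have "(\<lambda>n. ln (real n) / real n) \<longlonglongrightarrow> 0"
    by (rule filterlim_compose[OF ln_x_over_x_tendsto_0 filterlim_real_sequentially])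
  then have "(\<lambda>n. ln (real n) / real n / ln 2) \<longlonglongrightarrow> 0 / ln 2" by (intro tendsto_divide tendsto_const) auto
  then show ?thesis by (simp add: log_def field_simps)
qed

text \<open>Two limits in turn: for fixed \<open>m\<close> and a fixed ensemble, \<open>n\<close>
  tends to infinity along the subsequence \<open>n * m\<close>, which removes \<open>B\<close> and
  the logarithm; then the infimum over ensembles is taken and \<open>m\<close> tends to
  infinity.\<close>

lemma Ib_reg_le_Esq_C_reg: "Ib_reg dA dB \<rho> \<le> 2 * Esq_C_reg dA dB \<rho>"
proof -
  let ?L = "Ib_reg dA dB \<rho>"
  have le: "?L \<le> v / real m" if m: "m \<ge> 1" and v: "v \<in> ens dA dB \<rho> m" for m v
  proof -
    obtain B where B: "\<forall>n\<ge>1. Inf (bvals dA dB \<rho> (n * m)) \<le> real n * v + B + 2 * log 2 (real n)"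
      using Inf_bvals_le_ens[OF v] by blast
    have "strict_mono (\<lambda>n. n * m)" using m by (intro strict_monoI) simp
    then have lim: "(\<lambda>n. Inf (bvals dA dB \<rho> (n * m)) / real (n * m)) \<longlonglongrightarrow> ?L"
      using LIMSEQ_subseq_LIMSEQ[OF Ib_reg_lim[OF \<rho>], of "\<lambda>n. n * m"] by (simp add: comp_def)
    have "(\<lambda>n. (v + B * inverse (real n) + 2 * (log 2 (real n) / real n)) / real m) \<longlonglongrightarrow> (v + B * 0 + 2 * 0) / real m"
      by (intro tendsto_intros lim_inverse_n log_over_n_tendsto_0) (use m in auto)
    then have lim': "(\<lambda>n. (v + B * inverse (real n) + 2 * (log 2 (real n) / real n)) / real m) \<longlonglongrightarrow> v / real m" by simp
    show ?thesis
    proof (rule LIMSEQ_le[OF lim lim'], intro exI allI impI)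
      fix n :: nat assume n: "n \<ge> 1"
      have "Inf (bvals dA dB \<rho> (n * m)) / real (n * m) \<le> (real n * v + B + 2 * log 2 (real n)) / real (n * m)"
        using B n by (intro divide_right_mono) auto
      also have "\<dots> = (v + B * inverse (real n) + 2 * (log 2 (real n) / real n)) / real m"
        using n m by (simp add: field_simps)
      finally show "Inf (bvals dA dB \<rho> (n * m)) / real (n * m) \<le> (v + B * inverse (real n) + 2 * (log 2 (real n) / real n)) / real m" .
    qed
  qed
  have "?L \<le> Inf (ens dA dB \<rho> m) / real m" if m: "m \<ge> 1" for m
  proof -
    have "?L * real m \<le> Inf (ens dA dB \<rho> m)"
      using le[OF m] m by (intro cInf_greatest ens_nonempty[OF \<rho>]) (simp add: field_simps)
    then show ?thesis using m by (simp add: field_simps)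
  qed
  then show ?thesis by (intro LIMSEQ_le_const[OF Esq_C_reg_props(1)[OF \<rho>]]) blast
qed

end

subsection \<open>Conditional entanglement of mutual information\<close>

lemma nths_pair: "Suc j < length xs \<Longrightarrow> nths xs {j, Suc j} = [xs ! j, xs ! Suc j]"
proof (induction xs arbitrary: j)
  case (Cons x xs)
  show ?case
  proof (cases j)
    case 0
    have "nths xs {i. Suc i \<in> {0, Suc 0}} = [xs ! 0]"
    proof (cases xs)
      case (Cons y ys)
      have e: "{i. Suc i \<in> {0, Suc 0}} = {0::nat}" by auto
      show ?thesis unfolding e Cons by (simp add: nths_Cons)
    qed (use Cons.prems 0 in simp)
    then show ?thesis using 0 by (simp add: nths_Cons)
  next
    case (Suc i)
    have "{l. Suc l \<in> {j, Suc j}} = {i, Suc i}" using Suc by auto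
    then show ?thesis using Cons Suc by (simp add: nths_Cons)
  qed
qed simp

text \<open>Grouping the first \<open>k\<close> copies: system 0, 1 are the A- and B-part of copy \<open>k\<close>, system 2
  (resp. 3) collects the A-parts (resp. B-parts) of the earlier copies.\<close>
lemma regroup:
  assumes st: "state (nds dA dB n) \<sigma>" and k: "k < n" and pt: "ptrace (nds dA dB n) {2*k, 2*k+1} \<sigma> = \<rho>"
  shows "\<exists>a b \<sigma>'. is_ext [dA,dB] \<rho> [a,b] \<sigma>' \<and>
    mutinf [dA,dB,a,b] \<sigma>' {0,2} {1,3} - mutinf [dA,dB,a,b] \<sigma>' {2} {3} =
    mutinf (nds dA dB n) \<sigma> (Apos (Suc k)) (Bpos (Suc k)) - mutinf (nds dA dB n) \<sigma> (Apos k) (Bpos k)"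
proof -
  define ds where "ds = nds dA dB n"
  let ?N = "prod_list ds"
  have st: "state ds \<sigma>" using st unfolding ds_def .
  note D = stateD[OF st]
  have len: "length ds = 2 * n" unfolding ds_def by (rule length_nds)
  have nth: "ds ! (2 * k) = dA" "ds ! Suc (2 * k) = dB" unfolding ds_def using nds_nth[OF k] by auto
  define a where "a = prod_list (nths ds (Apos k))"
  define b where "b = prod_list (nths ds (Bpos k))"
  define es where "es = [dA, dB, a, b]"
  let ?M = "prod_list es"
  define xs where "xs w = [dig ds w (2 * k), dig ds w (Suc (2 * k)), restr ds (Apos k) w, restr ds (Bpos k) w]" for w
  define lm where "lm w = enc es (xs w)" for w
  \<comment> \<open>The part to be traced out: the copies after copy \<open>k\<close>.\<close>
  define lm' where "lm' w = lab ds {p. p \<ge> 2 * k + 2} w" for w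
  have valid: "list_all2 (<) (xs w) es" for w
    using dig_less[OF D(3), of "2 * k" w] dig_less[OF D(3), of "Suc (2 * k)" w] restr_less[OF D(3)] k nth
    unfolding xs_def es_def a_def b_def len by simp
  have lm_less: "lm w < ?M" for w unfolding lm_def by (rule enc_less[OF valid])
  have dg: "dig es (lm w) 0 = dig ds w (2 * k)" "dig es (lm w) 1 = dig ds w (Suc (2 * k))"
    "dig es (lm w) 2 = restr ds (Apos k) w" "dig es (lm w) 3 = restr ds (Bpos k) w" for w
    using dig_enc[OF valid[of w], of 0] dig_enc[OF valid[of w], of 1] dig_enc[OF valid[of w], of 2] dig_enc[OF valid[of w], of 3]
    unfolding lm_def es_def xs_def by (simp_all add: numeral_2_eq_2 numeral_3_eq_3)
  have all4: "(\<forall>p<length es. P p) \<longleftrightarrow> P 0 \<and> P 1 \<and> P 2 \<and> P 3" for P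
    unfolding es_def by (auto simp: less_Suc_eq numeral_2_eq_2 numeral_3_eq_3)
  \<comment> \<open>Dictionary between the four grouped systems and the original positions.\<close>
  have key: "lab es T (lm v) = lab es T (lm w) \<longleftrightarrow>
      (0 \<in> T \<longrightarrow> dig ds v (2 * k) = dig ds w (2 * k)) \<and> (1 \<in> T \<longrightarrow> dig ds v (Suc (2 * k)) = dig ds w (Suc (2 * k))) \<and>
      (2 \<in> T \<longrightarrow> (\<forall>p<length ds. p \<in> Apos k \<longrightarrow> dig ds v p = dig ds w p)) \<and>
      (3 \<in> T \<longrightarrow> (\<forall>p<length ds. p \<in> Bpos k \<longrightarrow> dig ds v p = dig ds w p))" for T v w
    unfolding lab_eq_iff all4 dg restr_eq_iff[OF D(3)] by blast
  have cl: "p = 2 * k \<or> p = Suc (2 * k) \<or> p \<in> Apos k \<or> p \<in> Bpos k \<or> p \<ge> 2 * k + 2" for p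
    unfolding Apos_def Bpos_def by auto
  have ex: "2 * k \<notin> Apos k" "2 * k \<notin> Bpos k" "Suc (2 * k) \<notin> Apos k" "Suc (2 * k) \<notin> Bpos k" "Apos k \<inter> Bpos k = {}"
    "\<And>p. p \<in> Apos k \<Longrightarrow> \<not> 2 * k + 2 \<le> p" "\<And>p. p \<in> Bpos k \<Longrightarrow> \<not> 2 * k + 2 \<le> p"
    unfolding Apos_def Bpos_def by auto
  define G where "G = red {..<?N} (mk \<sigma>) lm lm'"
  define \<sigma>' where "\<sigma>' = mat ?M ?M (\<lambda>(i,j). G i j)"
  have mk: "mk \<sigma>' = G"
  proof (intro ext)
    fix i j
    show "mk \<sigma>' i j = G i j"
    proof (cases "i < ?M \<and> j < ?M")
      case True
      then show ?thesis unfolding mk_def \<sigma>'_def by simp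
    next
      case False
      then have "G i j = 0" unfolding G_def using lm_less by (intro red_outside) auto
      then show ?thesis using False unfolding mk_def \<sigma>'_def by auto
    qed
  qed
  have "dens (lm ` {..<?N}) G" unfolding G_def
  proof (rule dens_red[OF D(2)], rule inj_onI)
    fix v w assume vw: "v \<in> {..<?N}" "w \<in> {..<?N}" "(lm v, lm' v) = (lm w, lm' w)"
    then have *: "lab es UNIV (lm v) = lab es UNIV (lm w)" "lm' v = lm' w" by auto
    have "\<forall>p<length ds. dig ds v p = dig ds w p"
    proof (intro allI impI)
      fix p assume p: "p < length ds"
      show "dig ds v p = dig ds w p"
        using *(1)[unfolded key] *(2)[unfolded lm'_def lab_eq_iff] cl[of p] p by auto
    qed
    then show "v = w" using index_eq_iff[of v ds w] vw by simp
  qed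
  then have "dens {..<?M} (mk \<sigma>')" unfolding mk by (rule dens_mono) (use lm_less in auto)
  then have st': "state es \<sigma>'" by (intro stateI) (auto simp: \<sigma>'_def)
  have im: "finite {..<?M}" "lm ` {..<?N} \<subseteq> {..<?M}" using lm_less by auto
  \<comment> \<open>As \<open>\<sigma>'\<close> is itself a reduction of \<open>\<sigma>\<close>,
    \<open>red_red\<close> writes each of its entropies as an entropy of \<open>\<sigma>\<close>,
    with \<open>S\<close> collecting the positions grouped under \<open>T\<close>.\<close>
  have ent': "ent es \<sigma>' T = ent ds \<sigma> S"
    if S: "\<And>p. p < length ds \<Longrightarrow> p \<in> S \<longleftrightarrow> (p = 2 * k \<and> 0 \<in> T) \<or> (p = Suc (2 * k) \<and> 1 \<in> T) \<or> (p \<in> Apos k \<and> 2 \<in> T) \<or> (p \<in> Bpos k \<and> 3 \<in> T)"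
    for S T
  proof -
    have "ent es \<sigma>' T = kent (red {..<?N} (mk \<sigma>) (\<lambda>w. lab es T (lm w)) (\<lambda>w. (lab es (- T) (lm w), lm' w)))"
      unfolding ent_lab[OF st'] mk G_def red_red[OF im] ..
    also have "\<dots> = ent ds \<sigma> S"
    proof (rule ent_labels[OF st, symmetric])
      fix v w
      have kl: "2 * k < length ds" "Suc (2 * k) < length ds" using k len by auto
      show "(lab es T (lm v) = lab es T (lm w)) = (\<forall>p<length ds. p \<in> S \<longrightarrow> dig ds v p = dig ds w p)"
        unfolding key using S kl by blast
      show "((lab es (- T) (lm v), lm' v) = (lab es (- T) (lm w), lm' w)) = (\<forall>p<length ds. p \<notin> S \<longrightarrow> dig ds v p = dig ds w p)"
      proof
        assume "(lab es (- T) (lm v), lm' v) = (lab es (- T) (lm w), lm' w)"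
        then have *: "lab es (- T) (lm v) = lab es (- T) (lm w)" "lm' v = lm' w" by auto
        show "\<forall>p<length ds. p \<notin> S \<longrightarrow> dig ds v p = dig ds w p"
        proof (intro allI impI)
          fix p assume p: "p < length ds" "p \<notin> S"
          show "dig ds v p = dig ds w p"
            using *(1)[unfolded key] *(2)[unfolded lm'_def lab_eq_iff] cl[of p] S[OF p(1)] p by auto
        qed
      next
        assume *: "\<forall>p<length ds. p \<notin> S \<longrightarrow> dig ds v p = dig ds w p"
        have "lab es (- T) (lm v) = lab es (- T) (lm w)"
          unfolding key using * S kl ex(1-5) by auto
        moreover have "lm' v = lm' w"
          unfolding lm'_def lab_eq_iff using * S ex(6,7) by auto
        ultimately show "(lab es (- T) (lm v), lm' v) = (lab es (- T) (lm w), lm' w)" by simp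
      qed
    qed
    finally show ?thesis .
  qed
  have A: "Apos (Suc k) = insert (2 * k) (Apos k)" and B: "Bpos (Suc k) = insert (Suc (2 * k)) (Bpos k)"
    unfolding Apos_def Bpos_def by (auto simp: less_Suc_eq)
  have e1: "ent es \<sigma>' {0,2} = ent ds \<sigma> (Apos (Suc k))" "ent es \<sigma>' {1,3} = ent ds \<sigma> (Bpos (Suc k))"
    "ent es \<sigma>' ({0,2} \<union> {1,3}) = ent ds \<sigma> (Apos (Suc k) \<union> Bpos (Suc k))"
    "ent es \<sigma>' {2} = ent ds \<sigma> (Apos k)" "ent es \<sigma>' {3} = ent ds \<sigma> (Bpos k)"
    "ent es \<sigma>' ({2} \<union> {3}) = ent ds \<sigma> (Apos k \<union> Bpos k)"
    by (rule ent'; auto simp: A B)+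
  have "ptrace es {0..<2} \<sigma>' = \<rho>"
  proof -
    \<comment> \<open>Being an extension is an equality of matrices, so the encoded values of both
      reductions must coincide, not only the partitions they induce.\<close>
    have r1: "restr es {0..<2} (lm w) = enc [dA, dB] [dig ds w (2 * k), dig ds w (Suc (2 * k))]" for w
    proof -
      have "map (dig es (lm w)) [0..<length es] = [dig es (lm w) 0, dig es (lm w) 1, dig es (lm w) 2, dig es (lm w) 3]"
        unfolding es_def by (simp add: upt_rec numeral_2_eq_2 numeral_3_eq_3)
      then show ?thesis unfolding restr_def dg unfolding es_def by (simp add: nths_Cons)
    qed
    have r2: "restr ds {2*k, 2*k+1} w = enc [dA, dB] [dig ds w (2 * k), dig ds w (Suc (2 * k))]" for w
    proof -
      have "Suc (2 * k) < length ds" using k len by simp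
      then show ?thesis unfolding restr_def using nths_pair[of "2 * k" ds] nths_pair[of "2 * k" "map (dig ds w) [0..<length ds]"] nth
        by simp
    qed
    have kl: "2 * k < length ds" "Suc (2 * k) < length ds" using k len by auto
    have "mk (ptrace es {0..<2} \<sigma>') = red {..<?N} (mk \<sigma>) (\<lambda>w. restr es {0..<2} (lm w)) (\<lambda>w. (lab es (- {0..<2}) (lm w), lm' w))"
      unfolding mk_ptrace[OF st'] mk G_def red_red[OF im] ..
    also have "\<dots> = red {..<?N} (mk \<sigma>) (restr ds {2*k, 2*k+1}) (lab ds (- {2*k, 2*k+1}))"
    proof (rule red_cong)
      fix v w
      show "((lab es (- {0..<2}) (lm v), lm' v) = (lab es (- {0..<2}) (lm w), lm' w)) =
        (lab ds (- {2*k, 2*k+1}) v = lab ds (- {2*k, 2*k+1}) w)"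
      proof
        assume "(lab es (- {0..<2}) (lm v), lm' v) = (lab es (- {0..<2}) (lm w), lm' w)"
        then have *: "lab es (- {0..<2}) (lm v) = lab es (- {0..<2}) (lm w)" "lm' v = lm' w" by auto
        show "lab ds (- {2*k, 2*k+1}) v = lab ds (- {2*k, 2*k+1}) w"
          unfolding lab_eq_iff
        proof (intro allI impI)
          fix p assume p: "p < length ds" "p \<in> - {2*k, 2*k+1}"
          show "dig ds v p = dig ds w p"
            using *(1)[unfolded key] *(2)[unfolded lm'_def lab_eq_iff] cl[of p] p by auto
        qed
      next
        assume *: "lab ds (- {2*k, 2*k+1}) v = lab ds (- {2*k, 2*k+1}) w"
        have "lab es (- {0..<2}) (lm v) = lab es (- {0..<2}) (lm w)"
          unfolding key using *[unfolded lab_eq_iff] ex(1-5) by auto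
        moreover have "lm' v = lm' w"
          unfolding lm'_def lab_eq_iff using *[unfolded lab_eq_iff] by auto
        ultimately show "(lab es (- {0..<2}) (lm v), lm' v) = (lab es (- {0..<2}) (lm w), lm' w)" by simp
      qed
    qed (simp_all add: r1 r2[simplified])
    also have "\<dots> = mk \<rho>" unfolding mk_ptrace[OF st, symmetric] using pt unfolding ds_def by simp
    finally have m: "mk (ptrace es {0..<2} \<sigma>') = mk \<rho>" .
    have n1: "nths es {0..<2} = [dA, dB]" unfolding es_def by (simp add: nths_Cons)
    have n2: "nths ds {2*k, 2*k+1} = [dA, dB]" using nths_pair[of "2 * k" ds] kl nth by simp
    show ?thesis
    proof (rule mk_inject)
      show "ptrace es {0..<2} \<sigma>' \<in> carrier_mat (prod_list [dA,dB]) (prod_list [dA,dB])"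
        using ptrace_carrier[of es "{0..<2}" \<sigma>'] unfolding n1 .
      show "\<rho> \<in> carrier_mat (prod_list [dA,dB]) (prod_list [dA,dB])"
        using ptrace_carrier[of ds "{2*k,2*k+1}" \<sigma>, unfolded n2] pt unfolding ds_def by simp
    qed (simp add: m)
  qed
  then have "is_ext [dA,dB] \<rho> [a,b] \<sigma>'"
    using st' unfolding is_ext_def es_def by (simp add: numeral_2_eq_2)
  moreover have "mutinf es \<sigma>' {0,2} {1,3} - mutinf es \<sigma>' {2} {3} =
    mutinf ds \<sigma> (Apos (Suc k)) (Bpos (Suc k)) - mutinf ds \<sigma> (Apos k) (Bpos k)"
    unfolding mutinf_def e1 ..
  ultimately show ?thesis unfolding es_def ds_def by blast
qed

text \<open>Merging the trailing systems \<open>es\<close> into one system does not change the index encoding.\<close>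
lemma state_merge: "state (ds @ es) \<sigma> \<longleftrightarrow> state (ds @ [prod_list es]) \<sigma>"
  unfolding state_def by simp

lemma ent_merge:
  assumes st: "state (ds @ es) \<sigma>"
    and S: "\<And>p. p < length ds \<Longrightarrow> p \<in> S \<longleftrightarrow> p \<in> T" "\<And>p. p \<ge> length ds \<Longrightarrow> p \<in> S \<longleftrightarrow> length ds \<in> T"
  shows "ent (ds @ [prod_list es]) \<sigma> T = ent (ds @ es) \<sigma> S"
proof -
  let ?P = "prod_list es"
  have pos: "?P > 0" using stateD(3)[OF st] by (auto intro!: Nat.gr0I)
  have st': "state (ds @ [?P]) \<sigma>" using st state_merge by blast
  have eqv: "lab (ds @ [?P]) T k = lab (ds @ [?P]) T l \<longleftrightarrow> (\<forall>p<length (ds @ es). p \<in> S \<longrightarrow> dig (ds @ es) k p = dig (ds @ es) l p)"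
    if S: "\<And>p. p < length ds \<Longrightarrow> p \<in> S \<longleftrightarrow> p \<in> T" "\<And>p. p \<ge> length ds \<Longrightarrow> p \<in> S \<longleftrightarrow> length ds \<in> T" for S T k l
  proof -
    have 1: "lab ds T = lab ds S" using S(1) by (auto simp: lab_def fun_eq_iff)
    have 2: "lab [?P] {p. p + length ds \<in> T} (k mod ?P) = lab [?P] {p. p + length ds \<in> T} (l mod ?P) \<longleftrightarrow>
      lab es {p. p + length ds \<in> S} (k mod ?P) = lab es {p. p + length ds \<in> S} (l mod ?P)"
    proof (cases "length ds \<in> T")
      case True
      \<comment> \<open>Agreement in all digits of the remainder is equality of the remainder, which
        is the single digit of the merged system.\<close>
      then have "{p. p + length ds \<in> S} = UNIV" using S(2) by auto
      then show ?thesis using True index_eq_iff[of "k mod ?P" es "l mod ?P"] pos by (auto simp: lab_eq_iff dig_def)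
    next
      case False
      then have "{p. p + length ds \<in> S} = {}" using S(2) by auto
      then show ?thesis using False by (auto simp: lab_eq_iff)
    qed
    show ?thesis unfolding agree_append using agree_append[of ds "[?P]" T k l] 1 2 by (simp add: lab_eq_iff[of "ds @ [?P]"])
  qed
  show ?thesis unfolding ent_lab[OF st']
  proof -
    have "kent (red {..<prod_list (ds @ es)} (mk \<sigma>) (lab (ds @ [?P]) T) (lab (ds @ [?P]) (- T))) = ent (ds @ es) \<sigma> S"
      using S eqv[of S T] eqv[of "- S" "- T"] by (intro ent_labels[OF st, symmetric]) auto
    then show "kent (red {..<prod_list (ds @ [?P])} (mk \<sigma>) (lab (ds @ [?P]) T) (lab (ds @ [?P]) (- T))) = ent (ds @ es) \<sigma> S"
      by simp
  qed
qed

lemma ptrace_merge: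
  assumes st: "state (ds @ es) \<sigma>"
  shows "ptrace (ds @ [prod_list es]) {0..<length ds} \<sigma> = ptrace (ds @ es) {0..<length ds} \<sigma>"
proof (rule mk_inject)
  let ?P = "prod_list es"
  have pos: "?P > 0" using stateD(3)[OF st] by (auto intro!: Nat.gr0I)
  have st': "state (ds @ [?P]) \<sigma>" using st state_merge by blast
  have n: "nths (ds @ fs) {0..<length ds} = ds" for fs by (simp add: nths_append nths_all)
  show "ptrace (ds @ [?P]) {0..<length ds} \<sigma> \<in> carrier_mat (prod_list ds) (prod_list ds)"
    "ptrace (ds @ es) {0..<length ds} \<sigma> \<in> carrier_mat (prod_list ds) (prod_list ds)"
    using ptrace_carrier[of "ds @ [?P]" "{0..<length ds}" \<sigma>] ptrace_carrier[of "ds @ es" "{0..<length ds}" \<sigma>] unfolding n by auto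
  fix i j
  have r: "restr (ds @ fs) {0..<length ds} k = restr ds {0..<length ds} (k div prod_list fs)" for fs k
    unfolding restr_append by (simp add: restr_def enc_def)
  have s: "{p. p + length ds \<in> - {0..<length ds}} = UNIV" by auto
  have z: "lab ds (- {0..<length ds}) k = (\<lambda>_. 0)" for k by (auto simp: lab_def)
  have l: "lab (ds @ fs) (- {0..<length ds}) k = lab (ds @ fs) (- {0..<length ds}) l \<longleftrightarrow> k mod prod_list fs = l mod prod_list fs"
    if "prod_list fs > 0" for fs k l
    using agree_append[of ds fs "- {0..<length ds}" k l] index_eq_iff[of "k mod prod_list fs" fs "l mod prod_list fs"] that
    unfolding s z by (simp add: lab_eq_iff[of "ds @ fs"] lab_eq_iff[of fs])
  have "mk (ptrace (ds @ [?P]) {0..<length ds} \<sigma>) = mk (ptrace (ds @ es) {0..<length ds} \<sigma>)"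
    unfolding mk_ptrace[OF st] mk_ptrace[OF st'] using l[of es] l[of "[?P]"] pos
    by simp (rule red_cong, simp_all add: r)
  then show "mk (ptrace (ds @ [?P]) {0..<length ds} \<sigma>) i j = mk (ptrace (ds @ es) {0..<length ds} \<sigma>) i j" by simp
qed

section \<open>Value sets of the two quantum measures\<close>

definition Esq_Q_values where
  "Esq_Q_values dA dB \<rho> = {mutinf [dA,dB,dE] \<sigma> {0} {1,2} - mutinf [dA,dB,dE] \<sigma> {0} {2}
      | dE \<sigma>. is_ext [dA,dB] \<rho> [dE] \<sigma>}"

definition E_I_values where
  "E_I_values dA dB \<rho> = {mutinf [dA,dB,a,b] \<sigma> {0,2} {1,3} - mutinf [dA,dB,a,b] \<sigma> {2} {3}
      | a b \<sigma>. is_ext [dA,dB] \<rho> [a,b] \<sigma>}"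

text \<open>The difference is the conditional mutual information \<open>I(A:B|E)\<close>, so this is
  strong subadditivity.\<close>

lemma Esq_Q_values_nonneg:
  assumes "v \<in> Esq_Q_values dA dB \<rho>"
  shows "v \<ge> 0"
proof -
  obtain dE \<sigma> where v: "v = mutinf [dA,dB,dE] \<sigma> {0} {1,2} - mutinf [dA,dB,dE] \<sigma> {0} {2}" "state [dA,dB,dE] \<sigma>"
    using assms unfolding Esq_Q_values_def is_ext_def by auto
  have "{0} \<union> {2} \<union> {1} = {0} \<union> {1,2::nat}" "{2} \<union> {1} = {1,2::nat}" by auto
  then show ?thesis using ent_strong_subadditivity[OF v(2), of "{0}" "{2}" "{1}"]
    unfolding v(1) mutinf_def by simp
qed

text \<open>With \<open>E = A'B'\<close> the value for \<open>E_I\<close> exceeds the one for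
  \<open>Esq_Q\<close> by exactly \<open>I(A:B'|A') + I(B:A'|B')\<close>, and both terms are
  nonnegative by strong subadditivity.\<close>

lemma E_I_values_dominate:
  assumes "v \<in> E_I_values dA dB \<rho>"
  shows "\<exists>u\<in>Esq_Q_values dA dB \<rho>. u \<le> v"
proof -
  obtain a b \<sigma> where v: "v = mutinf [dA,dB,a,b] \<sigma> {0,2} {1,3} - mutinf [dA,dB,a,b] \<sigma> {2} {3}" "is_ext [dA,dB] \<rho> [a,b] \<sigma>"
    using assms unfolding E_I_values_def by auto
  have st: "state ([dA,dB] @ [a,b]) \<sigma>" and pt: "ptrace ([dA,dB] @ [a,b]) {0..<length [dA,dB]} \<sigma> = \<rho>"
    using v(2) unfolding is_ext_def by auto
  let ?S = "ent ([dA,dB] @ [a,b]) \<sigma>" and ?S' = "ent ([dA,dB] @ [prod_list [a,b]]) \<sigma>"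
  have "is_ext [dA,dB] \<rho> [prod_list [a,b]] \<sigma>"
    unfolding is_ext_def using st state_merge ptrace_merge[OF st] pt by blast
  then have "mutinf [dA,dB,prod_list [a,b]] \<sigma> {0} {1,2} - mutinf [dA,dB,prod_list [a,b]] \<sigma> {0} {2} \<in> Esq_Q_values dA dB \<rho>"
    unfolding Esq_Q_values_def by blast
  moreover have "mutinf [dA,dB,prod_list [a,b]] \<sigma> {0} {1,2} - mutinf [dA,dB,prod_list [a,b]] \<sigma> {0} {2} \<le> v"
  proof -
    have p: "p \<in> {2..} \<union> S \<longleftrightarrow> p \<ge> 2 \<or> p \<in> S" for p :: nat and S by auto
    have m: "?S' {1,2} = ?S ({2..} \<union> {1})" "?S' ({0} \<union> {1,2}) = ?S ({2..} \<union> {0,1})"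
      "?S' {2} = ?S {2..}" "?S' ({0} \<union> {2}) = ?S ({2..} \<union> {0})"
      by (rule ent_merge[OF st]; auto)+
    have c: "?S ({2..} \<union> {1}) = ?S {1,2,3}" "?S ({2..} \<union> {0,1}) = ?S {0,1,2,3}" "?S {2..} = ?S {2,3}" "?S ({2..} \<union> {0}) = ?S {0,2,3}"
      by (rule ent_cong[OF _ st]; auto)+
    have "?S {0,2,3} + ?S {2} \<le> ?S {0,2} + ?S {2,3}"
      using ent_strong_subadditivity[OF st, of "{0}" "{2}" "{3}"] by (simp add: insert_commute)
    moreover have "?S {1,2,3} + ?S {3} \<le> ?S {1,3} + ?S {2,3}"
      using ent_strong_subadditivity[OF st, of "{1}" "{3}" "{2}"] by (simp add: insert_commute)
    moreover have "{0,2} \<union> {1,3} = {0,1,2,3::nat}" "{2} \<union> {3} = {2,3::nat}" by auto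
    ultimately show ?thesis unfolding v(1) mutinf_def using m c by simp
  qed
  ultimately show ?thesis by blast
qed

lemma E_I_values_nonneg: "v \<in> E_I_values dA dB \<rho> \<Longrightarrow> v \<ge> 0"
  using E_I_values_dominate Esq_Q_values_nonneg by (metis order_trans)

text \<open>\<open>regroup\<close> applied to a single copy, with no earlier copies, yields the
  extension by trivial systems.\<close>

lemma E_I_values_nonempty:
  assumes "state [dA,dB] \<rho>"
  shows "E_I_values dA dB \<rho> \<noteq> {}"
proof -
  have "{0..<length [dA, dB]} = {2 * 0, 2 * 0 + 1}" by auto
  then have "ptrace [dA, dB] {2 * 0, 2 * 0 + 1} \<rho> = \<rho>" using ptrace_full[OF assms] by metis
  then show ?thesis using regroup[of dA dB 1 \<rho> 0 \<rho>] assms unfolding E_I_values_def by (auto simp: nds_1)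
qed

lemma E_I_ge_Esq_Q:
  assumes "state [dA,dB] \<rho>"
  shows "Esq_Q dA dB \<rho> \<le> E_I dA dB \<rho>"
proof -
  have "bdd_below (Esq_Q_values dA dB \<rho>)" using Esq_Q_values_nonneg by (intro bdd_belowI[of _ 0])
  then have "Inf (Esq_Q_values dA dB \<rho>) \<le> Inf (E_I_values dA dB \<rho>)"
    using E_I_values_dominate by (intro cInf_mono E_I_values_nonempty[OF assms]) auto
  then show ?thesis unfolding Esq_Q_def E_I_def Esq_Q_values_def E_I_values_def by simp
qed

lemma Ib_reg_ge_E_I:
  assumes "state [dA,dB] \<rho>"
  shows "2 * E_I dA dB \<rho> \<le> Ib_reg dA dB \<rho>"
proof -
  let ?e = "Inf (E_I_values dA dB \<rho>)"
  have bdd: "bdd_below (E_I_values dA dB \<rho>)" using E_I_values_nonneg by (intro bdd_belowI[of _ 0])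
  have "real n * ?e \<le> v" if v: "v \<in> bvals dA dB \<rho> n" for n v
  proof -
    obtain \<sigma> where \<sigma>: "v = mutinf (nds dA dB n) \<sigma> Ev Od" "state (nds dA dB n) \<sigma>" "\<forall>k<n. ptrace (nds dA dB n) {2*k, 2*k+1} \<sigma> = \<rho>"
      using v unfolding bvals_def[OF assms] broadcast_def[OF assms] by blast
    \<comment> \<open>All partial mutual informations are taken in the same \<open>n\<close>-copy
      state, so a prefix of \<open>k\<close> copies is selected by its positions and never becomes a
      state of its own.\<close>
    have "real k * ?e \<le> mutinf (nds dA dB n) \<sigma> (Apos k) (Bpos k)" if "k \<le> n" for k
      using that
    proof (induction k)
      case 0
      have "Apos 0 = {}" "Bpos 0 = {}" by (auto simp: Apos_def Bpos_def)
      then show ?case using ent_empty[OF \<sigma>(2)] by (simp add: mutinf_def)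
    next
      case (Suc k)
      have k: "k < n" using Suc by simp
      obtain a b \<sigma>' where ext: "is_ext [dA,dB] \<rho> [a,b] \<sigma>'"
        "mutinf [dA,dB,a,b] \<sigma>' {0,2} {1,3} - mutinf [dA,dB,a,b] \<sigma>' {2} {3} =
          mutinf (nds dA dB n) \<sigma> (Apos (Suc k)) (Bpos (Suc k)) - mutinf (nds dA dB n) \<sigma> (Apos k) (Bpos k)"
        using regroup[OF \<sigma>(2) k] \<sigma>(3) k by blast
      have "mutinf (nds dA dB n) \<sigma> (Apos (Suc k)) (Bpos (Suc k)) - mutinf (nds dA dB n) \<sigma> (Apos k) (Bpos k) \<in> E_I_values dA dB \<rho>"
        unfolding E_I_values_def ext(2)[symmetric] using ext(1) by blast
      then have "?e \<le> mutinf (nds dA dB n) \<sigma> (Apos (Suc k)) (Bpos (Suc k)) - mutinf (nds dA dB n) \<sigma> (Apos k) (Bpos k)"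
        by (rule cInf_lower[OF _ bdd])
      then show ?case using Suc by (simp add: algebra_simps)
    qed
    then show ?thesis using mutinf_Apos_Bpos[OF \<sigma>(2)] \<sigma>(1) by (metis order_refl)
  qed
  then have "real n * ?e \<le> Inf (bvals dA dB \<rho> n)" for n
    by (intro cInf_greatest bvals_nonempty[OF assms])
  then have "?e \<le> Inf (bvals dA dB \<rho> n) / real n" if "n \<ge> 1" for n
    using that by (simp add: field_simps)
  then have "?e \<le> Ib_reg dA dB \<rho>" by (intro LIMSEQ_le_const[OF Ib_reg_lim[OF assms]]) blast
  then show ?thesis unfolding E_I_def E_I_values_def by simp
qed

theorem theorem3:
  fixes dA dB :: nat and \<rho> :: "complex mat"
  assumes "state [dA, dB] \<rho>"
  shows "2 * Esq_C [dA, dB] {0} {1} \<rho> \<ge> 2 * Esq_C_reg dA dB \<rho> \<and>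
         2 * Esq_C_reg dA dB \<rho> \<ge> Ib_reg dA dB \<rho> \<and>
         Ib_reg dA dB \<rho> \<ge> 2 * E_I dA dB \<rho> \<and>
         2 * E_I dA dB \<rho> \<ge> 2 * Esq_Q dA dB \<rho>"
  using Esq_C_reg_props(2)[OF assms] Ib_reg_le_Esq_C_reg[OF assms] Ib_reg_ge_E_I[OF assms] E_I_ge_Esq_Q[OF assms] by simp

end
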